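(* (1) Let $\underline C=(C_1,\dots,C_d)$ be a row contraction on a Hilbert space $\mathcal H_C$ and let $$\underline E=\begin{pmatrix}\underline C&\underline 0\\ \underline B&\underline A\end{pmatrix}$$ be a minimal contractive lifting of $\underline C$ on a Hilbert space $\mathcal H_E=\mathcal H_C\oplus\mathcal H_A$ with characteristic function $M_{C,E}:\Gamma\otimes\mathcal D_E\to\Gamma\otimes\mathcal D_C$. Then $M_{C,E}$ is purely contractive and satisfies the Szegö condition if and only if $\mathcal L_E=\mathcal L_A$ and $\mathcal L_C=\mathcal L_{*,A}$. In this case, with the canonical identifications, the characteristic function $M_{C,E}$ of the lifting $\underline E$ is equal to the characteristic function $M_{\Theta_A}:\Gamma\otimes\mathcal D_A\to\Gamma\otimes\mathcal D_{*,A}$ of the row contraction $\underline A$. (2) The characteristic function $M_{\Theta_A}$ of any completely non-coisometric row contraction $\underline A$ can be written in this form for any row contraction $\underline C$ with defect equal to $\dim\mathcal D_{*,A}$; that is, there is a minimal contractive lifting $\underline E$ of $\underline C$ with right lower corner $\underline A$ such that $\mathcal L_E=\mathcal L_A$ and $\mathcal L_C=\mathcal L_{*,A}$, so that $M_{C,E}=M_{\Theta_A}$ with the canonical identifications. (3) For completely non-coisometric row contractions $\underline A$ and $\underline A'$, the characteristic functions $M_{\Theta_A}$ and $M_{\Theta_{A'}}$ coincide if and only if $\underline A$ and $\underline A'$ are unitarily equivalent.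
   Context: Hilbert spaces are complex; $d\ge 1$ is a fixed integer. $P_X$ denotes the orthogonal projection onto $X$. **Multi-analytic operators.** $\Gamma=\bigoplus_{n\ge0}(\mathbb C^d)^{\otimes n}$ is the full Fock space, $e_\emptyset$ its vacuum vector, $L_j$ the left creation operator $L_jx=e_j\otimes x$. A bounded operator $M:\Gamma\otimes\mathcal D\to\Gamma\otimes\mathcal L$ is multi-analytic if $M(L_j\otimes I)=(L_j\otimes I)M$ for all $j$; its symbol is $\Theta:\mathcal D\to\Gamma\otimes\mathcal L$, $\Theta(\delta)=M(e_\emptyset\otimes\delta)$. A contractive ($\|M\|\le1$) multi-analytic $M$ is purely contractive if $\|P_{e_\emptyset\otimes\mathcal L}\Theta(\delta)\|<\|\delta\|$ for all $0\ne\delta\in\mathcal D$; it satisfies the Szegö condition if $\overline{\Delta(\Gamma\otimes\mathcal D)}=\overline{\Delta\big((\Gamma\otimes\mathcal D)\ominus(e_\emptyset\otimes\mathcal D)\big)}$ with $\Delta=(I-M^*M)^{1/2}$. Multi-analytic operators with symbols $\Theta:\mathcal D\to\Gamma\otimes\mathcal L$ and $\Theta':\mathcal D'\to\Gamma\otimes\mathcal L'$ coincide if there are unitaries $v_{\mathcal D}:\mathcal D\to\mathcal D'$, $v_{\mathcal L}:\mathcal L\to\mathcal L'$ with $\Theta'\circ v_{\mathcal D}=(I\otimes v_{\mathcal L})\circ\Theta$. **Row contractions and liftings.** A $d$-tuple $\underline T$ on $\mathcal H_T$ is a row contraction if $\sum_jT_jT_j^*\le I$, and a row isometry if the $T_j$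 are isometries with orthogonal ranges. $D_T=(\delta_{ij}I-T_i^*T_j)^{1/2}_{d\times d}$ on $\bigoplus_1^d\mathcal H_T$, $\mathcal D_T=\overline{\mathrm{range}\,D_T}$ is the defect space and $\dim\mathcal D_T$ the defect. $D_{*,T}=(I-\sum_jT_jT_j^* )^{1/2}$ and $\mathcal D_{*,T}=\overline{D_{*,T}\mathcal H_T}$. $\underline T$ is completely non-coisometric if $\sum_{|\alpha|=n}\|T_\alpha^*z\|^2=\|z\|^2$ for all $n\in\mathbb N$ only for $z=0$ (words $\alpha=\alpha_1\cdots\alpha_m$ in $\{1,\dots,d\}$, $|\alpha|=m$, $T_\alpha=T_{\alpha_1}\cdots T_{\alpha_m}$, $T_\emptyset=I$). $\underline A,\underline A'$ are unitarily equivalent if a unitary $u:\mathcal H_A\to\mathcal H_{A'}$ satisfies $uA_j=A_j'u$ for all $j$. A lifting of $\underline C$ is a $d$-tuple $\underline E$ on $\mathcal H_E=\mathcal H_C\oplus\mathcal H_A$ of the form $E_j=\begin{pmatrix} C_j & 0 \\ B_j & A_j \end{pmatrix}$; it is contractive if $\underline E$ is a row contraction, and minimal if $\mathcal H_E$ is the smallest closed subspace invariant under all $E_j$ and containing $\mathcal H_C$. $\underline A$ is its right lower corner. **Minimal isometric dilation.** An isometric dilation of $\underline T$ is a row isometry $\underline V$ on a space containing $\mathcal H_T$ with $T_\alpha=P_{\mathcal H_T}V_\alpha|_{\mathcal H_T}$ for all $\alpha$; it is minimal if the space is the smallest closed $\underline V$-invariant subspace containing $\mathcal H_T$. The minimal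 isometric dilation, unique up to unitary equivalence, is denoted $\underline V^T$; it is obtained from any isometric dilation $\underline V$ by restriction to the smallest closed $\underline V$-invariant subspace containing $\mathcal H_T$. In any isometric dilation $\underline V$, put $\mathcal L_T=\overline{\mathrm{span}}\{\mathcal H_T,V_1\mathcal H_T,\dots,V_d\mathcal H_T\}\ominus\mathcal H_T$ (wandering). There is a canonical unitary $\mathcal D_T\to\mathcal L_T$, $D_T(\bigoplus_i\xi_i)\mapsto\sum_i(V_i-T_i)\xi_i$, extending to the canonical unitary $K_T:\Gamma\otimes\mathcal D_T\to\bigoplus_\alpha V_\alpha\mathcal L_T$ that intertwines $L_j\otimes I$ and $V_j$. Further $\mathcal L_{*,T}=\ker(\underline V^T)^*=\bigcap_j\ker(V_j^T)^*$ (kernel in the space of $\underline V^T$), with canonical unitary $\mathcal D_{*,T}\to\mathcal L_{*,T}$, $D_{*,T}\xi\mapsto(I-\sum_iV_i^TT_i^* )\xi$, extending to $K_{*,T}:\Gamma\otimes\mathcal D_{*,T}\to\bigoplus_\alpha V^T_\alpha\mathcal L_{*,T}$ that intertwines $L_j\otimes I$ and $V^T_j$. **Characteristic function of a lifting.** For a minimal contractive lifting $\underline E$ of $\underline C$, $\underline V^E$ is an isometric dilation of $\underline E$, of $\underline C$ and of $\underline A$. The spaces $\mathcal L_E,\mathcal L_C,\mathcal L_A,\mathcal L_{*,A}$ are all formed inside the space of $\underline V^E$ (with $\underline V^A$ the restriction of $\underline V^E$ to the smallest closed invariant subspace containing $\mathcal H_A$). $M_{C,E}=K_C^*PK_E:\Gamma\otimes\mathcal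 D_E\to\Gamma\otimes\mathcal D_C$, with $P$ the orthogonal projection onto $\bigoplus_\alpha V_\alpha^E\mathcal L_C$. **Characteristic function of a completely non-coisometric row contraction.** $M_{\Theta_A}=K_{*,A}^*PK_A:\Gamma\otimes\mathcal D_A\to\Gamma\otimes\mathcal D_{*,A}$, with $P$ the orthogonal projection onto $\bigoplus_\alpha V^A_\alpha\mathcal L_{*,A}$. (The right lower corner of a minimal contractive lifting is completely non-coisometric.) "Canonical identifications" means $\mathcal D_E\cong\mathcal L_E=\mathcal L_A\cong\mathcal D_A$ and $\mathcal D_C\cong\mathcal L_C=\mathcal L_{*,A}\cong\mathcal D_{*,A}$ through the canonical unitaries. *)

theory Defs
  imports "HOL-Analysis.Analysis" "HOL-Library.Equipollence"
begin

section \<open>Complex Hilbert spaces\<close>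

text \<open>The inner product is linear in the first argument. The real structure, norm and topology
  are those of \<^class>\<open>real_inner\<close>, the real inner product being the real part of the complex one.\<close>

class complex_inner = real_inner +
  fixes scaleC :: "complex \<Rightarrow> 'a \<Rightarrow> 'a"  (infixr "*\<^sub>C" 75)
    and cinner :: "'a \<Rightarrow> 'a \<Rightarrow> complex"
  assumes scaleC_add_right: "c *\<^sub>C (x + y) = c *\<^sub>C x + c *\<^sub>C y"
    and scaleC_add_left: "(c + d) *\<^sub>C x = c *\<^sub>C x + d *\<^sub>C x"
    and scaleC_scaleC: "c *\<^sub>C d *\<^sub>C x = (c * d) *\<^sub>C x"
    and scaleC_of_real: "complex_of_real r *\<^sub>C x = r *\<^sub>R x"
    and cinner_commute: "cinner x y = cnj (cinner y x)"
    and cinner_add_left: "cinner (x + y) z = cinner x z + cinner y z"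
    and cinner_scaleC_left: "cinner (c *\<^sub>C x) y = c * cinner x y"
    and Re_cinner: "Re (cinner x y) = inner x y"

class chilbert_space = complex_inner + complete_space

lemma cinner_scaleR_left:
  fixes x y :: "'a::complex_inner" shows "cinner (r *\<^sub>R x) y = of_real r * cinner x y"
  by (metis cinner_scaleC_left scaleC_of_real)

lemma cinner_scaleC_right:
  fixes x y :: "'a::complex_inner" shows "cinner x (c *\<^sub>C y) = cnj c * cinner x y"
proof -
  have "cinner x (c *\<^sub>C y) = cnj (cinner (c *\<^sub>C y) x)" by (rule cinner_commute)
  also have "\<dots> = cnj c * cnj (cinner y x)" by (simp add: cinner_scaleC_left)
  also have "cnj (cinner y x) = cinner x y" by (rule cinner_commute [symmetric])
  finally show ?thesis .
qed

lemma cinner_self: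
  fixes x :: "'a::complex_inner" shows "cinner x x = of_real ((norm x)\<^sup>2)"
proof -
  have "Im (cinner x x) = 0" using cinner_commute[of x x]
    by (metis complex_cnj complex_eqI add.inverse_neutral complex.sel(2) complex_surj equal_neg_zero)
  then show ?thesis
    by (simp add: complex_eq_iff Re_cinner power2_norm_eq_inner)
qed

lemma Im_cinner:
  fixes x y :: "'a::complex_inner" shows "Im (cinner x y) = inner x (\<i> *\<^sub>C y)"
proof -
  have "cinner x (\<i> *\<^sub>C y) = cnj (\<i> * cinner y x)"
    by (metis cinner_commute cinner_scaleC_left)
  also have "\<dots> = - \<i> * cinner x y" by (simp add: cinner_commute[of x y])
  finally show ?thesis by (metis Re_cinner Re_i_times minus_mult_left uminus_complex.sel(1) minus_minus)
qed

lemma norm_scaleC: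
  fixes x :: "'a::complex_inner" shows "norm (c *\<^sub>C x) = cmod c * norm x"
proof -
  have "cinner (c *\<^sub>C x) (c *\<^sub>C x) = c * (cnj c * cinner x x)"
    by (metis cinner_commute cinner_scaleC_left complex_cnj_mult)
  then have "complex_of_real ((norm (c *\<^sub>C x))\<^sup>2) = of_real ((cmod c)\<^sup>2 * (norm x)\<^sup>2)"
    by (simp add: cinner_self complex_norm_square mult.assoc [symmetric] del: of_real_power)
  then have "(norm (c *\<^sub>C x))\<^sup>2 = (cmod c * norm x)\<^sup>2"
    by (simp only: of_real_eq_iff power_mult_distrib)
  then show ?thesis by (simp add: power2_eq_iff_nonneg)
qed

lemma scaleC_zero_right: "c *\<^sub>C 0 = (0::'a::complex_inner)"
  using scaleC_add_right[of c 0 "0::'a"] by simp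

lemma cinner_zero_left: "cinner 0 (x::'a::complex_inner) = 0"
  using cinner_add_left[of 0 0 x] by simp

lemma cmod_cinner_le:
  fixes x y :: "'a::complex_inner" shows "cmod (cinner x y) \<le> norm x * norm y"
proof (cases "cinner x y = 0")
  case False
  define c where "c = cnj (cinner x y) / of_real (cmod (cinner x y))"
  have c: "cmod c = 1" using False by (simp add: c_def norm_divide)
  have "cinner (c *\<^sub>C x) y = of_real (cmod (cinner x y))"
    using False by (simp add: cinner_scaleC_left c_def complex_norm_square power2_eq_square
        mult.commute[of "cnj _"] flip: complex_norm_square)
  then have "cmod (cinner x y) = inner (c *\<^sub>C x) y" by (metis Re_complex_of_real Re_cinner)
  also have "\<dots> \<le> norm (c *\<^sub>C x) * norm y" by (rule norm_cauchy_schwarz)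
  finally show ?thesis by (simp add: norm_scaleC c)
qed simp

instantiation complex :: chilbert_space
begin
definition "scaleC_complex (c::complex) (x::complex) = c * x"
definition "cinner_complex (x::complex) (y::complex) = x * cnj y"
instance
  by standard
    (auto simp: scaleC_complex_def cinner_complex_def algebra_simps scaleR_conv_of_real inner_complex_def)
end

instantiation prod :: (complex_inner, complex_inner) complex_inner
begin
definition "scaleC_prod c x = (c *\<^sub>C fst x, c *\<^sub>C snd x)"
definition "cinner_prod x y = cinner (fst x) (fst y) + cinner (snd x) (snd y)"
instance
proof
  fix x y :: "'a \<times> 'b"
  show "cinner x y = cnj (cinner y x)"
    unfolding cinner_prod_def by (metis complex_cnj_add cinner_commute)
qed (auto simp: scaleC_prod_def cinner_prod_def scaleC_add_right scaleC_add_left scaleC_scaleC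
    scaleC_of_real cinner_add_left cinner_scaleC_left Re_cinner inner_prod_def algebra_simps
    prod_eq_iff)
end

instance prod :: (chilbert_space, chilbert_space) chilbert_space ..

instantiation vec :: (complex_inner, finite) complex_inner
begin
definition "scaleC_vec c x = (\<chi> i. c *\<^sub>C (x $ i))"
definition "cinner_vec x y = (\<Sum>i\<in>UNIV. cinner (x $ i) (y $ i))"
instance
proof
  fix x y :: "'a ^ 'b"
  show "cinner x y = cnj (cinner y x)"
    unfolding cinner_vec_def cnj_sum by (intro sum.cong refl) (metis cinner_commute)
qed (auto simp: scaleC_vec_def cinner_vec_def scaleC_add_right scaleC_add_left scaleC_scaleC
    scaleC_of_real cinner_add_left cinner_scaleC_left Re_cinner inner_vec_def sum.distrib
    sum_distrib_left vec_eq_iff)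
end

instance vec :: (chilbert_space, finite) chilbert_space ..


section \<open>Square-summable families\<close>

typedef (overloaded) ('i, 'a) l2 =
  "{f :: 'i \<Rightarrow> 'a::complex_inner. (\<lambda>i. (norm (f i))\<^sup>2) summable_on UNIV}"
  morphisms coord Abs_l2
  by (rule exI[of _ "\<lambda>_. 0"]) simp

setup_lifting type_definition_l2

lemma coord_summable: "(\<lambda>i. (norm (coord x i))\<^sup>2) summable_on UNIV"
  using coord[of x] by simp

lemma l2_eqI: "(\<And>i. coord x i = coord y i) \<Longrightarrow> x = y"
  by (metis coord_inject ext)

lemma sq_norm_add_le:
  fixes x y :: "'a::real_inner"
  shows "(norm (x + y))\<^sup>2 \<le> 2 * (norm x)\<^sup>2 + 2 * (norm y)\<^sup>2"
proof -
  have "(norm (x + y))\<^sup>2 + (norm (x - y))\<^sup>2 = 2 * (norm x)\<^sup>2 + 2 * (norm y)\<^sup>2"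
    by (simp add: power2_norm_eq_inner inner_add_left inner_add_right inner_diff_left inner_diff_right)
  then show ?thesis using zero_le_power2[of "norm (x - y)"] by linarith
qed

lemma sq_summable_add:
  fixes f g :: "'i \<Rightarrow> 'a::real_inner"
  assumes "(\<lambda>i. (norm (f i))\<^sup>2) summable_on UNIV" "(\<lambda>i. (norm (g i))\<^sup>2) summable_on UNIV"
  shows "(\<lambda>i. (norm (f i + g i))\<^sup>2) summable_on UNIV"
proof (rule summable_on_comparison_test)
  show "(\<lambda>i. 2 * (norm (f i))\<^sup>2 + 2 * (norm (g i))\<^sup>2) summable_on UNIV"
    by (intro summable_on_add summable_on_cmult_right assms)
qed (auto simp: sq_norm_add_le)

lemma cinner_coord_abs_summable:
  "(\<lambda>i. norm (cinner (coord x i) (coord y i))) summable_on UNIV"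
proof (rule summable_on_comparison_test)
  show "(\<lambda>i. (norm (coord x i))\<^sup>2 + (norm (coord y i))\<^sup>2) summable_on UNIV"
    by (intro summable_on_add coord_summable)
next
  fix i
  have "norm (cinner (coord x i) (coord y i)) \<le> norm (coord x i) * norm (coord y i)"
    by (rule cmod_cinner_le)
  also have "\<dots> \<le> (norm (coord x i))\<^sup>2 + (norm (coord y i))\<^sup>2"
    using sum_squares_bound[of "norm (coord x i)" "norm (coord y i)"]
      mult_nonneg_nonneg[OF norm_ge_zero[of "coord x i"] norm_ge_zero[of "coord y i"]] by linarith
  finally show "norm (cinner (coord x i) (coord y i)) \<le> \<dots>" .
qed simp

lemma cinner_coord_summable:
  "(\<lambda>i. cinner (coord x i) (coord y i)) summable_on UNIV"
  by (rule abs_summable_summable[OF cinner_coord_abs_summable])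

lemma inner_coord_summable:
  "(\<lambda>i. inner (coord x i) (coord y i)) summable_on UNIV"
  using summable_on_Re[OF cinner_coord_summable[of x y]] by (simp add: Re_cinner)

instantiation l2 :: (type, complex_inner) real_vector
begin
lift_definition zero_l2 :: "('a, 'b) l2" is "\<lambda>_. 0" by simp
lift_definition plus_l2 :: "('a, 'b) l2 \<Rightarrow> ('a, 'b) l2 \<Rightarrow> ('a, 'b) l2" is "\<lambda>f g i. f i + g i"
  by (rule sq_summable_add)
lift_definition uminus_l2 :: "('a, 'b) l2 \<Rightarrow> ('a, 'b) l2" is "\<lambda>f i. - f i" by simp
definition minus_l2 :: "('a, 'b) l2 \<Rightarrow> ('a, 'b) l2 \<Rightarrow> ('a, 'b) l2" where "minus_l2 x y = x + - y"
lift_definition scaleR_l2 :: "real \<Rightarrow> ('a, 'b) l2 \<Rightarrow> ('a, 'b) l2" is "\<lambda>r f i. r *\<^sub>R f i"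
  by (simp add: power_mult_distrib summable_on_cmult_right)
instance
proof
  fix x y z :: "('a, 'b) l2" and a b :: real
  show "x + y + z = x + (y + z)" by (rule l2_eqI) (simp add: plus_l2.rep_eq add.assoc)
  show "x + y = y + x" by (rule l2_eqI) (simp add: plus_l2.rep_eq add.commute)
  show "0 + x = x" by (rule l2_eqI) (simp add: plus_l2.rep_eq zero_l2.rep_eq)
  show "- x + x = 0" by (rule l2_eqI) (simp add: plus_l2.rep_eq zero_l2.rep_eq uminus_l2.rep_eq)
  show "x - y = x + - y" by (rule minus_l2_def)
  show "a *\<^sub>R (x + y) = a *\<^sub>R x + a *\<^sub>R y"
    by (rule l2_eqI) (simp add: plus_l2.rep_eq scaleR_l2.rep_eq scaleR_add_right)
  show "(a + b) *\<^sub>R x = a *\<^sub>R x + b *\<^sub>R x"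
    by (rule l2_eqI) (simp add: plus_l2.rep_eq scaleR_l2.rep_eq scaleR_add_left)
  show "a *\<^sub>R b *\<^sub>R x = (a * b) *\<^sub>R x" by (rule l2_eqI) (simp add: scaleR_l2.rep_eq)
  show "1 *\<^sub>R x = x" by (rule l2_eqI) (simp add: scaleR_l2.rep_eq)
qed
end

lemma coord_simps [simp]:
  "coord 0 i = 0" "coord (x + y) i = coord x i + coord y i" "coord (- x) i = - coord x i"
  "coord (x - y) i = coord x i - coord y i" "coord (r *\<^sub>R x) i = r *\<^sub>R coord x i"
  by (simp_all only: minus_l2_def [of x y] plus_l2.rep_eq zero_l2.rep_eq uminus_l2.rep_eq scaleR_l2.rep_eq
      diff_conv_add_uminus [of "coord x i"])

instantiation l2 :: (type, complex_inner) complex_inner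
begin
definition inner_l2 :: "('a, 'b) l2 \<Rightarrow> ('a, 'b) l2 \<Rightarrow> real"
  where "inner_l2 x y = (\<Sum>\<^sub>\<infinity>i. inner (coord x i) (coord y i))"
definition norm_l2 :: "('a, 'b) l2 \<Rightarrow> real" where "norm_l2 x = sqrt (inner x x)"
definition sgn_l2 :: "('a, 'b) l2 \<Rightarrow> ('a, 'b) l2" where "sgn_l2 x = x /\<^sub>R norm x"
definition dist_l2 :: "('a, 'b) l2 \<Rightarrow> ('a, 'b) l2 \<Rightarrow> real" where "dist_l2 x y = norm (x - y)"
definition uniformity_l2 :: "(('a, 'b) l2 \<times> ('a, 'b) l2) filter"
  where "uniformity_l2 = (INF e\<in>{0<..}. principal {(x, y). dist x y < e})"
definition open_l2 :: "('a, 'b) l2 set \<Rightarrow> bool"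
  where "open_l2 U = (\<forall>x\<in>U. eventually (\<lambda>(x', y). x' = x \<longrightarrow> y \<in> U) uniformity)"
lift_definition scaleC_l2 :: "complex \<Rightarrow> ('a, 'b) l2 \<Rightarrow> ('a, 'b) l2" is "\<lambda>c f i. c *\<^sub>C f i"
  by (simp add: norm_scaleC power_mult_distrib summable_on_cmult_right)
definition cinner_l2 :: "('a, 'b) l2 \<Rightarrow> ('a, 'b) l2 \<Rightarrow> complex"
  where "cinner_l2 x y = (\<Sum>\<^sub>\<infinity>i. cinner (coord x i) (coord y i))"
instance
proof
  fix x y z :: "('a, 'b) l2" and r :: real and c d :: complex
  show "inner x y = inner y x" by (simp add: inner_l2_def inner_commute)
  show "inner (x + y) z = inner x z + inner y z"
    by (simp add: inner_l2_def inner_add_left infsum_add inner_coord_summable)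
  show "inner (r *\<^sub>R x) y = r * inner x y"
    by (simp add: inner_l2_def infsum_cmult_right')
  show "0 \<le> inner x x" by (simp add: inner_l2_def infsum_nonneg)
  show "inner x x = 0 \<longleftrightarrow> x = 0"
  proof
    assume "inner x x = 0"
    then have "inner (coord x i) (coord x i) = 0" for i
      unfolding inner_l2_def
      using nonneg_infsum_le_0D[of "\<lambda>i. inner (coord x i) (coord x i)" UNIV i]
      by (simp add: inner_coord_summable)
    then show "x = 0" by (intro l2_eqI) simp
  qed (simp add: inner_l2_def)
  show "norm x = sqrt (inner x x)" by (rule norm_l2_def)
  show "sgn x = x /\<^sub>R norm x" by (rule sgn_l2_def)
  show "dist x y = norm (x - y)" by (rule dist_l2_def)
  show "(uniformity :: (('a, 'b) l2 \<times> ('a, 'b) l2) filter)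
      = (INF e\<in>{0<..}. principal {(x, y). dist x y < e})" by (rule uniformity_l2_def)
  show "open U = (\<forall>x\<in>U. \<forall>\<^sub>F (x', y) in uniformity. x' = x \<longrightarrow> y \<in> U)" for U :: "('a, 'b) l2 set"
    by (rule open_l2_def)
  show "c *\<^sub>C (x + y) = c *\<^sub>C x + c *\<^sub>C y"
    by (rule l2_eqI) (simp add: scaleC_l2.rep_eq scaleC_add_right)
  show "(c + d) *\<^sub>C x = c *\<^sub>C x + d *\<^sub>C x"
    by (rule l2_eqI) (simp add: scaleC_l2.rep_eq scaleC_add_left)
  show "c *\<^sub>C d *\<^sub>C x = (c * d) *\<^sub>C x"
    by (rule l2_eqI) (simp add: scaleC_l2.rep_eq scaleC_scaleC)
  show "complex_of_real r *\<^sub>C x = r *\<^sub>R x"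
    by (rule l2_eqI) (simp add: scaleC_l2.rep_eq scaleC_of_real)
  show "cinner x y = cnj (cinner y x)"
    unfolding cinner_l2_def infsum_cnj[symmetric] by (intro infsum_cong) (metis cinner_commute)
  show "cinner (x + y) z = cinner x z + cinner y z"
    by (simp add: cinner_l2_def cinner_add_left infsum_add cinner_coord_summable)
  show "cinner (c *\<^sub>C x) y = c * cinner x y"
    by (simp add: cinner_l2_def scaleC_l2.rep_eq cinner_scaleC_left infsum_cmult_right')
  show "Re (cinner x y) = inner x y"
    unfolding cinner_l2_def inner_l2_def
    using infsum_Re[OF cinner_coord_summable[of x y]] by (simp only: Re_cinner)
qed
end

lemma coord_scaleC [simp]: "coord (c *\<^sub>C x) i = c *\<^sub>C coord x i"
  by (simp add: scaleC_l2.rep_eq)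

lemma norm_l2_sq: "(norm x)\<^sup>2 = (\<Sum>\<^sub>\<infinity>i. (norm (coord x i))\<^sup>2)"
  by (simp add: power2_norm_eq_inner inner_l2_def)

lemma sum_coord_le: "finite F \<Longrightarrow> (\<Sum>i\<in>F. (norm (coord x i))\<^sup>2) \<le> (norm x)\<^sup>2"
  unfolding norm_l2_sq by (rule finite_sum_le_infsum[OF coord_summable]) auto

lemma norm_coord_le: "norm (coord x i) \<le> norm x"
  using sum_coord_le[of "{i}" x] by (auto intro: power2_le_imp_le)

lemma norm_l2_le:
  assumes "\<And>F. finite F \<Longrightarrow> (\<Sum>i\<in>F. (norm (coord x i))\<^sup>2) \<le> r\<^sup>2" "0 \<le> r"
  shows "norm x \<le> r"
proof -
  have "(norm x)\<^sup>2 \<le> r\<^sup>2" unfolding norm_l2_sq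
    by (rule infsum_le_finite_sums[OF coord_summable]) (auto intro: assms)
  then show ?thesis using assms(2) by (rule power2_le_imp_le)
qed

instance l2 :: (type, chilbert_space) chilbert_space
proof
  fix X :: "nat \<Rightarrow> ('a, 'b) l2"
  assume X: "Cauchy X"
  have "Cauchy (\<lambda>n. coord (X n) i)" for i
  proof (rule metric_CauchyI)
    fix e :: real assume "0 < e"
    then obtain N where N: "\<And>m n. m \<ge> N \<Longrightarrow> n \<ge> N \<Longrightarrow> dist (X m) (X n) < e"
      using X metric_CauchyD by blast
    moreover have "dist (coord (X m) i) (coord (X n) i) \<le> dist (X m) (X n)" for m n
      using norm_coord_le[of "X m - X n" i] by (simp add: dist_norm)
    ultimately have "\<forall>m\<ge>N. \<forall>n\<ge>N. dist (coord (X m) i) (coord (X n) i) < e"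
      by (meson le_less_trans)
    then show "\<exists>M. \<forall>m\<ge>M. \<forall>n\<ge>M. dist (coord (X m) i) (coord (X n) i) < e" ..
  qed
  then have "\<exists>l. (\<lambda>n. coord (X n) i) \<longlonglongrightarrow> l" for i
    unfolding convergent_def [symmetric] by (rule Cauchy_convergent)
  then obtain f where f: "\<And>i. (\<lambda>n. coord (X n) i) \<longlonglongrightarrow> f i" by metis
  have bound: "\<exists>N. \<forall>n\<ge>N. \<forall>F. finite F \<longrightarrow> (\<Sum>i\<in>F. (norm (coord (X n) i - f i))\<^sup>2) \<le> e\<^sup>2"
    if e: "0 < e" for e
  proof -
    obtain N where N: "\<And>m n. m \<ge> N \<Longrightarrow> n \<ge> N \<Longrightarrow> dist (X m) (X n) < e"
      using X metric_CauchyD e by blast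
    have "(\<Sum>i\<in>F. (norm (coord (X n) i - f i))\<^sup>2) \<le> e\<^sup>2" if n: "n \<ge> N" and F: "finite F" for n F
    proof (rule LIMSEQ_le_const2)
      show "(\<lambda>m. \<Sum>i\<in>F. (norm (coord (X n) i - coord (X m) i))\<^sup>2)
          \<longlonglongrightarrow> (\<Sum>i\<in>F. (norm (coord (X n) i - f i))\<^sup>2)"
        by (intro tendsto_intros f)
      have "(\<Sum>i\<in>F. (norm (coord (X n) i - coord (X m) i))\<^sup>2) \<le> e\<^sup>2" if "m \<ge> N" for m
      proof -
        have "(\<Sum>i\<in>F. (norm (coord (X n - X m) i))\<^sup>2) \<le> (norm (X n - X m))\<^sup>2"
          by (rule sum_coord_le[OF F])
        also have "\<dots> \<le> e\<^sup>2"
          using N[OF n that] by (intro power_mono) (auto simp: dist_norm)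
        finally show ?thesis by simp
      qed
      then show "\<exists>N. \<forall>m\<ge>N. (\<Sum>i\<in>F. (norm (coord (X n) i - coord (X m) i))\<^sup>2) \<le> e\<^sup>2" by blast
    qed
    then show ?thesis by blast
  qed
  have f_l2: "(\<lambda>i. (norm (f i))\<^sup>2) summable_on UNIV"
  proof -
    obtain N where N: "\<And>F. finite F \<Longrightarrow> (\<Sum>i\<in>F. (norm (coord (X N) i - f i))\<^sup>2) \<le> 1\<^sup>2"
      using bound[of 1] by auto
    have "(\<lambda>i. (norm (coord (X N) i - f i))\<^sup>2) summable_on UNIV"
    proof (rule nonneg_bdd_above_summable_on)
      show "bdd_above (sum (\<lambda>i. (norm (coord (X N) i - f i))\<^sup>2) ` {F. F \<subseteq> UNIV \<and> finite F})"
        by (rule bdd_aboveI2) (rule N, simp)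
    qed simp
    then have "(\<lambda>i. (norm (f i - coord (X N) i))\<^sup>2) summable_on UNIV"
      by (simp add: norm_minus_commute)
    from sq_summable_add[OF this coord_summable[of "X N"]] show ?thesis by simp
  qed
  define x where "x = Abs_l2 f"
  have x: "coord x i = f i" for i using f_l2 by (simp add: x_def Abs_l2_inverse)
  have "X \<longlonglongrightarrow> x"
  proof (rule metric_LIMSEQ_I)
    fix e :: real assume e: "0 < e"
    then obtain N where N: "\<And>n F. n \<ge> N \<Longrightarrow> finite F \<Longrightarrow>
        (\<Sum>i\<in>F. (norm (coord (X n) i - f i))\<^sup>2) \<le> (e/2)\<^sup>2"
      using bound[of "e/2"] by auto
    have "norm (X n - x) \<le> e/2" if "n \<ge> N" for n
    proof (rule norm_l2_le)
      show "(\<Sum>i\<in>F. (norm (coord (X n - x) i))\<^sup>2) \<le> (e/2)\<^sup>2" if "finite F" for F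
        using N[OF \<open>n \<ge> N\<close> that] by (simp only: coord_simps x)
    qed (use e in simp)
    then have "\<forall>n\<ge>N. dist (X n) x < e"
      using e by (fastforce simp: dist_norm intro: le_less_trans)
    then show "\<exists>N. \<forall>n\<ge>N. dist (X n) x < e" ..
  qed
  then show "convergent X" by (rule convergentI)
qed

section \<open>Closed subspaces and operators between them\<close>

definition csubspace :: "'h::complex_inner set \<Rightarrow> bool" where
  "csubspace X \<longleftrightarrow> 0 \<in> X \<and> (\<forall>x\<in>X. \<forall>y\<in>X. x + y \<in> X) \<and> (\<forall>c. \<forall>x\<in>X. c *\<^sub>C x \<in> X)"

definition closed_csubspace :: "'h::complex_inner set \<Rightarrow> bool" where
  "closed_csubspace X \<longleftrightarrow> csubspace X \<and> closed X"

definition closed_cspan :: "'h::complex_inner set \<Rightarrow> 'h set" where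
  "closed_cspan S = \<Inter>{X. closed_csubspace X \<and> S \<subseteq> X}"

definition orth_diff :: "'h::complex_inner set \<Rightarrow> 'h set \<Rightarrow> 'h set"  (infixl "\<ominus>" 65) where
  "X \<ominus> Y = {x \<in> X. \<forall>y\<in>Y. cinner x y = 0}"

definition proj :: "'h::complex_inner set \<Rightarrow> 'h \<Rightarrow> 'h" where
  "proj X x = (THE p. p \<in> X \<and> (\<forall>y\<in>X. cinner (x - p) y = 0))"

text \<open>An operator from \<open>X\<close> to \<open>Y\<close> is a function on the ambient types of which only the values
  on \<open>X\<close> matter. The operators chosen by \<open>SOME\<close> below are uniquely determined there.\<close>

definition bounded_op :: "'g::complex_inner set \<Rightarrow> 'h::complex_inner set \<Rightarrow> ('g \<Rightarrow> 'h) \<Rightarrow> bool" where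
  "bounded_op X Y f \<longleftrightarrow> (\<forall>x\<in>X. f x \<in> Y) \<and>
     (\<forall>x\<in>X. \<forall>y\<in>X. f (x + y) = f x + f y) \<and> (\<forall>c. \<forall>x\<in>X. f (c *\<^sub>C x) = c *\<^sub>C f x) \<and>
     (\<exists>b. \<forall>x\<in>X. norm (f x) \<le> b * norm x)"

definition unitary_op :: "'g::complex_inner set \<Rightarrow> 'h::complex_inner set \<Rightarrow> ('g \<Rightarrow> 'h) \<Rightarrow> bool" where
  "unitary_op X Y u \<longleftrightarrow> bounded_op X Y u \<and> u ` X = Y \<and>
     (\<forall>x\<in>X. \<forall>y\<in>X. cinner (u x) (u y) = cinner x y)"

definition adj :: "'g::complex_inner set \<Rightarrow> 'h::complex_inner set \<Rightarrow> ('g \<Rightarrow> 'h) \<Rightarrow> 'h \<Rightarrow> 'g" where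
  "adj X Y f = (SOME g. bounded_op Y X g \<and> (\<forall>x\<in>X. \<forall>y\<in>Y. cinner (f x) y = cinner x (g y)))"

definition positive_op :: "'h::complex_inner set \<Rightarrow> ('h \<Rightarrow> 'h) \<Rightarrow> bool" where
  "positive_op X S \<longleftrightarrow> bounded_op X X S \<and>
     (\<forall>x\<in>X. Im (cinner (S x) x) = 0 \<and> 0 \<le> Re (cinner (S x) x))"

definition op_sqrt :: "'h::complex_inner set \<Rightarrow> ('h \<Rightarrow> 'h) \<Rightarrow> 'h \<Rightarrow> 'h" where
  "op_sqrt X S = (SOME R. positive_op X R \<and> (\<forall>x\<in>X. R (R x) = S x))"

definition orthonormal_basis :: "'h::complex_inner set \<Rightarrow> 'h set \<Rightarrow> bool" where
  "orthonormal_basis B X \<longleftrightarrow> (\<forall>x\<in>B. \<forall>y\<in>B. cinner x y = (if x = y then 1 else 0)) \<and> closed_cspan B = X"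

definition same_hilbert_dim :: "'g::complex_inner set \<Rightarrow> 'h::complex_inner set \<Rightarrow> bool" where
  "same_hilbert_dim X Y \<longleftrightarrow> (\<exists>B B'. orthonormal_basis B X \<and> orthonormal_basis B' Y \<and> B \<approx> B')"

section \<open>Fock space and multi-analytic operators\<close>

text \<open>\<open>('d, \<complex>) fock\<close> is the full Fock space over \<open>\<complex>\<^sup>d\<close>, where \<open>d = CARD('d)\<close>: the
  coordinate at the word \<open>\<alpha>\<close> is the coefficient of \<open>e\<^sub>\<alpha> = e\<^bsub>\<alpha>\<^sub>1\<^esub> \<otimes> \<dots> \<otimes> e\<^bsub>\<alpha>\<^sub>n\<^esub>\<close>. For a closed
  subspace \<open>D\<close>, \<open>fock_on D\<close> is the Hilbert space tensor product of the Fock space with \<open>D\<close>, with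
  elements \<open>\<Sum>\<^sub>\<alpha> e\<^sub>\<alpha> \<otimes> x\<^sub>\<alpha>\<close>, \<open>x\<^sub>\<alpha> \<in> D\<close>, \<open>\<Sum>\<^sub>\<alpha> \<parallel>x\<^sub>\<alpha>\<parallel>\<^sup>2 < \<infinity>\<close>; see the lemmas about \<open>tensor\<close>.\<close>

type_synonym ('d, 'h) fock = "('d list, 'h) l2"

definition fock_on :: "'h::complex_inner set \<Rightarrow> ('d, 'h) fock set" where
  "fock_on D = {x. \<forall>\<alpha>. coord x \<alpha> \<in> D}"

lift_definition tensor :: "('d, complex) fock \<Rightarrow> 'h::complex_inner \<Rightarrow> ('d, 'h) fock"
  is "\<lambda>f h \<alpha>. f \<alpha> *\<^sub>C h"
  by (simp add: norm_scaleC power_mult_distrib summable_on_cmult_left)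

lift_definition basis_vec :: "'d list \<Rightarrow> ('d, complex) fock"
  is "\<lambda>\<beta> \<alpha>. if \<alpha> = \<beta> then 1 else 0"
  by (rule finite_nonzero_values_imp_summable_on) simp

abbreviation vac_tensor :: "'h::complex_inner \<Rightarrow> ('d, 'h) fock" where
  "vac_tensor h \<equiv> tensor (basis_vec []) h"

text \<open>The left creation operator \<open>L\<^sub>j \<otimes> I\<close> (which is \<open>L\<^sub>j\<close> itself on \<open>('d, \<complex>) fock\<close>).\<close>

lift_definition creation :: "'d \<Rightarrow> ('d, 'h::complex_inner) fock \<Rightarrow> ('d, 'h) fock"
  is "\<lambda>j f \<alpha>. case \<alpha> of [] \<Rightarrow> 0 | i # \<beta> \<Rightarrow> if i = j then f \<beta> else 0"
proof -
  fix j :: 'd and f :: "'d list \<Rightarrow> 'h"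
  assume f: "(\<lambda>\<alpha>. (norm (f \<alpha>))\<^sup>2) summable_on UNIV"
  let ?g = "\<lambda>\<alpha>. (norm (case \<alpha> of [] \<Rightarrow> 0 | i # \<beta> \<Rightarrow> if i = j then f \<beta> else 0))\<^sup>2"
  have "?g summable_on range ((#) j)"
    using f by (subst summable_on_reindex) (auto simp: o_def inj_def)
  then show "?g summable_on UNIV"
    by (rule summable_on_cong_neutral[THEN iffD1, rotated -1]) (auto split: list.splits)
qed

definition id_tensor :: "('g::complex_inner \<Rightarrow> 'h::complex_inner) \<Rightarrow> ('d, 'g) fock \<Rightarrow> ('d, 'h) fock" where
  "id_tensor v x = Abs_l2 (\<lambda>\<alpha>. v (coord x \<alpha>))"

lemma cinner_tensor: "cinner (tensor x g) (tensor y h) = cinner x y * cinner g h"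
  by (simp add: cinner_l2_def tensor.rep_eq cinner_scaleC_left cinner_scaleC_right cinner_complex_def
      infsum_cmult_left' mult.commute [of "cnj _"] flip: mult.assoc)

lemma closed_csubspace_fock_on:
  assumes "closed_csubspace D" shows "closed_csubspace (fock_on D :: ('d, 'h::complex_inner) fock set)"
proof -
  have cl: "closed {x. coord x \<alpha> \<in> D}" for \<alpha> :: "'d list"
  proof -
    have "bounded_linear (\<lambda>x. coord x \<alpha>)"
      by (rule bounded_linear_intro[where K = 1]) (simp_all add: norm_coord_le)
    then have "continuous_on UNIV (\<lambda>x. coord x \<alpha>)" by (rule linear_continuous_on)
    moreover have "closed D" using assms by (simp add: closed_csubspace_def)
    ultimately show ?thesis using closed_vimage by (fastforce simp: vimage_def)
  qed
  have "(fock_on D :: ('d, 'h) fock set) = (\<Inter>\<alpha>. {x. coord x \<alpha> \<in> D})" by (auto simp: fock_on_def)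
  then have "closed (fock_on D :: ('d, 'h) fock set)" using cl by auto
  then show ?thesis
    using assms by (simp add: closed_csubspace_def csubspace_def fock_on_def)
qed

lemma closed_cspan_tensor:
  fixes D :: "'h::complex_inner set"
  assumes D: "closed_csubspace D"
  shows "closed_cspan {tensor x h |x h. h \<in> D} = (fock_on D :: ('d, 'h) fock set)"
proof
  have "tensor x h \<in> fock_on D" if "h \<in> D" for x :: "('d, complex) fock" and h
    using D that by (simp add: fock_on_def tensor.rep_eq closed_csubspace_def csubspace_def)
  then show "closed_cspan {tensor x h |x h. h \<in> D} \<subseteq> (fock_on D :: ('d, 'h) fock set)"
    using closed_csubspace_fock_on[OF D] unfolding closed_cspan_def by blast
next
  have "x \<in> X" if X: "closed_csubspace X" "{tensor x h |x h. h \<in> D} \<subseteq> X" and x: "x \<in> fock_on D"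
    for X :: "('d, 'h) fock set" and x
  proof -
    define S where "S F = (\<Sum>\<alpha>\<in>F. tensor (basis_vec \<alpha>) (coord x \<alpha>))" for F
    have S_in: "S F \<in> X" if "finite F" for F
      using that
    proof (induction F)
      case empty
      then show ?case using X by (simp add: S_def closed_csubspace_def csubspace_def)
    next
      case (insert \<alpha> F)
      have "tensor (basis_vec \<alpha>) (coord x \<alpha>) \<in> X" using X(2) x by (auto simp: fock_on_def)
      then show ?case using X(1) insert by (simp add: S_def closed_csubspace_def csubspace_def)
    qed
    have zero: "0 *\<^sub>C h = 0" "1 *\<^sub>C h = h" for h :: 'h
      using scaleC_of_real[of 0 h] scaleC_of_real[of 1 h] by simp_all
    have coord_S: "coord (S F) \<beta> = (if \<beta> \<in> F then coord x \<beta> else 0)" if "finite F" for F \<beta>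
      using that
      by (induction F) (auto simp: S_def tensor.rep_eq basis_vec.rep_eq zero)
    have "\<exists>y\<in>X. dist y x < e" if e: "e > 0" for e
    proof -
      have sum: "((\<lambda>\<alpha>. (norm (coord x \<alpha>))\<^sup>2) has_sum (norm x)\<^sup>2) UNIV"
        unfolding norm_l2_sq by (rule has_sum_infsum[OF coord_summable])
      then obtain F where F: "finite F"
        and "dist (\<Sum>\<alpha>\<in>F. (norm (coord x \<alpha>))\<^sup>2) ((norm x)\<^sup>2) \<le> (e/2)\<^sup>2"
        using has_sum_finite_approximation[OF sum, of "(e/2)\<^sup>2"] e by auto
      then have F_sum: "(norm x)\<^sup>2 - (\<Sum>\<alpha>\<in>F. (norm (coord x \<alpha>))\<^sup>2) \<le> (e/2)\<^sup>2"
        by (simp add: dist_real_def abs_le_iff)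
      have "norm (x - S F) \<le> e/2"
      proof (rule norm_l2_le)
        fix G :: "'d list set" assume G: "finite G"
        have "(\<Sum>\<alpha>\<in>G. (norm (coord (x - S F) \<alpha>))\<^sup>2) = (\<Sum>\<alpha>\<in>G - F. (norm (coord x \<alpha>))\<^sup>2)"
          using G F by (intro sum.mono_neutral_cong_right) (auto simp: coord_S)
        also have "\<dots> = (\<Sum>\<alpha>\<in>G \<union> F. (norm (coord x \<alpha>))\<^sup>2) - (\<Sum>\<alpha>\<in>F. (norm (coord x \<alpha>))\<^sup>2)"
          using G F by (subst sum_diff [symmetric]) (auto intro!: sum.cong)
        also have "\<dots> \<le> (e/2)\<^sup>2"
          using sum_coord_le[of "G \<union> F" x] F_sum G F by simp
        finally show "(\<Sum>\<alpha>\<in>G. (norm (coord (x - S F) \<alpha>))\<^sup>2) \<le> (e/2)\<^sup>2" .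
      qed (use e in simp)
      then show ?thesis
        using S_in[OF F] e by (intro bexI[of _ "S F"]) (auto simp: dist_norm norm_minus_commute)
    qed
    then have "x \<in> closure X" by (simp add: closure_approachable)
    then show ?thesis using X by (simp add: closed_csubspace_def)
  qed
  then show "(fock_on D :: ('d, 'h) fock set) \<subseteq> closed_cspan {tensor x h |x h. h \<in> D}"
    unfolding closed_cspan_def by blast
qed

lemma creation_tensor: "creation j (tensor x h) = tensor (creation j x) h"
proof -
  have "0 *\<^sub>C h = 0" by (metis of_real_0 scaleC_of_real scaleR_zero_left)
  then show ?thesis
    by (intro l2_eqI) (simp add: creation.rep_eq tensor.rep_eq split: list.splits)
qed

lemma creation_basis_vec: "creation j (basis_vec \<alpha>) = basis_vec (j # \<alpha>)"
  by (rule l2_eqI) (auto simp: creation.rep_eq basis_vec.rep_eq split: list.splits)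

definition multi_analytic ::
    "'g::complex_inner set \<Rightarrow> 'h::complex_inner set \<Rightarrow> (('d, 'g) fock \<Rightarrow> ('d, 'h) fock) \<Rightarrow> bool" where
  "multi_analytic D L M \<longleftrightarrow> bounded_op (fock_on D) (fock_on L) M \<and>
     (\<forall>j. \<forall>x\<in>fock_on D. M (creation j x) = creation j (M x))"

definition op_symbol :: "(('d, 'g::complex_inner) fock \<Rightarrow> ('d, 'h) fock) \<Rightarrow> 'g \<Rightarrow> ('d, 'h) fock" where
  "op_symbol M \<delta> = M (vac_tensor \<delta>)"

definition contractive_multi_analytic ::
    "'g::complex_inner set \<Rightarrow> 'h::complex_inner set \<Rightarrow> (('d, 'g) fock \<Rightarrow> ('d, 'h) fock) \<Rightarrow> bool" where
  "contractive_multi_analytic D L M \<longleftrightarrow> multi_analytic D L M \<and> (\<forall>x\<in>fock_on D. norm (M x) \<le> norm x)"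

definition purely_contractive ::
    "'g::complex_inner set \<Rightarrow> 'h::complex_inner set \<Rightarrow> (('d, 'g) fock \<Rightarrow> ('d, 'h) fock) \<Rightarrow> bool" where
  "purely_contractive D L M \<longleftrightarrow> contractive_multi_analytic D L M \<and>
     (\<forall>\<delta>\<in>D. \<delta> \<noteq> 0 \<longrightarrow> norm (proj (vac_tensor ` L) (op_symbol M \<delta>)) < norm \<delta>)"

definition szego_condition ::
    "'g::complex_inner set \<Rightarrow> 'h::complex_inner set \<Rightarrow> (('d, 'g) fock \<Rightarrow> ('d, 'h) fock) \<Rightarrow> bool" where
  "szego_condition D L M \<longleftrightarrow> contractive_multi_analytic D L M \<and>
     (let \<Delta> = op_sqrt (fock_on D) (\<lambda>x. x - adj (fock_on D) (fock_on L) M (M x))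
      in closure (\<Delta> ` fock_on D) = closure (\<Delta> ` (fock_on D \<ominus> vac_tensor ` D)))"

definition coincide ::
    "'g::complex_inner set \<Rightarrow> 'h::complex_inner set \<Rightarrow> (('d, 'g) fock \<Rightarrow> ('d, 'h) fock) \<Rightarrow>
     'g2::complex_inner set \<Rightarrow> 'h2::complex_inner set \<Rightarrow> (('d, 'g2) fock \<Rightarrow> ('d, 'h2) fock) \<Rightarrow> bool" where
  "coincide D L M D' L' M' \<longleftrightarrow> (\<exists>v\<^sub>D v\<^sub>L. unitary_op D D' v\<^sub>D \<and> unitary_op L L' v\<^sub>L \<and>
     (\<forall>\<delta>\<in>D. op_symbol M' (v\<^sub>D \<delta>) = id_tensor v\<^sub>L (op_symbol M \<delta>)))"

section \<open>Row contractions and liftings\<close>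

primrec word_op :: "('d \<Rightarrow> 'h \<Rightarrow> 'h) \<Rightarrow> 'd list \<Rightarrow> 'h \<Rightarrow> 'h" where
  "word_op T [] = id"
| "word_op T (j # \<alpha>) = T j \<circ> word_op T \<alpha>"

definition row_contraction :: "('d::finite \<Rightarrow> 'h::chilbert_space \<Rightarrow> 'h) \<Rightarrow> bool" where
  "row_contraction T \<longleftrightarrow> (\<forall>j. bounded_op UNIV UNIV (T j)) \<and>
     positive_op UNIV (\<lambda>x. x - (\<Sum>j\<in>UNIV. T j (adj UNIV UNIV (T j) x)))"

definition row_isometry_on :: "'k::complex_inner set \<Rightarrow> ('d::finite \<Rightarrow> 'k \<Rightarrow> 'k) \<Rightarrow> bool" where
  "row_isometry_on K V \<longleftrightarrow> (\<forall>j. bounded_op K K (V j) \<and> (\<forall>x\<in>K. norm (V j x) = norm x)) \<and>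
     (\<forall>i j. i \<noteq> j \<longrightarrow> (\<forall>x\<in>K. \<forall>y\<in>K. cinner (V i x) (V j y) = 0))"

definition defect_op :: "('d::finite \<Rightarrow> 'h::chilbert_space \<Rightarrow> 'h) \<Rightarrow> 'h ^ 'd \<Rightarrow> 'h ^ 'd" where
  "defect_op T = op_sqrt UNIV (\<lambda>x. \<chi> i. x $ i - (\<Sum>j\<in>UNIV. adj UNIV UNIV (T i) (T j (x $ j))))"

definition defect_space :: "('d::finite \<Rightarrow> 'h::chilbert_space \<Rightarrow> 'h) \<Rightarrow> ('h ^ 'd) set" where
  "defect_space T = closure (range (defect_op T))"

definition star_defect_op :: "('d::finite \<Rightarrow> 'h::chilbert_space \<Rightarrow> 'h) \<Rightarrow> 'h \<Rightarrow> 'h" where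
  "star_defect_op T = op_sqrt UNIV (\<lambda>x. x - (\<Sum>j\<in>UNIV. T j (adj UNIV UNIV (T j) x)))"

definition star_defect_space :: "('d::finite \<Rightarrow> 'h::chilbert_space \<Rightarrow> 'h) \<Rightarrow> 'h set" where
  "star_defect_space T = closure (range (star_defect_op T))"

definition completely_non_coisometric :: "('d::finite \<Rightarrow> 'h::chilbert_space \<Rightarrow> 'h) \<Rightarrow> bool" where
  "completely_non_coisometric T \<longleftrightarrow> (\<forall>z.
     (\<forall>n. (\<Sum>\<alpha> | length \<alpha> = n. (norm (adj UNIV UNIV (word_op T \<alpha>) z))\<^sup>2) = (norm z)\<^sup>2) \<longrightarrow> z = 0)"

definition unitarily_equivalent ::
    "('d::finite \<Rightarrow> 'g::chilbert_space \<Rightarrow> 'g) \<Rightarrow> ('d \<Rightarrow> 'h::chilbert_space \<Rightarrow> 'h) \<Rightarrow> bool" where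
  "unitarily_equivalent A A' \<longleftrightarrow> (\<exists>u. unitary_op UNIV UNIV u \<and> (\<forall>j x. u (A j x) = A' j (u x)))"

text \<open>The smallest closed subspace of \<open>K\<close> that contains \<open>S\<close> and is invariant under all \<open>V\<^sub>j\<close>.\<close>

definition inv_hull :: "'k::complex_inner set \<Rightarrow> ('d::finite \<Rightarrow> 'k \<Rightarrow> 'k) \<Rightarrow> 'k set \<Rightarrow> 'k set" where
  "inv_hull K V S = \<Inter>{X. closed_csubspace X \<and> S \<subseteq> X \<and> X \<subseteq> K \<and> (\<forall>j. V j ` X \<subseteq> X)}"

text \<open>The Hilbert space of a lifting is the product type, with the following embeddings of the
  spaces of \<open>C\<close> and \<open>A\<close>.\<close>

abbreviation in_C :: "'c \<Rightarrow> 'c \<times> 'a::zero" where "in_C c \<equiv> (c, 0)"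
abbreviation in_A :: "'a \<Rightarrow> 'c::zero \<times> 'a" where "in_A a \<equiv> (0, a)"

definition lifting ::
    "('d::finite \<Rightarrow> 'c::chilbert_space \<Rightarrow> 'c) \<Rightarrow> ('d \<Rightarrow> 'c \<Rightarrow> 'a::chilbert_space) \<Rightarrow> ('d \<Rightarrow> 'a \<Rightarrow> 'a) \<Rightarrow>
     'd \<Rightarrow> 'c \<times> 'a \<Rightarrow> 'c \<times> 'a" where
  "lifting C B A j = (\<lambda>(c, a). (C j c, B j c + A j a))"

definition minimal_contractive_lifting ::
    "('d::finite \<Rightarrow> 'c::chilbert_space \<Rightarrow> 'c) \<Rightarrow> ('d \<Rightarrow> 'c \<Rightarrow> 'a::chilbert_space) \<Rightarrow> ('d \<Rightarrow> 'a \<Rightarrow> 'a) \<Rightarrow>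
     bool" where
  "minimal_contractive_lifting C B A \<longleftrightarrow>
     (\<forall>j. bounded_op UNIV UNIV (C j) \<and> bounded_op UNIV UNIV (B j) \<and> bounded_op UNIV UNIV (A j)) \<and>
     row_contraction (lifting C B A) \<and> inv_hull UNIV (lifting C B A) (range in_C) = UNIV"

section \<open>Minimal isometric dilations\<close>

text \<open>A dilation of \<open>T\<close> consists of a closed subspace \<open>K\<close> of some Hilbert space, a row isometry
  \<open>V\<close> on \<open>K\<close>, and an isometric embedding \<open>J\<close> by which the space of \<open>T\<close> is regarded as a subspace
  of \<open>K\<close>. By Schaeffer's construction, a row contraction on \<open>'h\<close> has a minimal one with \<open>K\<close> in
  \<open>'h \<times> ('d, 'h ^ 'd) fock\<close>; minimal ones are unique up to unitary equivalence.\<close>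

definition isometric_dilation ::
    "('d::finite \<Rightarrow> 'h::chilbert_space \<Rightarrow> 'h) \<Rightarrow> 'k::chilbert_space set \<Rightarrow> ('d \<Rightarrow> 'k \<Rightarrow> 'k) \<Rightarrow> ('h \<Rightarrow> 'k) \<Rightarrow>
     bool" where
  "isometric_dilation T K V J \<longleftrightarrow> closed_csubspace K \<and> row_isometry_on K V \<and>
     unitary_op UNIV (range J) J \<and> range J \<subseteq> K \<and>
     (\<forall>\<alpha> h. J (word_op T \<alpha> h) = proj (range J) (word_op V \<alpha> (J h)))"

definition minimal_isometric_dilation ::
    "('d::finite \<Rightarrow> 'h::chilbert_space \<Rightarrow> 'h) \<Rightarrow> 'k::chilbert_space set \<Rightarrow> ('d \<Rightarrow> 'k \<Rightarrow> 'k) \<Rightarrow> ('h \<Rightarrow> 'k) \<Rightarrow>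
     bool" where
  "minimal_isometric_dilation T K V J \<longleftrightarrow>
     isometric_dilation T K V J \<and> inv_hull K V (range J) = K"

text \<open>In the following, \<open>J\<close> embeds the space of \<open>T\<close> into that of an isometric dilation \<open>V\<close>, which
  is \<open>K\<close> where it matters. For \<open>H = range J\<close>, \<open>wandering V H\<close> is \<open>\<L>\<^sub>T\<close>; \<open>star_wandering K V\<close> is
  \<open>\<L>\<^sub>*\<^sub>,\<^sub>T\<close> if the dilation is minimal; \<open>shift_space V L\<close> is \<open>\<Oplus>\<^sub>\<alpha> V\<^sub>\<alpha> L\<close> for wandering \<open>L\<close>.\<close>

definition wandering :: "('d::finite \<Rightarrow> 'k::chilbert_space \<Rightarrow> 'k) \<Rightarrow> 'k set \<Rightarrow> 'k set" where
  "wandering V H = closed_cspan (H \<union> (\<Union>j. V j ` H)) \<ominus> H"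

definition star_wandering :: "'k::chilbert_space set \<Rightarrow> ('d::finite \<Rightarrow> 'k \<Rightarrow> 'k) \<Rightarrow> 'k set" where
  "star_wandering K V = {x \<in> K. \<forall>j. adj K K (V j) x = 0}"

definition shift_space :: "('d::finite \<Rightarrow> 'k::chilbert_space \<Rightarrow> 'k) \<Rightarrow> 'k set \<Rightarrow> 'k set" where
  "shift_space V L = closed_cspan (\<Union>\<alpha>. word_op V \<alpha> ` L)"

definition canon ::
    "('d::finite \<Rightarrow> 'h::chilbert_space \<Rightarrow> 'h) \<Rightarrow> ('d \<Rightarrow> 'k::chilbert_space \<Rightarrow> 'k) \<Rightarrow> ('h \<Rightarrow> 'k) \<Rightarrow>
     'h ^ 'd \<Rightarrow> 'k" where
  "canon T V J = (SOME u. unitary_op (defect_space T) (wandering V (range J)) u \<and>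
     (\<forall>\<xi>. u (defect_op T \<xi>) = (\<Sum>i\<in>UNIV. V i (J (\<xi> $ i)) - J (T i (\<xi> $ i)))))"

definition canon_K ::
    "('d::finite \<Rightarrow> 'h::chilbert_space \<Rightarrow> 'h) \<Rightarrow> ('d \<Rightarrow> 'k::chilbert_space \<Rightarrow> 'k) \<Rightarrow> ('h \<Rightarrow> 'k) \<Rightarrow>
     ('d, 'h ^ 'd) fock \<Rightarrow> 'k" where
  "canon_K T V J = (SOME U.
     unitary_op (fock_on (defect_space T)) (shift_space V (wandering V (range J))) U \<and>
     (\<forall>\<delta>\<in>defect_space T. U (vac_tensor \<delta>) = canon T V J \<delta>) \<and>
     (\<forall>j. \<forall>x\<in>fock_on (defect_space T). U (creation j x) = V j (U x)))"

definition star_canon ::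
    "('d::finite \<Rightarrow> 'h::chilbert_space \<Rightarrow> 'h) \<Rightarrow> 'k::chilbert_space set \<Rightarrow> ('d \<Rightarrow> 'k \<Rightarrow> 'k) \<Rightarrow> ('h \<Rightarrow> 'k) \<Rightarrow>
     'h \<Rightarrow> 'k" where
  "star_canon T K V J = (SOME u. unitary_op (star_defect_space T) (star_wandering K V) u \<and>
     (\<forall>\<xi>. u (star_defect_op T \<xi>) = J \<xi> - (\<Sum>i\<in>UNIV. V i (J (adj UNIV UNIV (T i) \<xi>)))))"

definition star_canon_K ::
    "('d::finite \<Rightarrow> 'h::chilbert_space \<Rightarrow> 'h) \<Rightarrow> 'k::chilbert_space set \<Rightarrow> ('d \<Rightarrow> 'k \<Rightarrow> 'k) \<Rightarrow> ('h \<Rightarrow> 'k) \<Rightarrow>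
     ('d, 'h) fock \<Rightarrow> 'k" where
  "star_canon_K T K V J = (SOME U.
     unitary_op (fock_on (star_defect_space T)) (shift_space V (star_wandering K V)) U \<and>
     (\<forall>\<delta>\<in>star_defect_space T. U (vac_tensor \<delta>) = star_canon T K V J \<delta>) \<and>
     (\<forall>j. \<forall>x\<in>fock_on (star_defect_space T). U (creation j x) = V j (U x)))"

section \<open>Characteristic functions\<close>

text \<open>\<open>M\<^sub>C\<^sub>,\<^sub>E\<close> for \<open>E = lifting C B A\<close>, where \<open>V\<close>, \<open>J\<close> belong to the minimal isometric dilation of \<open>E\<close>.\<close>

definition lifting_char_fun ::
    "('d::finite \<Rightarrow> 'c::chilbert_space \<Rightarrow> 'c) \<Rightarrow> ('d \<Rightarrow> 'c \<Rightarrow> 'a::chilbert_space) \<Rightarrow> ('d \<Rightarrow> 'a \<Rightarrow> 'a) \<Rightarrow>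
     ('d \<Rightarrow> 'k::chilbert_space \<Rightarrow> 'k) \<Rightarrow> ('c \<times> 'a \<Rightarrow> 'k) \<Rightarrow>
     ('d, ('c \<times> 'a) ^ 'd) fock \<Rightarrow> ('d, 'c ^ 'd) fock" where
  "lifting_char_fun C B A V J x =
     (let X = shift_space V (wandering V (range (J \<circ> in_C)))
      in adj (fock_on (defect_space C)) X (canon_K C V (J \<circ> in_C))
           (proj X (canon_K (lifting C B A) V J x)))"

text \<open>The characteristic function of \<open>A\<close>, where \<open>K\<close>, \<open>V\<close>, \<open>J\<close> is the minimal isometric dilation
  of \<open>A\<close>.\<close>

definition char_fun ::
    "('d::finite \<Rightarrow> 'a::chilbert_space \<Rightarrow> 'a) \<Rightarrow> 'k::chilbert_space set \<Rightarrow> ('d \<Rightarrow> 'k \<Rightarrow> 'k) \<Rightarrow> ('a \<Rightarrow> 'k) \<Rightarrow>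
     ('d, 'a ^ 'd) fock \<Rightarrow> ('d, 'a) fock" where
  "char_fun A K V J x =
     (let X = shift_space V (star_wandering K V)
      in adj (fock_on (star_defect_space A)) X (star_canon_K A K V J)
           (proj X (canon_K A V J x)))"

text \<open>For a minimal isometric dilation \<open>K\<close>, \<open>V\<close>, \<open>J\<close> of a lifting, the minimal isometric dilation
  of \<open>A\<close> is the restriction of \<open>V\<close> to \<open>corner_space K V J\<close>.\<close>

definition corner_space ::
    "'k::chilbert_space set \<Rightarrow> ('d::finite \<Rightarrow> 'k \<Rightarrow> 'k) \<Rightarrow> ('c::chilbert_space \<times> 'a::chilbert_space \<Rightarrow> 'k) \<Rightarrow>
     'k set" where
  "corner_space K V J = inv_hull K V (range (J \<circ> in_A))"

text \<open>\<open>\<L>\<^sub>E = \<L>\<^sub>A\<close> and \<open>\<L>\<^sub>C = \<L>\<^sub>*\<^sub>,\<^sub>A\<close>.\<close>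

definition wandering_spaces_agree ::
    "'k::chilbert_space set \<Rightarrow> ('d::finite \<Rightarrow> 'k \<Rightarrow> 'k) \<Rightarrow> ('c::chilbert_space \<times> 'a::chilbert_space \<Rightarrow> 'k) \<Rightarrow>
     bool" where
  "wandering_spaces_agree K V J \<longleftrightarrow>
     wandering V (range J) = wandering V (range (J \<circ> in_A)) \<and>
     wandering V (range (J \<circ> in_C)) = star_wandering (corner_space K V J) V"

text \<open>\<open>M\<^sub>C\<^sub>,\<^sub>E\<close> equals the characteristic function of \<open>A\<close> under the identifications
  \<open>\<D>\<^sub>E \<cong> \<L>\<^sub>E = \<L>\<^sub>A \<cong> \<D>\<^sub>A\<close> and \<open>\<D>\<^sub>C \<cong> \<L>\<^sub>C = \<L>\<^sub>*\<^sub>,\<^sub>A \<cong> \<D>\<^sub>*\<^sub>,\<^sub>A\<close>; meaningful if \<open>wandering_spaces_agree K V J\<close>.\<close>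

definition char_funs_agree ::
    "('d::finite \<Rightarrow> 'c::chilbert_space \<Rightarrow> 'c) \<Rightarrow> ('d \<Rightarrow> 'c \<Rightarrow> 'a::chilbert_space) \<Rightarrow> ('d \<Rightarrow> 'a \<Rightarrow> 'a) \<Rightarrow>
     'k::chilbert_space set \<Rightarrow> ('d \<Rightarrow> 'k \<Rightarrow> 'k) \<Rightarrow> ('c \<times> 'a \<Rightarrow> 'k) \<Rightarrow> bool" where
  "char_funs_agree C B A K V J \<longleftrightarrow>
     (let E = lifting C B A; K\<^sub>A = corner_space K V J; J\<^sub>A = J \<circ> in_A;
          u = inv_into (defect_space A) (canon A V J\<^sub>A) \<circ> canon E V J;
          w = inv_into (star_defect_space A) (star_canon A K\<^sub>A V J\<^sub>A) \<circ> canon C V (J \<circ> in_C)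
      in \<forall>x\<in>fock_on (defect_space E).
           id_tensor w (lifting_char_fun C B A V J x) = char_fun A K\<^sub>A V J\<^sub>A (id_tensor u x))"

end

theory Submission
  imports Defs
begin

text \<open>
  In the space \<open>K\<close> of the minimal isometric dilation \<open>V\<close> of \<open>E\<close> write \<open>S\<^sub>C = \<Oplus>\<^sub>\<alpha> V\<^sub>\<alpha> \<L>\<^sub>C\<close>, and let the
  reducing subspace \<open>R\<close> be the complement of the space of \<open>C\<close> plus \<open>S\<^sub>C\<close>. Minimality of the lifting says
  that \<open>R\<close> meets the space of \<open>E\<close> only in 0. Then pure contractivity means \<open>\<L>\<^sub>E \<inter> \<L>\<^sub>C = 0\<close>, and, since
  the defect of \<open>M\<^sub>C\<^sub>,\<^sub>E\<close> is implemented by the projection onto \<open>R\<close>, the Szego condition means that no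
  nonzero vector of \<open>R\<close> is annihilated by all \<open>V\<^sub>j\<^sup>*\<close>. A vector of \<open>\<L>\<^sub>E \<ominus> \<L>\<^sub>A\<close> is mapped by every \<open>V\<^sub>j\<^sup>*\<close>
  into the space of \<open>C\<close>, so under these conditions it lies in \<open>\<L>\<^sub>E \<inter> \<L>\<^sub>C\<close>; and once \<open>\<L>\<^sub>E = \<L>\<^sub>A\<close>, the
  dilation space of \<open>A\<close> is the complement of the space of \<open>C\<close>, whence
  \<open>\<L>\<^sub>*\<^sub>,\<^sub>A = \<L>\<^sub>C \<oplus> (R \<ominus> \<Oplus>\<^sub>j V\<^sub>j R)\<close>.

  For the second part take \<open>B = D\<^sub>*\<^sub>,\<^sub>A \<gamma> D\<^sub>C\<close> with a unitary \<open>\<gamma>\<close> between the defect spaces. For the third,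
  a coincidence of characteristic functions prescribes a unitary between the dilation spaces on the
  two shift parts, which together are total because \<open>A\<close> is completely non-coisometric.
\<close>

subsection \<open>Inner products and closed subspaces\<close>

text \<open>The unitaries here have one source: two families with equal inner products have
  isomorphic closed spans. Canonical maps, their Fock extensions and the unitaries between dilation
  spaces all arise in this way, so the defect operators, known only as some chosen positive root,
  enter mainly through <D x, D y> = <x, y> - <T x, T y>. Both characteristic functions are
  compressions of a Fock space unitary to a shift space and differ only in the wandering subspaces,
  so they share one locale. Transport along an intertwining unitary gives the equality of the two
  functions in the first part, with the identity map, and one direction of the third. The vacuum
  component of the symbol of M_{C,E} is the projection from L_E to L_C, which preserves the norm
  only on L_C; this brings in the intersection. The Szego condition speaks of images of Fock
  vectors; it reaches every vector of R because minimality of the lifting makes the projection of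
  S_E dense in R. Ranges of defect operators need not be closed, so in the second part generators of
  L_E and L_{*,A} are only approximated by vectors of L_A and L_C.\<close>

lemma cinner_add_right:
  fixes x :: "'a::complex_inner" shows "cinner x (y + z) = cinner x y + cinner x z"
proof -
  have "cinner x (y + z) = cnj (cinner (y + z) x)" by (rule cinner_commute)
  also have "\<dots> = cinner x y + cinner x z"
    by (simp add: cinner_add_left cinner_commute[of x y] cinner_commute[of x z])
  finally show ?thesis .
qed

lemma scaleC_zero_left [simp]: "0 *\<^sub>C (x::'a::complex_inner) = 0"
  using scaleC_of_real[of 0 x] by simp

lemma scaleC_one [simp]: "1 *\<^sub>C (x::'a::complex_inner) = x"
  using scaleC_of_real[of 1 x] by simp

lemma scaleC_minus_one [simp]: "(-1) *\<^sub>C (x::'a::complex_inner) = - x"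
  using scaleC_of_real[of "-1" x] by simp

declare scaleC_zero_right [simp] cinner_zero_left [simp]

lemma cinner_zero_right [simp]: "cinner (x::'a::complex_inner) 0 = 0"
  using cinner_add_right[of x 0 0] by simp

lemma cinner_minus_left [simp]: "cinner (- x) (y::'a::complex_inner) = - cinner x y"
  using cinner_add_left[of x "- x" y] by (simp add: eq_neg_iff_add_eq_0 add.commute)

lemma cinner_minus_right [simp]: "cinner x (- y::'a::complex_inner) = - cinner x y"
  using cinner_add_right[of x y "- y"] by (simp add: eq_neg_iff_add_eq_0 add.commute)

lemma cinner_diff_left: "cinner (x - y) (z::'a::complex_inner) = cinner x z - cinner y z"
  using cinner_add_left[of x "- y" z] by simp

lemma cinner_diff_right: "cinner x (y - z::'a::complex_inner) = cinner x y - cinner x z"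
  using cinner_add_right[of x y "- z"] by simp

lemma cinner_sum_left: "cinner (\<Sum>i\<in>I. f i) (z::'a::complex_inner) = (\<Sum>i\<in>I. cinner (f i) z)"
  by (induction I rule: infinite_finite_induct) (auto simp: cinner_add_left)

lemma cinner_sum_right: "cinner (z::'a::complex_inner) (\<Sum>i\<in>I. f i) = (\<Sum>i\<in>I. cinner z (f i))"
  by (induction I rule: infinite_finite_induct) (auto simp: cinner_add_right)

lemma cinner_eq_zero_commute: "cinner (x::'a::complex_inner) y = 0 \<longleftrightarrow> cinner y x = 0"
  using cinner_commute[of x y] cinner_commute[of y x] by auto

lemma cinner_self_eq_zero [simp]: "cinner (x::'a::complex_inner) x = 0 \<longleftrightarrow> x = 0"
  by (simp add: cinner_self)

lemma norm_sq_cinner: "(norm (x::'a::complex_inner))\<^sup>2 = Re (cinner x x)"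
  by (simp add: cinner_self)

lemma Re_cinner_commute: "Re (cinner (x::'a::complex_inner) y) = Re (cinner y x)"
  using cinner_commute[of x y] by simp

lemma norm_add_sq:
  "(norm (x + y::'a::complex_inner))\<^sup>2 = (norm x)\<^sup>2 + 2 * Re (cinner x y) + (norm y)\<^sup>2"
  by (simp add: norm_sq_cinner cinner_add_left cinner_add_right Re_cinner_commute[of y x])

lemma norm_diff_sq:
  "(norm (x - y::'a::complex_inner))\<^sup>2 = (norm x)\<^sup>2 - 2 * Re (cinner x y) + (norm y)\<^sup>2"
  using norm_add_sq[of x "- y"] by simp

lemma scaleC_minus_right [simp]: "c *\<^sub>C (- x) = - (c *\<^sub>C (x::'a::complex_inner))"
  using scaleC_add_right[of c x "- x"] by (simp add: eq_neg_iff_add_eq_0 add.commute)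

lemma scaleC_diff_right: "c *\<^sub>C (x - y) = c *\<^sub>C x - c *\<^sub>C (y::'a::complex_inner)"
  using scaleC_add_right[of c x "- y"] by simp

lemma bounded_linear_cinner_left: "bounded_linear (\<lambda>x. cinner x (y::'a::complex_inner))"
  by (rule bounded_linear_intro[where K = "norm y"])
    (auto simp: cinner_add_left cinner_scaleR_left scaleR_conv_of_real cmod_cinner_le)

lemma bounded_linear_cinner_right: "bounded_linear (\<lambda>y. cinner (x::'a::complex_inner) y)"
proof (rule bounded_linear_intro[where K = "norm x"])
  show "cinner x (r *\<^sub>R y) = r *\<^sub>R cinner x y" for r y
    using cinner_scaleC_right[of x "of_real r" y] by (simp add: scaleC_of_real scaleR_conv_of_real)
  show "norm (cinner x y) \<le> norm y * norm x" for y
    using cmod_cinner_le[of x y] by (simp add: mult.commute)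
qed (rule cinner_add_right)

lemma bounded_linear_scaleC: "bounded_linear (\<lambda>x::'a::complex_inner. c *\<^sub>C x)"
proof (rule bounded_linear_intro[where K = "cmod c"])
  show "c *\<^sub>C (r *\<^sub>R x) = r *\<^sub>R c *\<^sub>C x" for r and x :: 'a
    by (simp add: scaleC_of_real [symmetric] scaleC_scaleC mult.commute)
qed (auto simp: scaleC_add_right norm_scaleC)

lemmas tendsto_cinner_left = bounded_linear.tendsto[OF bounded_linear_cinner_left]
lemmas tendsto_cinner_right = bounded_linear.tendsto[OF bounded_linear_cinner_right]
lemmas tendsto_scaleC = bounded_linear.tendsto[OF bounded_linear_scaleC]

lemma csubspaceI:
  assumes "0 \<in> X" "\<And>x y. x \<in> X \<Longrightarrow> y \<in> X \<Longrightarrow> x + y \<in> X" "\<And>c x. x \<in> X \<Longrightarrow> c *\<^sub>C x \<in> X"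
  shows "csubspace X"
  using assms by (auto simp: csubspace_def)

lemma csubspace_zero: "csubspace X \<Longrightarrow> 0 \<in> X"
  and csubspace_add: "csubspace X \<Longrightarrow> x \<in> X \<Longrightarrow> y \<in> X \<Longrightarrow> x + y \<in> X"
  and csubspace_scaleC: "csubspace X \<Longrightarrow> x \<in> X \<Longrightarrow> c *\<^sub>C x \<in> X"
  by (auto simp: csubspace_def)

lemma csubspace_minus: "csubspace X \<Longrightarrow> x \<in> X \<Longrightarrow> - x \<in> X"
  using csubspace_scaleC[of X x "-1"] by simp

lemma csubspace_diff: "csubspace X \<Longrightarrow> x \<in> X \<Longrightarrow> y \<in> X \<Longrightarrow> x - y \<in> X"
  using csubspace_add[of X x "- y"] csubspace_minus[of X y] by simp

lemma csubspace_scaleR: "csubspace X \<Longrightarrow> x \<in> X \<Longrightarrow> r *\<^sub>R x \<in> X"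
  using csubspace_scaleC[of X x "of_real r"] by (simp add: scaleC_of_real)

lemma csubspace_sum: "csubspace X \<Longrightarrow> (\<And>i. i \<in> I \<Longrightarrow> f i \<in> X) \<Longrightarrow> (\<Sum>i\<in>I. f i) \<in> X"
  by (induction I rule: infinite_finite_induct) (auto intro: csubspace_add csubspace_zero)

lemma closed_csubspace_imp: "closed_csubspace X \<Longrightarrow> csubspace X"
  by (simp add: closed_csubspace_def)

lemmas cc_zero = csubspace_zero[OF closed_csubspace_imp]
  and cc_add = csubspace_add[OF closed_csubspace_imp]
  and cc_scaleC = csubspace_scaleC[OF closed_csubspace_imp]
  and cc_minus = csubspace_minus[OF closed_csubspace_imp]
  and cc_diff = csubspace_diff[OF closed_csubspace_imp]
  and cc_sum = csubspace_sum[OF closed_csubspace_imp]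

lemma csubspace_UNIV [simp]: "csubspace UNIV"
  by (simp add: csubspace_def)

lemma closed_csubspace_UNIV [simp]: "closed_csubspace UNIV"
  by (simp add: closed_csubspace_def)

lemma closed_csubspace_Int: "closed_csubspace X \<Longrightarrow> closed_csubspace Y \<Longrightarrow> closed_csubspace (X \<inter> Y)"
  by (auto simp: closed_csubspace_def csubspace_def)

lemma closed_csubspace_closed_cspan [simp]: "closed_csubspace (closed_cspan S)"
  unfolding closed_cspan_def closed_csubspace_def csubspace_def by auto

lemma closed_cspan_superset: "S \<subseteq> closed_cspan S"
  by (auto simp: closed_cspan_def)

lemma closed_cspan_base: "x \<in> S \<Longrightarrow> x \<in> closed_cspan S"
  using closed_cspan_superset by blast

lemma closed_cspan_minimal: "S \<subseteq> X \<Longrightarrow> closed_csubspace X \<Longrightarrow> closed_cspan S \<subseteq> X"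
  by (auto simp: closed_cspan_def)

lemma csubspace_closure:
  assumes "csubspace X" shows "csubspace (closure X)"
proof (rule csubspaceI)
  show "0 \<in> closure X" using assms closure_subset csubspace_zero by blast
  show "x + y \<in> closure X" if xy: "x \<in> closure X" "y \<in> closure X" for x y
  proof -
    obtain f g where "\<And>n. f n \<in> X" "f \<longlonglongrightarrow> x" "\<And>n. g n \<in> X" "g \<longlonglongrightarrow> y"
      using xy unfolding closure_sequential by blast
    then have "(\<lambda>n. f n + g n) \<longlonglongrightarrow> x + y" "\<And>n. f n + g n \<in> X"
      by (auto intro: tendsto_add csubspace_add[OF assms])
    then show ?thesis unfolding closure_sequential by (intro exI[of _ "\<lambda>n. f n + g n"]) auto
  qed
  show "c *\<^sub>C x \<in> closure X" if x: "x \<in> closure X" for c x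
  proof -
    obtain f where "\<And>n. f n \<in> X" "f \<longlonglongrightarrow> x"
      using x unfolding closure_sequential by blast
    then have "(\<lambda>n. c *\<^sub>C f n) \<longlonglongrightarrow> c *\<^sub>C x" "\<And>n. c *\<^sub>C f n \<in> X"
      by (auto intro: tendsto_scaleC csubspace_scaleC[OF assms])
    then show ?thesis unfolding closure_sequential by (intro exI[of _ "\<lambda>n. c *\<^sub>C f n"]) auto
  qed
qed

lemma closed_csubspace_closure: "csubspace X \<Longrightarrow> closed_csubspace (closure X)"
  by (simp add: closed_csubspace_def csubspace_closure)

lemma closed_cspan_csubspace: "csubspace X \<Longrightarrow> closed_cspan X = closure X"
proof
  show "closed_cspan X \<subseteq> closure X" if "csubspace X"
    by (rule closed_cspan_minimal[OF closure_subset closed_csubspace_closure[OF that]])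
  show "closure X \<subseteq> closed_cspan X"
    using closed_csubspace_closed_cspan[of X]
    by (intro closure_minimal closed_cspan_superset) (simp add: closed_csubspace_def)
qed

definition orth :: "'h::complex_inner set \<Rightarrow> 'h set" where
  "orth S = {x. \<forall>y\<in>S. cinner x y = 0}"

lemma orthI: "(\<And>y. y \<in> S \<Longrightarrow> cinner x y = 0) \<Longrightarrow> x \<in> orth S"
  by (simp add: orth_def)

lemma orthD: "x \<in> orth S \<Longrightarrow> y \<in> S \<Longrightarrow> cinner x y = 0"
  and orthD': "x \<in> orth S \<Longrightarrow> y \<in> S \<Longrightarrow> cinner y x = 0"
  by (auto simp: orth_def cinner_eq_zero_commute[of y x])

lemma orth_diff_eq: "X \<ominus> Y = X \<inter> orth Y"
  by (auto simp: orth_diff_def orth_def)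

lemma closed_csubspace_cinner_eq:
  assumes "bounded_linear f" "\<And>c x. f (c *\<^sub>C x) = c * f x"
  shows "closed_csubspace {x::'a::complex_inner. cinner x y = f x}"
proof -
  have "continuous_on UNIV (\<lambda>x::'a. cinner x y)" "continuous_on UNIV f"
    by (rule linear_continuous_on, simp add: bounded_linear_cinner_left assms)+
  then have "closed {x::'a. cinner x y = f x}" by (rule closed_Collect_eq)
  moreover have "f 0 = 0" "f (u + v) = f u + f v" for u v
    using assms(1) by (simp_all add: linear_simps)
  ultimately show ?thesis using assms(2)
    by (auto simp: closed_csubspace_def csubspace_def cinner_add_left cinner_scaleC_left)
qed

lemma closed_csubspace_orth [simp]: "closed_csubspace (orth S)"
proof -
  have 1: "orth S = \<Inter>((\<lambda>y. {x. cinner x y = 0}) ` S)" by (auto simp: orth_def)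
  have 2: "closed_csubspace {x. cinner x y = 0}" for y :: 'a
    by (rule closed_csubspace_cinner_eq) auto
  show ?thesis
    unfolding 1 using 2 unfolding closed_csubspace_def csubspace_def by (auto intro!: closed_INT)
qed

text \<open>If x is orthogonal to S, then S lies in the closed subspace \<open>orth {x}\<close>,
  which therefore contains the closed span. Equations are often extended from generators in this way
  below.\<close>

lemma orth_closed_cspan: "orth (closed_cspan S) = orth S"
proof
  show "orth (closed_cspan S) \<subseteq> orth S" using closed_cspan_superset by (auto simp: orth_def)
  show "orth S \<subseteq> orth (closed_cspan S)"
  proof
    fix x assume x: "x \<in> orth S"
    have "S \<subseteq> orth {x}" using x by (auto simp: orth_def cinner_eq_zero_commute[of _ x])
    then have "closed_cspan S \<subseteq> orth {x}" by (rule closed_cspan_minimal) simp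
    then show "x \<in> orth (closed_cspan S)"
      by (auto simp: orth_def cinner_eq_zero_commute[of x] subset_iff)
  qed
qed

lemma orth_antimono: "S \<subseteq> T \<Longrightarrow> orth T \<subseteq> orth S"
  by (auto simp: orth_def)

lemma cc_eq_by_cinner:
  assumes "csubspace X" "x \<in> X" "y \<in> X" "\<And>z. z \<in> X \<Longrightarrow> cinner x z = cinner y z"
  shows "x = y"
proof -
  have "x - y \<in> X" using assms csubspace_diff by blast
  then have "cinner (x - y) (x - y) = 0" using assms(4)[of "x - y"] by (simp add: cinner_diff_left)
  then show ?thesis by simp
qed

subsection \<open>Orthogonal projections\<close>

lemma closest_point_orthogonal:
  fixes X :: "'h::complex_inner set"
  assumes X: "csubspace X" and p: "p \<in> X" "\<And>y. y \<in> X \<Longrightarrow> norm (x - p) \<le> norm (x - y)" and y: "y \<in> X"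
  shows "cinner (x - p) y = 0"
proof -
  have re: "inner (x - p) z = 0" if z: "z \<in> X" for z
  proof (cases "z = 0")
    case False
    \<comment> \<open>This t minimises the norm of x - p - t z; if the inner product were nonzero,
      the quadratic in t would drop below its value at 0.\<close>
    define t where "t = inner (x - p) z / (norm z)\<^sup>2"
    have "norm (x - p) \<le> norm (x - (p + t *\<^sub>R z))"
      by (intro p(2) csubspace_add csubspace_scaleR X p z)
    then have "(norm (x - p))\<^sup>2 \<le> (norm ((x - p) - t *\<^sub>R z))\<^sup>2"
      by (simp add: diff_diff_eq)
    also have "\<dots> = (norm (x - p))\<^sup>2 - 2 * t * inner (x - p) z + t\<^sup>2 * (norm z)\<^sup>2"
      using dot_norm_neg[of "x - p" "t *\<^sub>R z"] by (simp add: power_mult_distrib field_simps)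
    also have "t\<^sup>2 * (norm z)\<^sup>2 = t * inner (x - p) z"
      using False by (simp add: t_def power2_eq_square)
    finally have "t * inner (x - p) z \<le> 0" by simp
    then have "(inner (x - p) z)\<^sup>2 \<le> 0" using False
      by (simp add: t_def power2_eq_square divide_le_0_iff mult_le_0_iff)
    then show ?thesis by simp
  qed simp
  \<comment> \<open>The imaginary part is the real inner product with i y, which lies in X as
    well.\<close>
  have "Im (cinner (x - p) y) = 0" using re csubspace_scaleC[OF X y] by (simp add: Im_cinner)
  moreover have "Re (cinner (x - p) y) = 0" using re[OF y] by (simp add: Re_cinner)
  ultimately show ?thesis by (simp add: complex_eq_iff)
qed

lemma projection_exists:
  fixes X :: "'h::chilbert_space set"
  assumes X: "closed_csubspace X"
  shows "\<exists>p\<in>X. \<forall>y\<in>X. cinner (x - p) y = 0"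
proof -
  have sub: "csubspace X" and cl: "closed X" and ne: "X \<noteq> {}"
    using X csubspace_zero by (auto simp: closed_csubspace_def)
  define d where "d = infdist x X"
  have d: "d \<le> norm (x - y)" if "y \<in> X" for y
    using infdist_le[OF that, of x] by (simp add: d_def dist_norm)
  have d0: "0 \<le> d" by (simp add: d_def infdist_nonneg)
  have "\<exists>y\<in>X. norm (x - y) < d + e" if "e > 0" for e
  proof -
    have "Inf (dist x ` X) < d + e" using that ne by (simp add: d_def infdist_def)
    then obtain r where "r \<in> dist x ` X" "r < d + e" using cInf_lessD[of "dist x ` X"] ne by auto
    then show ?thesis unfolding dist_norm by blast
  qed
  then have "\<forall>n. \<exists>y. y \<in> X \<and> norm (x - y) < d + inverse (real (Suc n))"
    by (metis inverse_positive_iff_positive of_nat_0_less_iff zero_less_Suc)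
  then obtain Y where "\<forall>n. Y n \<in> X \<and> norm (x - Y n) < d + inverse (real (Suc n))"
    unfolding choice_iff by blast
  then have Y: "\<And>n. Y n \<in> X" "\<And>n. norm (x - Y n) < d + inverse (real (Suc n))" by blast+
  have lim: "(\<lambda>n. norm (x - Y n)) \<longlonglongrightarrow> d"
  proof (rule tendsto_sandwich[where f = "\<lambda>_. d"])
    show "(\<lambda>n. d + inverse (real (Suc n))) \<longlonglongrightarrow> d"
      using tendsto_add[OF tendsto_const LIMSEQ_inverse_real_of_nat, of d] by simp
  next
    show "\<forall>\<^sub>F n in sequentially. norm (x - Y n) \<le> d + inverse (real (Suc n))"
      using Y(2) by (intro always_eventually allI less_imp_le)
    show "\<forall>\<^sub>F n in sequentially. d \<le> norm (x - Y n)"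
      using d[OF Y(1)] by (intro always_eventually allI)
  qed (rule tendsto_const)
  \<comment> \<open>Parallelogram law: the midpoint of Y m and Y n is in X, hence at distance at
    least d from x. This makes the minimising sequence Cauchy.\<close>
  have par: "(norm (Y m - Y n))\<^sup>2 \<le> 2 * (norm (x - Y m))\<^sup>2 + 2 * (norm (x - Y n))\<^sup>2 - 4 * d\<^sup>2" for m n
  proof -
    have mid: "(1/2) *\<^sub>R (Y m + Y n) \<in> X" by (intro csubspace_scaleR csubspace_add sub Y)
    have "(norm ((x - Y m) + (x - Y n)))\<^sup>2 + (norm ((x - Y m) - (x - Y n)))\<^sup>2
       = 2 * (norm (x - Y m))\<^sup>2 + 2 * (norm (x - Y n))\<^sup>2"
      unfolding norm_add_sq norm_diff_sq by simp
    moreover have "(x - Y m) + (x - Y n) = 2 *\<^sub>R (x - (1/2) *\<^sub>R (Y m + Y n))"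
      by (simp add: algebra_simps scaleR_2)
    then have "norm ((x - Y m) + (x - Y n)) \<ge> 2 * d" using d[OF mid] by simp
    then have "(norm ((x - Y m) + (x - Y n)))\<^sup>2 \<ge> (2 * d)\<^sup>2" using d0 by (intro power_mono) auto
    moreover have "(x - Y m) - (x - Y n) = - (Y m - Y n)" by simp
    then have "norm ((x - Y m) - (x - Y n)) = norm (Y m - Y n)" by (metis norm_minus_cancel)
    ultimately show ?thesis by (simp add: power_mult_distrib)
  qed
  have "Cauchy Y"
  proof (rule CauchyI)
    fix e :: real assume e: "e > 0"
    have "(\<lambda>n. (norm (x - Y n))\<^sup>2) \<longlonglongrightarrow> d\<^sup>2" by (intro tendsto_intros lim)
    then have "\<exists>N. \<forall>n\<ge>N. norm ((norm (x - Y n))\<^sup>2 - d\<^sup>2) < e\<^sup>2 / 4"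
      by (rule LIMSEQ_D) (use e in simp)
    then obtain N where N: "\<And>n. n \<ge> N \<Longrightarrow> \<bar>(norm (x - Y n))\<^sup>2 - d\<^sup>2\<bar> < e\<^sup>2 / 4"
      unfolding real_norm_def by blast
    have "norm (Y m - Y n) < e" if "m \<ge> N" "n \<ge> N" for m n
    proof -
      have "(norm (Y m - Y n))\<^sup>2 < e\<^sup>2" using par[of m n] N[OF that(1)] N[OF that(2)] by linarith
      then show ?thesis by (rule power2_less_imp_less) (use e in simp)
    qed
    then show "\<exists>M. \<forall>m\<ge>M. \<forall>n\<ge>M. norm (Y m - Y n) < e" by blast
  qed
  then obtain p where p: "Y \<longlonglongrightarrow> p" unfolding Cauchy_convergent_iff convergent_def by (rule exE)
  have pX: "p \<in> X" by (rule closed_sequentially[OF cl Y(1) p])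
  have "(\<lambda>n. norm (x - Y n)) \<longlonglongrightarrow> norm (x - p)" by (intro tendsto_intros p)
  then have "norm (x - p) = d" by (rule LIMSEQ_unique[OF _ lim])
  then have "norm (x - p) \<le> norm (x - y)" if "y \<in> X" for y using d[OF that] by simp
  then have "\<forall>y\<in>X. cinner (x - p) y = 0"
    by (intro ballI closest_point_orthogonal[OF sub pX])
  then show ?thesis by (rule bexI[OF _ pX])
qed

lemma proj_eqI:
  assumes "csubspace X" "p \<in> X" "\<And>y. y \<in> X \<Longrightarrow> cinner (x - p) y = 0"
  shows "proj X x = p"
  unfolding proj_def
proof (rule the_equality)
  fix q assume q: "q \<in> X \<and> (\<forall>y\<in>X. cinner (x - q) y = 0)"
  show "q = p"
  proof (rule cc_eq_by_cinner[of X])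
    fix z assume "z \<in> X"
    then have "cinner (x - p) z = 0" "cinner (x - q) z = 0" using assms(3) q by auto
    then show "cinner q z = cinner p z" by (simp add: cinner_diff_left)
  next
    show "csubspace X" "q \<in> X" "p \<in> X" using assms q by blast+
  qed
next
  show "p \<in> X \<and> (\<forall>y\<in>X. cinner (x - p) y = 0)" using assms by blast
qed

lemma
  fixes X :: "'h::chilbert_space set"
  assumes "closed_csubspace X"
  shows proj_in: "proj X x \<in> X" and proj_orth: "y \<in> X \<Longrightarrow> cinner (x - proj X x) y = 0"
proof -
  obtain p where p: "p \<in> X" "\<And>y. y \<in> X \<Longrightarrow> cinner (x - p) y = 0"
    using projection_exists[OF assms] by blast
  then have "proj X x = p" by (intro proj_eqI closed_csubspace_imp assms)
  with p show "proj X x \<in> X" "y \<in> X \<Longrightarrow> cinner (x - proj X x) y = 0" by auto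
qed

lemma proj_cinner:
  fixes X :: "'h::chilbert_space set"
  assumes "closed_csubspace X" "y \<in> X"
  shows "cinner (proj X x) y = cinner x y"
  using proj_orth[OF assms, of x] by (simp add: cinner_diff_left)

lemma proj_cinner':
  fixes X :: "'h::chilbert_space set"
  assumes "closed_csubspace X" "y \<in> X"
  shows "cinner y (proj X x) = cinner y x"
  using proj_cinner[OF assms, of x] cinner_commute[of y] cinner_commute[of "proj X x"] by metis

lemma proj_same: "csubspace X \<Longrightarrow> x \<in> X \<Longrightarrow> proj X x = x"
  by (rule proj_eqI) auto

lemma proj_pythagoras:
  fixes X :: "'h::chilbert_space set"
  assumes "closed_csubspace X"
  shows "(norm x)\<^sup>2 = (norm (proj X x))\<^sup>2 + (norm (x - proj X x))\<^sup>2"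
proof -
  have "cinner (proj X x) (x - proj X x) = 0"
    using proj_orth[OF assms proj_in[OF assms]] cinner_eq_zero_commute by blast
  then show ?thesis using norm_add_sq[of "proj X x" "x - proj X x"] by simp
qed

lemma norm_proj_le:
  fixes X :: "'h::chilbert_space set"
  assumes "closed_csubspace X" shows "norm (proj X x) \<le> norm x"
  using proj_pythagoras[OF assms, of x] by (auto intro: power2_le_imp_le)

text \<open>For x in Y, the difference of x and its projection onto X lies in Y and is orthogonal to
  X. Identifications of closed subspaces below are usually reduced to this test.\<close>

lemma orth_eq_0:
  fixes X Y :: "'h::chilbert_space set"
  assumes X: "closed_csubspace X" and Y: "csubspace Y" "X \<subseteq> Y"
    and *: "\<And>x. x \<in> Y \<Longrightarrow> x \<in> orth X \<Longrightarrow> x = 0"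
  shows "X = Y"
proof
  show "Y \<subseteq> X"
  proof
    fix x assume x: "x \<in> Y"
    have "x - proj X x \<in> Y"
      by (rule csubspace_diff[OF Y(1) x subsetD[OF Y(2) proj_in[OF X]]])
    moreover have "x - proj X x \<in> orth X" by (intro orthI proj_orth[OF X])
    ultimately have "x - proj X x = 0" by (rule *)
    then show "x \<in> X" using proj_in[OF X, of x] by simp
  qed
qed fact

subsection \<open>Bounded operators between closed subspaces\<close>

lemma bounded_opI:
  assumes "\<And>x. x \<in> X \<Longrightarrow> f x \<in> Y" "\<And>x y. x \<in> X \<Longrightarrow> y \<in> X \<Longrightarrow> f (x + y) = f x + f y"
    "\<And>c x. x \<in> X \<Longrightarrow> f (c *\<^sub>C x) = c *\<^sub>C f x" "\<And>x. x \<in> X \<Longrightarrow> norm (f x) \<le> b * norm x"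
  shows "bounded_op X Y f"
  unfolding bounded_op_def using assms by blast

lemma bounded_op_in: "bounded_op X Y f \<Longrightarrow> x \<in> X \<Longrightarrow> f x \<in> Y"
  and bounded_op_add: "bounded_op X Y f \<Longrightarrow> x \<in> X \<Longrightarrow> y \<in> X \<Longrightarrow> f (x + y) = f x + f y"
  and bounded_op_scaleC: "bounded_op X Y f \<Longrightarrow> x \<in> X \<Longrightarrow> f (c *\<^sub>C x) = c *\<^sub>C f x"
  by (simp_all add: bounded_op_def)

lemma bounded_op_bound:
  assumes "bounded_op X Y f" obtains b where "b \<ge> 0" "\<And>x. x \<in> X \<Longrightarrow> norm (f x) \<le> b * norm x"
proof -
  obtain b where b: "\<forall>x\<in>X. norm (f x) \<le> b * norm x" using assms unfolding bounded_op_def by blast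
  have "norm (f x) \<le> max b 0 * norm x" if "x \<in> X" for x
    using b[rule_format, OF that] mult_right_mono[of b "max b 0" "norm x"] by simp
  then show ?thesis using that[of "max b 0"] by simp
qed

lemma bounded_op_zero: "bounded_op X Y f \<Longrightarrow> 0 \<in> X \<Longrightarrow> f 0 = 0"
  using bounded_op_scaleC[of X Y f 0 0] by simp

lemma bounded_op_minus: "bounded_op X Y f \<Longrightarrow> x \<in> X \<Longrightarrow> f (- x) = - f x"
  using bounded_op_scaleC[of X Y f x "-1"] by simp

lemma bounded_op_scaleR: "bounded_op X Y f \<Longrightarrow> x \<in> X \<Longrightarrow> f (r *\<^sub>R x) = r *\<^sub>R f x"
  using bounded_op_scaleC[of X Y f x "of_real r"] by (simp add: scaleC_of_real)

lemma bounded_op_diff: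
  assumes "bounded_op X Y f" "csubspace X" "x \<in> X" "y \<in> X" shows "f (x - y) = f x - f y"
  using bounded_op_add[OF assms(1,3) csubspace_minus[OF assms(2,4)]] bounded_op_minus[OF assms(1,4)]
  by simp

lemma bounded_op_sum:
  assumes f: "bounded_op X Y f" and X: "csubspace X" and "\<And>i. i \<in> I \<Longrightarrow> g i \<in> X"
  shows "f (\<Sum>i\<in>I. g i) = (\<Sum>i\<in>I. f (g i))"
  using assms(3)
proof (induction I rule: infinite_finite_induct)
  case (insert i I)
  have "f (g i + (\<Sum>i\<in>I. g i)) = f (g i) + f (\<Sum>i\<in>I. g i)"
    by (rule bounded_op_add[OF f]) (use insert.prems in \<open>auto intro: csubspace_sum[OF X]\<close>)
  then show ?case using insert by simp
qed (simp_all add: bounded_op_zero[OF f csubspace_zero[OF X]])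

lemma bounded_op_subset:
  "bounded_op X Y f \<Longrightarrow> X' \<subseteq> X \<Longrightarrow> (\<And>x. x \<in> X' \<Longrightarrow> f x \<in> Y') \<Longrightarrow> bounded_op X' Y' f"
  unfolding bounded_op_def by (simp add: subset_iff) blast

lemma bounded_op_compose:
  assumes f: "bounded_op X Y f" and g: "bounded_op Y Z g" shows "bounded_op X Z (\<lambda>x. g (f x))"
proof -
  obtain b where b: "b \<ge> 0" "\<And>x. x \<in> X \<Longrightarrow> norm (f x) \<le> b * norm x" using bounded_op_bound[OF f] by blast
  obtain c where c: "c \<ge> 0" "\<And>x. x \<in> Y \<Longrightarrow> norm (g x) \<le> c * norm x" using bounded_op_bound[OF g] by blast
  show ?thesis
  proof (rule bounded_opI[where b = "c * b"])
    fix x assume x: "x \<in> X"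
    have "norm (g (f x)) \<le> c * norm (f x)" by (rule c(2)[OF bounded_op_in[OF f x]])
    also have "\<dots> \<le> c * (b * norm x)" by (rule mult_left_mono[OF b(2)[OF x] c(1)])
    finally show "norm (g (f x)) \<le> c * b * norm x" by (simp add: mult.assoc)
  qed (simp_all add: bounded_op_in[OF f] bounded_op_in[OF g] bounded_op_add[OF f] bounded_op_add[OF g]
      bounded_op_scaleC[OF f] bounded_op_scaleC[OF g])
qed

lemma bounded_op_add_op:
  assumes f: "bounded_op X Y f" and g: "bounded_op X Y g" and Y: "csubspace Y"
  shows "bounded_op X Y (\<lambda>x. f x + g x)"
proof -
  obtain b where b: "\<And>x. x \<in> X \<Longrightarrow> norm (f x) \<le> b * norm x" using bounded_op_bound[OF f] by blast
  obtain c where c: "\<And>x. x \<in> X \<Longrightarrow> norm (g x) \<le> c * norm x" using bounded_op_bound[OF g] by blast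
  show ?thesis
  proof (rule bounded_opI[where b = "b + c"])
    fix x assume x: "x \<in> X"
    show "norm (f x + g x) \<le> (b + c) * norm x"
      using norm_triangle_ineq[of "f x" "g x"] b[OF x] c[OF x] by (simp add: distrib_right)
  qed (simp_all add: bounded_op_in[OF f] bounded_op_in[OF g] bounded_op_add[OF f] bounded_op_add[OF g]
      bounded_op_scaleC[OF f] bounded_op_scaleC[OF g] csubspace_add[OF Y] scaleC_add_right algebra_simps)
qed

lemma bounded_op_scaleC_op:
  assumes f: "bounded_op X Y f" and Y: "csubspace Y"
  shows "bounded_op X Y (\<lambda>x. c *\<^sub>C f x)"
proof -
  obtain b where b: "\<And>x. x \<in> X \<Longrightarrow> norm (f x) \<le> b * norm x" using bounded_op_bound[OF f] by blast
  show ?thesis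
  proof (rule bounded_opI[where b = "cmod c * b"])
    fix x assume x: "x \<in> X"
    show "norm (c *\<^sub>C f x) \<le> cmod c * b * norm x"
      using mult_left_mono[OF b[OF x], of "cmod c"] by (simp add: norm_scaleC mult.assoc)
  qed (simp_all add: bounded_op_in[OF f] bounded_op_add[OF f] bounded_op_scaleC[OF f]
      csubspace_scaleC[OF Y] scaleC_add_right scaleC_scaleC mult.commute)
qed

lemma bounded_op_minus_op:
  "bounded_op X Y f \<Longrightarrow> csubspace Y \<Longrightarrow> bounded_op X Y (\<lambda>x. - f x)"
  using bounded_op_scaleC_op[of X Y f "-1"] by simp

lemma bounded_op_diff_op:
  "bounded_op X Y f \<Longrightarrow> bounded_op X Y g \<Longrightarrow> csubspace Y \<Longrightarrow> bounded_op X Y (\<lambda>x. f x - g x)"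
  using bounded_op_add_op[of X Y f "\<lambda>x. - g x"] bounded_op_minus_op[of X Y g] by simp

lemma bounded_op_zero_op: "csubspace Y \<Longrightarrow> bounded_op X Y (\<lambda>x. 0)"
  by (rule bounded_opI[where b = 0]) (simp_all add: csubspace_zero)

lemma bounded_op_sum_op:
  assumes "\<And>i. i \<in> I \<Longrightarrow> bounded_op X Y (f i)" "csubspace Y"
  shows "bounded_op X Y (\<lambda>x. \<Sum>i\<in>I. f i x)"
  using assms(1)
proof (induction I rule: infinite_finite_induct)
  case (insert i I)
  then show ?case by (simp add: bounded_op_add_op assms(2))
qed (simp_all add: bounded_op_zero_op assms(2))

lemma bounded_op_ident: "bounded_op X X (\<lambda>x. x)"
  by (rule bounded_opI[where b = 1]) simp_all

lemma bounded_op_proj: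
  fixes Z :: "'h::chilbert_space set"
  assumes Z: "closed_csubspace Z" shows "bounded_op X Z (proj Z)"
proof (rule bounded_opI[where b = 1])
  have sub: "csubspace Z" by (rule closed_csubspace_imp[OF Z])
  show "proj Z (x + y) = proj Z x + proj Z y" for x y
  proof (rule proj_eqI[OF sub])
    show "proj Z x + proj Z y \<in> Z" by (intro cc_add[OF Z] proj_in[OF Z])
    show "cinner (x + y - (proj Z x + proj Z y)) z = 0" if "z \<in> Z" for z
      using proj_orth[OF Z that, of x] proj_orth[OF Z that, of y]
      by (simp add: cinner_diff_left cinner_add_left)
  qed
  show "proj Z (c *\<^sub>C x) = c *\<^sub>C proj Z x" for c x
  proof (rule proj_eqI[OF sub])
    show "c *\<^sub>C proj Z x \<in> Z" by (intro cc_scaleC[OF Z] proj_in[OF Z])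
    show "cinner (c *\<^sub>C x - c *\<^sub>C proj Z x) z = 0" if "z \<in> Z" for z
      using proj_orth[OF Z that, of x] by (simp add: scaleC_diff_right [symmetric] cinner_scaleC_left)
  qed
qed (simp_all add: proj_in[OF Z] norm_proj_le[OF Z])

lemma bounded_op_tendsto:
  assumes f: "bounded_op X Y f" and X: "csubspace X" and x: "\<And>n. x n \<in> X" "l \<in> X" "x \<longlonglongrightarrow> l"
  shows "(\<lambda>n. f (x n)) \<longlonglongrightarrow> f l"
proof -
  obtain b where b: "\<And>x. x \<in> X \<Longrightarrow> norm (f x) \<le> b * norm x" using bounded_op_bound[OF f] by blast
  have "(\<lambda>n. f (x n) - f l) \<longlonglongrightarrow> 0"
  proof (rule Lim_null_comparison)
    show "\<forall>\<^sub>F n in sequentially. norm (f (x n) - f l) \<le> b * norm (x n - l)"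
      using b[OF csubspace_diff[OF X x(1,2)]]
      by (simp add: bounded_op_diff[OF f X x(1,2)])
    have "(\<lambda>n. b * norm (x n - l)) \<longlonglongrightarrow> b * norm (l - l)" by (intro tendsto_intros x)
    then show "(\<lambda>n. b * norm (x n - l)) \<longlonglongrightarrow> 0" by simp
  qed
  then show ?thesis by (simp add: LIM_zero_iff)
qed

lemma closed_csubspace_preimage:
  assumes f: "bounded_op X Y f" and X: "closed_csubspace X" and Z: "closed_csubspace Z"
  shows "closed_csubspace {x \<in> X. f x \<in> Z}"
proof -
  have sub: "csubspace X" by (rule closed_csubspace_imp[OF X])
  have "closed {x \<in> X. f x \<in> Z}"
    unfolding closed_sequential_limits
  proof (intro allI impI, elim conjE)
    fix x l assume x: "\<forall>n. x n \<in> {x \<in> X. f x \<in> Z}" "x \<longlonglongrightarrow> l"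
    have xX: "x n \<in> X" "f (x n) \<in> Z" for n using x(1) by simp_all
    have "l \<in> X" using X by (intro closed_sequentially[OF _ xX(1) x(2)]) (simp add: closed_csubspace_def)
    moreover have "(\<lambda>n. f (x n)) \<longlonglongrightarrow> f l"
      by (rule bounded_op_tendsto[OF f sub xX(1) \<open>l \<in> X\<close> x(2)])
    then have "f l \<in> Z"
      using Z by (intro closed_sequentially[OF _ xX(2)]) (simp_all add: closed_csubspace_def)
    ultimately show "l \<in> {x \<in> X. f x \<in> Z}" by simp
  qed
  moreover have "csubspace {x \<in> X. f x \<in> Z}"
    by (rule csubspaceI)
      (simp_all add: csubspace_zero csubspace_add csubspace_scaleC sub bounded_op_zero[OF f]
        bounded_op_add[OF f] bounded_op_scaleC[OF f] closed_csubspace_imp[OF Z])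
  ultimately show ?thesis by (simp add: closed_csubspace_def)
qed

lemma closed_csubspace_zero [simp]: "closed_csubspace {0}"
  by (simp add: closed_csubspace_def csubspace_def)

text \<open>Induction over a closed span: the preimage of Z is a closed subspace, so it is enough to
  look at the generators.\<close>

lemma bounded_op_closed_cspan_in:
  assumes f: "bounded_op X Y f" and X: "closed_csubspace X" and Z: "closed_csubspace Z"
    and S: "S \<subseteq> X" "\<And>s. s \<in> S \<Longrightarrow> f s \<in> Z" and x: "x \<in> closed_cspan S"
  shows "f x \<in> Z"
proof -
  have "closed_cspan S \<subseteq> {x \<in> X. f x \<in> Z}"
    by (rule closed_cspan_minimal[OF _ closed_csubspace_preimage[OF f X Z]]) (use S in blast)
  then show ?thesis using x by blast
qed

lemma bounded_op_eq_on_closed_cspan: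
  assumes f: "bounded_op X Y f" and g: "bounded_op X Y' g" and X: "closed_csubspace X"
    and S: "S \<subseteq> X" "\<And>s. s \<in> S \<Longrightarrow> f s = g s" and x: "x \<in> closed_cspan S"
  shows "f x = g x"
proof -
  have "bounded_op X UNIV f" "bounded_op X UNIV g"
    using f g by (auto elim!: bounded_op_subset)
  then have "bounded_op X UNIV (\<lambda>x. f x - g x)" by (rule bounded_op_diff_op) simp
  from bounded_op_closed_cspan_in[OF this X closed_csubspace_zero S(1) _ x] S(2) show ?thesis by simp
qed

subsection \<open>Adjoints\<close>

lemma riesz_representation:
  fixes X :: "'h::chilbert_space set"
  assumes X: "closed_csubspace X" and f: "bounded_op X UNIV f"
  shows "\<exists>y\<in>X. \<forall>x\<in>X. (f x :: complex) = cinner x y"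
proof -
  define N where "N = {x \<in> X. f x \<in> {0}}"
  have N: "closed_csubspace N" unfolding N_def by (rule closed_csubspace_preimage[OF f X]) simp
  show ?thesis
  proof (cases "\<forall>x\<in>X. f x = 0")
    case True
    then show ?thesis by (intro bexI[of _ 0]) (simp_all add: cc_zero[OF X])
  next
    case False
    then obtain x0 where x0: "x0 \<in> X" "f x0 \<noteq> 0" by blast
    define z where "z = x0 - proj N x0"
    have p: "proj N x0 \<in> X" "f (proj N x0) = 0" using proj_in[OF N, of x0] by (simp_all add: N_def)
    have zX: "z \<in> X" unfolding z_def by (rule cc_diff[OF X x0(1) p(1)])
    have fz: "f z = f x0" unfolding z_def
      by (simp add: bounded_op_diff[OF f closed_csubspace_imp[OF X] x0(1) p(1)] p(2))
    have z0: "z \<noteq> 0" using fz x0(2) bounded_op_zero[OF f cc_zero[OF X]] by (intro notI) simp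
    \<comment> \<open>The representing vector spans the complement of the kernel N; the scalar is
      forced by f z = <z, y>. For general x one uses that f z x - f x z is annihilated by f.\<close>
    define y where "y = cnj (f z / cinner z z) *\<^sub>C z"
    have "f x = cinner x y" if x: "x \<in> X" for x
    proof -
      let ?w = "f z *\<^sub>C x - f x *\<^sub>C z"
      have "?w \<in> N" unfolding N_def
        by (simp add: cc_diff[OF X] cc_scaleC[OF X] x zX bounded_op_diff[OF f closed_csubspace_imp[OF X]]
            bounded_op_scaleC[OF f] scaleC_complex_def)
      then have "cinner z ?w = 0" unfolding z_def by (rule proj_orth[OF N])
      then have "cinner ?w z = 0" by (simp add: cinner_eq_zero_commute)
      then have "f z * cinner x z = f x * cinner z z" by (simp add: cinner_diff_left cinner_scaleC_left)
      then show ?thesis using z0 by (simp add: y_def cinner_scaleC_right field_simps)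
    qed
    moreover have "y \<in> X" unfolding y_def by (rule cc_scaleC[OF X zX])
    ultimately show ?thesis by blast
  qed
qed

text \<open>Riesz for each functional x -> <f x, y>. Uniqueness of the representing vector makes g
  linear, and the bound carries over because |g y|^2 = <f (g y), y>.\<close>

lemma adj_exists:
  fixes X :: "'g::chilbert_space set" and Y :: "'h::complex_inner set"
  assumes X: "closed_csubspace X" and Y: "csubspace Y" and f: "bounded_op X Y f"
  shows "\<exists>g. bounded_op Y X g \<and> (\<forall>x\<in>X. \<forall>y\<in>Y. cinner (f x) y = cinner x (g y))"
proof -
  obtain b where b: "b \<ge> 0" "\<And>x. x \<in> X \<Longrightarrow> norm (f x) \<le> b * norm x" using bounded_op_bound[OF f] by blast
  have "\<exists>z\<in>X. \<forall>x\<in>X. cinner (f x) y = cinner x z" for y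
  proof (rule riesz_representation[OF X])
    show "bounded_op X UNIV (\<lambda>x. cinner (f x) y)"
    proof (rule bounded_opI[where b = "b * norm y"])
      fix x assume x: "x \<in> X"
      have "cmod (cinner (f x) y) \<le> norm (f x) * norm y" by (rule cmod_cinner_le)
      also have "\<dots> \<le> b * norm x * norm y" by (rule mult_right_mono[OF b(2)[OF x]]) simp
      finally show "norm (cinner (f x) y) \<le> b * norm y * norm x" by (simp add: algebra_simps)
    qed (simp_all add: bounded_op_add[OF f] bounded_op_scaleC[OF f] cinner_add_left cinner_scaleC_left
        scaleC_complex_def)
  qed
  then have "\<forall>y. \<exists>z. z \<in> X \<and> (\<forall>x\<in>X. cinner (f x) y = cinner x z)" by blast
  then obtain g where "\<forall>y. g y \<in> X \<and> (\<forall>x\<in>X. cinner (f x) y = cinner x (g y))"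
    unfolding choice_iff by blast
  then have g: "\<And>y. g y \<in> X" "\<And>x y. x \<in> X \<Longrightarrow> cinner (f x) y = cinner x (g y)" by blast+
  have "bounded_op Y X g"
  proof (rule bounded_opI[where b = b])
    show "g (x + y) = g x + g y" for x y
    proof (rule cc_eq_by_cinner[OF closed_csubspace_imp[OF X]])
      show "cinner (g (x + y)) z = cinner (g x + g y) z" if "z \<in> X" for z
        using g(2)[OF that, of "x + y"] g(2)[OF that, of x] g(2)[OF that, of y]
          cinner_commute[of z] by (metis cinner_add_right cinner_commute)
    qed (simp_all add: g(1) cc_add[OF X])
    show "g (c *\<^sub>C x) = c *\<^sub>C g x" for c x
    proof (rule cc_eq_by_cinner[OF closed_csubspace_imp[OF X]])
      show "cinner (g (c *\<^sub>C x)) z = cinner (c *\<^sub>C g x) z" if "z \<in> X" for z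
        using g(2)[OF that, of "c *\<^sub>C x"] g(2)[OF that, of x]
        by (metis cinner_scaleC_right cinner_commute)
    qed (simp_all add: g(1) cc_scaleC[OF X])
    show "norm (g y) \<le> b * norm y" for y
    proof (cases "g y = 0")
      case False
      have "(norm (g y))\<^sup>2 = cmod (cinner (f (g y)) y)"
        by (simp add: g(2)[OF g(1)] cinner_self norm_power)
      also have "\<dots> \<le> norm (f (g y)) * norm y" by (rule cmod_cinner_le)
      also have "\<dots> \<le> b * norm (g y) * norm y" by (rule mult_right_mono[OF b(2)[OF g(1)]]) simp
      finally show ?thesis using False by (simp add: power2_eq_square)
    qed (simp add: b)
  qed (rule g(1))
  with g(2) show ?thesis by blast
qed

lemma
  fixes X :: "'g::chilbert_space set" and Y :: "'h::complex_inner set"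
  assumes "closed_csubspace X" "csubspace Y" "bounded_op X Y f"
  shows bounded_op_adj: "bounded_op Y X (adj X Y f)"
    and adj_cinner: "x \<in> X \<Longrightarrow> y \<in> Y \<Longrightarrow> cinner x (adj X Y f y) = cinner (f x) y"
proof -
  have *: "bounded_op Y X (adj X Y f) \<and> (\<forall>x\<in>X. \<forall>y\<in>Y. cinner (f x) y = cinner x (adj X Y f y))"
    unfolding adj_def by (rule someI_ex[OF adj_exists[OF assms]])
  show "bounded_op Y X (adj X Y f)" using * by (rule conjunct1)
  show "cinner x (adj X Y f y) = cinner (f x) y" if "x \<in> X" "y \<in> Y" using * that by metis
qed

lemma adj_cinner':
  fixes X :: "'g::chilbert_space set" and Y :: "'h::complex_inner set"
  assumes "closed_csubspace X" "csubspace Y" "bounded_op X Y f" "x \<in> X" "y \<in> Y"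
  shows "cinner (adj X Y f y) x = cinner y (f x)"
  using adj_cinner[OF assms] cinner_commute[of "adj X Y f y" x] cinner_commute[of y "f x"] by simp

lemma adj_eqI:
  fixes X :: "'g::chilbert_space set" and Y :: "'h::complex_inner set"
  assumes "closed_csubspace X" "csubspace Y" "bounded_op X Y f"
    and "y \<in> Y" "z \<in> X" "\<And>x. x \<in> X \<Longrightarrow> cinner (f x) y = cinner x z"
  shows "adj X Y f y = z"
proof (rule cc_eq_by_cinner[OF closed_csubspace_imp[OF assms(1)]])
  show "adj X Y f y \<in> X" by (rule bounded_op_in[OF bounded_op_adj[OF assms(1-3)] assms(4)])
  show "cinner (adj X Y f y) x = cinner z x" if "x \<in> X" for x
    using adj_cinner[OF assms(1-3) that assms(4)] assms(6)[OF that] cinner_commute by metis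
qed fact

subsection \<open>Isometries and unitaries\<close>

lemma norm_eq_of_cinner: "cinner x x = cinner y y \<Longrightarrow> norm x = norm y"
  for x :: "'g::complex_inner" and y :: "'h::complex_inner"
  by (metis norm_eq_sqrt_inner Re_cinner)

lemma csubspace_image:
  assumes f: "bounded_op X Y f" and X: "csubspace X" shows "csubspace (f ` X)"
proof (rule csubspaceI)
  show "0 \<in> f ` X"
    by (rule image_eqI[OF _ csubspace_zero[OF X]]) (simp add: bounded_op_zero[OF f csubspace_zero[OF X]])
  show "a + b \<in> f ` X" if ab: "a \<in> f ` X" "b \<in> f ` X" for a b
  proof -
    obtain x y where "x \<in> X" "y \<in> X" "a = f x" "b = f y" using ab by blast
    then show ?thesis by (intro image_eqI[of _ _ "x + y"])
        (simp_all add: bounded_op_add[OF f] csubspace_add[OF X])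
  qed
  show "c *\<^sub>C a \<in> f ` X" if a: "a \<in> f ` X" for c a
  proof -
    obtain x where "x \<in> X" "a = f x" using a by blast
    then show ?thesis by (intro image_eqI[of _ _ "c *\<^sub>C x"])
        (simp_all add: bounded_op_scaleC[OF f] csubspace_scaleC[OF X])
  qed
qed

text \<open>An isometry reflects Cauchy sequences, so a limit of image points can be pulled
  back.\<close>

lemma closed_csubspace_isometric_image:
  fixes X :: "'g::chilbert_space set" and Y :: "'h::complex_inner set"
  assumes f: "bounded_op X Y f" and X: "closed_csubspace X" and iso: "\<And>x. x \<in> X \<Longrightarrow> norm (f x) = norm x"
  shows "closed_csubspace (f ` X)"
proof -
  have sub: "csubspace X" by (rule closed_csubspace_imp[OF X])
  have "closed (f ` X)"
    unfolding closed_sequential_limits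
  proof (intro allI impI, elim conjE)
    fix y l assume y: "\<forall>n. y n \<in> f ` X" "y \<longlonglongrightarrow> l"
    then have "\<forall>n. \<exists>x. x \<in> X \<and> y n = f x" by blast
    then obtain x where "\<forall>n. x n \<in> X \<and> y n = f (x n)" unfolding choice_iff by blast
    then have x: "\<And>n. x n \<in> X" "\<And>n. y n = f (x n)" by blast+
    have "norm (x m - x n) = norm (y m - y n)" for m n
      using iso[OF csubspace_diff[OF sub x(1,1), of m n]] by (simp add: bounded_op_diff[OF f sub x(1,1)] x(2))
    moreover have "Cauchy y" using y(2) by (rule LIMSEQ_imp_Cauchy)
    ultimately have "Cauchy x" by (simp add: Cauchy_iff)
    then obtain a where a: "x \<longlonglongrightarrow> a" unfolding Cauchy_convergent_iff convergent_def by (rule exE)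
    have aX: "a \<in> X" using X by (intro closed_sequentially[OF _ x(1) a]) (simp add: closed_csubspace_def)
    have "y \<longlonglongrightarrow> f a" using bounded_op_tendsto[OF f sub x(1) aX a] by (simp add: x(2) [symmetric])
    then have "l = f a" by (rule LIMSEQ_unique[OF y(2)])
    then show "l \<in> f ` X" using aX by simp
  qed
  moreover have "csubspace (f ` X)" by (rule csubspace_image[OF f sub])
  ultimately show ?thesis by (simp add: closed_csubspace_def)
qed

lemma unitary_bounded: "unitary_op X Y u \<Longrightarrow> bounded_op X Y u"
  and unitary_image: "unitary_op X Y u \<Longrightarrow> u ` X = Y"
  and unitary_cinner: "unitary_op X Y u \<Longrightarrow> x \<in> X \<Longrightarrow> y \<in> X \<Longrightarrow> cinner (u x) (u y) = cinner x y"
  and unitary_in: "unitary_op X Y u \<Longrightarrow> x \<in> X \<Longrightarrow> u x \<in> Y"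
  by (auto simp: unitary_op_def)

lemma unitary_norm: "unitary_op X Y u \<Longrightarrow> x \<in> X \<Longrightarrow> norm (u x) = norm x"
  by (rule norm_eq_of_cinner) (rule unitary_cinner)

lemma unitary_inj_on:
  assumes u: "unitary_op X Y u" and X: "csubspace X" shows "inj_on u X"
proof (rule inj_onI)
  fix x y assume xy: "x \<in> X" "y \<in> X" "u x = u y"
  have "norm (x - y) = norm (u (x - y))"
    by (rule unitary_norm[OF u csubspace_diff[OF X xy(1,2)], symmetric])
  also have "\<dots> = 0" by (simp add: bounded_op_diff[OF unitary_bounded[OF u] X xy(1,2)] xy(3))
  finally show "x = y" by simp
qed

lemma unitary_opI:
  assumes "\<And>x y. x \<in> X \<Longrightarrow> y \<in> X \<Longrightarrow> u (x + y) = u x + u y" "\<And>c x. x \<in> X \<Longrightarrow> u (c *\<^sub>C x) = c *\<^sub>C u x"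
    "u ` X = Y" and ip: "\<And>x y. x \<in> X \<Longrightarrow> y \<in> X \<Longrightarrow> cinner (u x) (u y) = cinner x y"
  shows "unitary_op X Y u"
proof -
  have "bounded_op X Y u"
    by (rule bounded_opI[where b = 1]) (use assms in \<open>auto simp: norm_eq_of_cinner[OF ip]\<close>)
  then show ?thesis using assms by (simp add: unitary_op_def)
qed

lemma unitary_closed_csubspace:
  fixes X :: "'g::chilbert_space set" and Y :: "'h::complex_inner set"
  assumes u: "unitary_op X Y u" and X: "closed_csubspace X" shows "closed_csubspace Y"
  using closed_csubspace_isometric_image[OF unitary_bounded[OF u] X unitary_norm[OF u]]
    unitary_image[OF u] by simp

lemma
  assumes u: "unitary_op X Y u" and X: "csubspace X"
  shows unitary_inv: "unitary_op Y X (inv_into X u)"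
    and unitary_inv_right: "y \<in> Y \<Longrightarrow> u (inv_into X u y) = y"
proof -
  have inj: "inj_on u X" by (rule unitary_inj_on[OF u X])
  have Y: "Y = u ` X" using unitary_image[OF u] by simp
  have l: "inv_into X u (u x) = x" if "x \<in> X" for x by (rule inv_into_f_f[OF inj that])
  show r: "u (inv_into X u y) = y" if "y \<in> Y" for y by (rule f_inv_into_f) (use that Y in simp)
  show "unitary_op Y X (inv_into X u)"
  proof (rule unitary_opI)
    show "inv_into X u ` Y = X" unfolding Y image_image by (simp add: l)
    fix a b assume "a \<in> Y" "b \<in> Y"
    then obtain x y where xy: "x \<in> X" "y \<in> X" "a = u x" "b = u y" unfolding Y by blast
    show "inv_into X u (a + b) = inv_into X u a + inv_into X u b"
      using l[OF csubspace_add[OF X xy(1,2)]]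
      by (simp add: xy l bounded_op_add[OF unitary_bounded[OF u]])
    show "cinner (inv_into X u a) (inv_into X u b) = cinner a b"
      by (simp add: xy l unitary_cinner[OF u])
  next
    fix c a assume "a \<in> Y"
    then obtain x where x: "x \<in> X" "a = u x" unfolding Y by blast
    show "inv_into X u (c *\<^sub>C a) = c *\<^sub>C inv_into X u a"
      using l[OF csubspace_scaleC[OF X x(1), of c]]
      by (simp add: x l bounded_op_scaleC[OF unitary_bounded[OF u]])
  qed
qed

lemma unitary_compose:
  assumes u: "unitary_op X Y u" and v: "unitary_op Y Z v"
  shows "unitary_op X Z (v \<circ> u)"
  unfolding unitary_op_def o_def
proof (intro conjI ballI)
  show "bounded_op X Z (\<lambda>x. v (u x))"
    by (rule bounded_op_compose[OF unitary_bounded[OF u] unitary_bounded[OF v]])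
  show "(\<lambda>x. v (u x)) ` X = Z"
    using unitary_image[OF u] unitary_image[OF v] by (metis image_image)
qed (simp add: unitary_cinner[OF u] unitary_cinner[OF v] unitary_in[OF u])

lemma unitary_restrict:
  assumes "unitary_op X Y u" "Z \<subseteq> X" shows "unitary_op Z (u ` Z) u"
  using assms by (intro unitary_opI) (auto simp: subset_iff unitary_cinner
    bounded_op_add[OF unitary_bounded] bounded_op_scaleC[OF unitary_bounded])

lemma adj_unitary:
  fixes X :: "'g::chilbert_space set" and Y :: "'h::complex_inner set"
  assumes u: "unitary_op X Y u" and X: "closed_csubspace X" and Y: "csubspace Y" and y: "y \<in> Y"
  shows "adj X Y u y = inv_into X u y"
proof (rule adj_eqI[OF X Y unitary_bounded[OF u] y])
  note sub = closed_csubspace_imp[OF X]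
  show *: "inv_into X u y \<in> X" by (rule unitary_in[OF unitary_inv[OF u sub] y])
  show "cinner (u x) y = cinner x (inv_into X u y)" if "x \<in> X" for x
    using unitary_cinner[OF u that *] by (simp add: unitary_inv_right[OF u sub y])
qed

lemma proj_unitary_image:
  fixes X Z :: "'g::chilbert_space set" and Y :: "'h::complex_inner set"
  assumes u: "unitary_op X Y u" and X: "csubspace X" and Z: "closed_csubspace Z" "Z \<subseteq> X" and x: "x \<in> X"
  shows "proj (u ` Z) (u x) = u (proj Z x)"
proof (rule proj_eqI)
  show "csubspace (u ` Z)"
    by (rule closed_csubspace_imp[OF unitary_closed_csubspace[OF unitary_restrict[OF u Z(2)] Z(1)]])
  have p: "proj Z x \<in> Z" "proj Z x \<in> X" using proj_in[OF Z(1)] Z(2) by blast+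
  then show "u (proj Z x) \<in> u ` Z" by blast
  fix y assume "y \<in> u ` Z"
  then obtain z where z: "z \<in> Z" "y = u z" by blast
  have "cinner (u x - u (proj Z x)) y = cinner (u (x - proj Z x)) (u z)"
    by (simp add: z(2) bounded_op_diff[OF unitary_bounded[OF u] X x p(2)])
  also have "\<dots> = cinner (x - proj Z x) z"
    by (rule unitary_cinner[OF u csubspace_diff[OF X x p(2)] subsetD[OF Z(2) z(1)]])
  also have "\<dots> = 0" by (rule proj_orth[OF Z(1) z(1)])
  finally show "cinner (u x - u (proj Z x)) y = 0" .
qed

lemma unitary_image_closed_cspan:
  fixes X :: "'g::chilbert_space set" and Y :: "'h::chilbert_space set"
  assumes u: "unitary_op X Y u" and X: "closed_csubspace X" and S: "S \<subseteq> X"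
  shows "u ` closed_cspan S = closed_cspan (u ` S)"
proof
  have SX: "closed_cspan S \<subseteq> X" by (rule closed_cspan_minimal[OF S X])
  show "closed_cspan (u ` S) \<subseteq> u ` closed_cspan S"
    by (rule closed_cspan_minimal[OF image_mono[OF closed_cspan_superset]
          unitary_closed_csubspace[OF unitary_restrict[OF u SX]]]) simp
  show "u ` closed_cspan S \<subseteq> closed_cspan (u ` S)"
  proof (rule image_subsetI)
    show "u x \<in> closed_cspan (u ` S)" if "x \<in> closed_cspan S" for x
      by (rule bounded_op_closed_cspan_in[where f = u, OF unitary_bounded[OF u] X
            closed_csubspace_closed_cspan S _ that]) (simp add: closed_cspan_base)
  qed
qed

text \<open>The closed span of the pairs \<open>(x i, y i)\<close> is the graph of the required unitary.\<close>

lemma unitary_of_equal_gram: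
  fixes x :: "'i \<Rightarrow> 'g::chilbert_space" and y :: "'i \<Rightarrow> 'h::chilbert_space"
  assumes gram: "\<And>i j. i \<in> I \<Longrightarrow> j \<in> I \<Longrightarrow> cinner (x i) (x j) = cinner (y i) (y j)"
  shows "\<exists>W. unitary_op (closed_cspan (x ` I)) (closed_cspan (y ` I)) W \<and> (\<forall>i\<in>I. W (x i) = y i)"
proof -
  define G where "G = closed_cspan ((\<lambda>i. (x i, y i)) ` I)"
  have G: "closed_csubspace G" by (simp add: G_def)
  note Gs = closed_csubspace_imp[OF G]
  have G_gen: "(x i, y i) \<in> G" if "i \<in> I" for i
    unfolding G_def using that by (intro closed_cspan_base) simp
  \<comment> \<open>A relation <p1, a> = <p2, b> is orthogonality to (a, -b) in the product space,
    so it passes from generators to their closed span G. Using this once in each argument gives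
    \<open>ip\<close>.\<close>
  have orth_iff: "p \<in> orth {(a, - b)} \<longleftrightarrow> cinner (fst p) a = cinner (snd p) b"
    for p :: "'g \<times> 'h" and a b by (simp add: orth_def cinner_prod_def)
  have gen: "cinner (fst p) (x j) = cinner (snd p) (y j)" if p: "p \<in> G" and j: "j \<in> I" for p j
  proof -
    have "G \<subseteq> orth {(x j, - y j)}"
      unfolding G_def by (rule closed_cspan_minimal) (auto simp: orth_iff gram j)
    then show ?thesis using p orth_iff by blast
  qed
  have ip: "cinner (fst p) (fst q) = cinner (snd p) (snd q)" if p: "p \<in> G" and q: "q \<in> G" for p q
  proof -
    have "cinner (x i) (fst q) = cinner (y i) (snd q)" if "i \<in> I" for i
      using gen[OF q that] by (metis cinner_commute)
    then have "G \<subseteq> orth {(fst q, - snd q)}"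
      unfolding G_def by (intro closed_cspan_minimal) (auto simp: orth_iff)
    then show ?thesis using p orth_iff by blast
  qed
  have nrm: "norm (snd p) = norm (fst p)" if "p \<in> G" for p
    by (rule norm_eq_of_cinner) (simp add: ip[OF that that])
  have fstI: "bounded_op UNIV UNIV (fst :: 'g \<times> 'h \<Rightarrow> 'g)" "bounded_op UNIV UNIV (snd :: 'g \<times> 'h \<Rightarrow> 'h)"
  proof -
    show "bounded_op UNIV UNIV (fst :: 'g \<times> 'h \<Rightarrow> 'g)"
      by (rule bounded_opI[where b = 1])
        (simp_all add: scaleC_prod_def norm_fst_le[of "fst x" "snd x" for x, simplified])
    show "bounded_op UNIV UNIV (snd :: 'g \<times> 'h \<Rightarrow> 'h)"
      by (rule bounded_opI[where b = 1])
        (simp_all add: scaleC_prod_def norm_snd_le[of "snd x" "fst x" for x, simplified])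
  qed
  have fstG: "fst ` G = closed_cspan (x ` I)"
  proof
    show "fst ` G \<subseteq> closed_cspan (x ` I)"
    proof (rule image_subsetI)
      show "fst p \<in> closed_cspan (x ` I)" if "p \<in> G" for p
      proof (rule bounded_op_closed_cspan_in[where f = fst, OF fstI(1)])
        show "p \<in> closed_cspan ((\<lambda>i. (x i, y i)) ` I)" using that by (simp only: G_def)
        show "fst s \<in> closed_cspan (x ` I)" if "s \<in> (\<lambda>i. (x i, y i)) ` I" for s
          using that by (intro closed_cspan_base) auto
      qed simp_all
    qed
    \<comment> \<open>On G both components have the same norm, so sqrt 2 times the first projection
      is isometric there and its image is closed.\<close>
    have "closed_csubspace ((\<lambda>p. fst p /\<^sub>R (1 / sqrt 2)) ` G)"
    proof (rule closed_csubspace_isometric_image[OF _ G])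
      show "bounded_op G UNIV (\<lambda>p::'g \<times> 'h. fst p /\<^sub>R (1 / sqrt 2))"
        by (rule bounded_opI[where b = "sqrt 2"])
          (simp_all add: scaleC_prod_def norm_fst_le[of "fst x" "snd x" for x, simplified]
            scaleC_scaleC scaleC_add_right norm_scaleC mult.commute flip: scaleC_of_real)
      show "norm (fst p /\<^sub>R (1 / sqrt 2)) = norm p" if "p \<in> G" for p
      proof -
        have "norm p = sqrt ((norm (fst p))\<^sup>2 + (norm (snd p))\<^sup>2)"
          using norm_Pair[of "fst p" "snd p"] by simp
        also have "\<dots> = sqrt (2 * (norm (fst p))\<^sup>2)" by (simp add: nrm[OF that])
        finally show ?thesis by (simp add: real_sqrt_mult)
      qed
    qed
    moreover have "(\<lambda>p. fst p /\<^sub>R (1 / sqrt 2)) ` G = fst ` G"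
    proof (intro subset_antisym image_subsetI)
      show "fst p /\<^sub>R (1 / sqrt 2) \<in> fst ` G" if "p \<in> G" for p
        by (rule image_eqI[of _ _ "p /\<^sub>R (1 / sqrt 2)"]) (simp_all add: csubspace_scaleR[OF Gs that])
      show "fst p \<in> (\<lambda>p. fst p /\<^sub>R (1 / sqrt 2)) ` G" if "p \<in> G" for p
        by (rule image_eqI[of _ _ "p /\<^sub>R sqrt 2"]) (simp_all add: csubspace_scaleR[OF Gs that])
    qed
    ultimately have "closed_csubspace (fst ` G)" by simp
    then show "closed_cspan (x ` I) \<subseteq> fst ` G"
      by (intro closed_cspan_minimal) (use G_gen image_iff in fastforce)
  qed
  define W where "W a = (THE b. (a, b) \<in> G)" for a
  have uniq: "b = b'" if "(a, b) \<in> G" "(a, b') \<in> G" for a b b'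
    using nrm[OF csubspace_diff[OF Gs that]] by simp
  have W: "W a = b" if "(a, b) \<in> G" for a b
    unfolding W_def
  proof (rule the_equality)
    show "(a, b) \<in> G" by (rule that)
    show "b' = b" if "(a, b') \<in> G" for b' by (rule uniq[OF that \<open>(a, b) \<in> G\<close>])
  qed
  have WG: "(a, W a) \<in> G" if a: "a \<in> closed_cspan (x ` I)" for a
  proof -
    obtain b where "(a, b) \<in> G" using a unfolding fstG[symmetric] by auto
    then show ?thesis using W by simp
  qed
  have lin: "W (a + b) = W a + W b" "cinner (W a) (W b) = cinner a b"
    if "a \<in> closed_cspan (x ` I)" "b \<in> closed_cspan (x ` I)" for a b
    using csubspace_add[OF Gs WG[OF that(1)] WG[OF that(2)]] ip[OF WG[OF that(1)] WG[OF that(2)]]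
    by (simp_all add: W)
  have lin2: "W (c *\<^sub>C a) = c *\<^sub>C W a" if "a \<in> closed_cspan (x ` I)" for c a
    using csubspace_scaleC[OF Gs WG[OF that], of c] by (simp add: W scaleC_prod_def)
  have Wx: "W (x i) = y i" if "i \<in> I" for i by (rule W[OF G_gen[OF that]])
  have U: "unitary_op (closed_cspan (x ` I)) (W ` closed_cspan (x ` I)) W"
    by (rule unitary_opI) (simp_all add: lin lin2)
  have "W ` closed_cspan (x ` I) = closed_cspan (W ` x ` I)"
    by (rule unitary_image_closed_cspan[OF U]) (simp_all add: closed_cspan_superset)
  also have "W ` x ` I = y ` I" unfolding image_image using Wx by simp
  finally have "W ` closed_cspan (x ` I) = closed_cspan (y ` I)" .
  then have "unitary_op (closed_cspan (x ` I)) (closed_cspan (y ` I)) W" using U by (simp only:)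
  then show ?thesis using Wx by (intro exI[of _ W] conjI ballI)
qed

subsection \<open>Positive square roots\<close>

text \<open>The difference h of the two sides is sesquilinear and vanishes on the diagonal, because
  the quadratic form is real. Expanding at x + y makes h antisymmetric, expanding at x + i y makes
  it symmetric.\<close>

lemma positive_op_symmetric:
  assumes R: "positive_op X R" and X: "csubspace X" and xy: "x \<in> X" "y \<in> X"
  shows "cinner (R x) y = cinner x (R y)"
proof -
  have b: "bounded_op X X R" and real: "\<And>x. x \<in> X \<Longrightarrow> Im (cinner (R x) x) = 0"
    using R by (simp_all add: positive_op_def)
  define h where "h u v = cinner (R u) v - cinner u (R v)" for u v
  have diag: "h u u = 0" if "u \<in> X" for u
  proof -
    have "cinner u (R u) = cnj (cinner (R u) u)" by (rule cinner_commute)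
    also have "\<dots> = cinner (R u) u" using real[OF that] by (simp add: complex_eq_iff)
    finally show ?thesis by (simp add: h_def)
  qed
  have "h (x + y) (x + y) = h x x + h x y + h y x + h y y"
    by (simp add: h_def bounded_op_add[OF b xy] cinner_add_left cinner_add_right)
  then have 1: "h x y + h y x = 0" using xy by (simp add: diag csubspace_add[OF X])
  have iy: "\<i> *\<^sub>C y \<in> X" by (rule csubspace_scaleC[OF X xy(2)])
  have "h (x + \<i> *\<^sub>C y) (x + \<i> *\<^sub>C y) = h x x - \<i> * h x y + \<i> * h y x + h y y"
    by (simp add: h_def bounded_op_add[OF b xy(1) iy] bounded_op_scaleC[OF b xy(2)]
        cinner_add_left cinner_add_right cinner_scaleC_left cinner_scaleC_right algebra_simps)
  then have "\<i> * (h y x - h x y) = 0"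
    using xy iy by (simp add: diag csubspace_add[OF X] algebra_simps)
  then have "h y x = h x y" by simp
  then have "h x y = 0" using 1 by simp
  then show ?thesis by (simp add: h_def)
qed

text \<open>The iterates are polynomials in B with nonnegative coefficients. So they commute, and
  the case B = 1 bounds them when B is a contraction.\<close>

primrec sqrt_iter :: "('h \<Rightarrow> 'h::complex_inner) \<Rightarrow> nat \<Rightarrow> 'h \<Rightarrow> 'h" where
  "sqrt_iter B 0 x = 0"
| "sqrt_iter B (Suc n) x = (1/2) *\<^sub>R (B x + sqrt_iter B n (sqrt_iter B n x))"

primrec sqrt_bound :: "nat \<Rightarrow> real" where
  "sqrt_bound 0 = 0"
| "sqrt_bound (Suc n) = (1 + (sqrt_bound n)\<^sup>2) / 2"

lemma sqrt_bound_range: "0 \<le> sqrt_bound n \<and> sqrt_bound n \<le> 1"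
proof (induction n)
  case (Suc n)
  then have "(sqrt_bound n)\<^sup>2 \<le> 1" by (simp add: power_le_one)
  then show ?case by simp
qed simp

lemma sqrt_bound_mono: "sqrt_bound n \<le> sqrt_bound (Suc n)"
proof (induction n)
  case (Suc n)
  have "(sqrt_bound n)\<^sup>2 \<le> (sqrt_bound (Suc n))\<^sup>2" using Suc sqrt_bound_range[of n] by (rule power_mono[OF _ conjunct1])
  then have "(1 + (sqrt_bound n)\<^sup>2) / 2 \<le> (1 + (sqrt_bound (Suc n))\<^sup>2) / 2" by simp
  then show ?case by (simp only: sqrt_bound.simps)
qed simp

lemma Cauchy_sqrt_bound: "Cauchy sqrt_bound"
proof -
  have "incseq sqrt_bound" by (rule incseq_SucI) (rule sqrt_bound_mono)
  then obtain l where "sqrt_bound \<longlonglongrightarrow> l"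
    using incseq_convergent[of sqrt_bound 1] sqrt_bound_range by blast
  then show ?thesis by (rule LIMSEQ_imp_Cauchy)
qed

text \<open>The iteration \<open>Y \<mapsto> (B + Y\<^sup>2)/2\<close> converges to \<open>Y\<close> with \<open>(1 - Y)\<^sup>2 = 1 - B\<close>; its increments are
  dominated in norm by those of the scalar iteration with \<open>B = 1\<close>.\<close>

locale contractive_symmetric =
  fixes X :: "'h::chilbert_space set" and B :: "'h \<Rightarrow> 'h"
  assumes X: "closed_csubspace X" and B: "bounded_op X X B"
    and contr: "\<And>x. x \<in> X \<Longrightarrow> norm (B x) \<le> norm x"
    and symm: "\<And>x y. x \<in> X \<Longrightarrow> y \<in> X \<Longrightarrow> cinner (B x) y = cinner x (B y)"
begin

lemma sub: "csubspace X" by (rule closed_csubspace_imp[OF X])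

lemma iter_op: "bounded_op X X (sqrt_iter B n)"
proof (induction n)
  case 0
  show ?case by (simp add: bounded_op_zero_op[OF sub])
next
  case (Suc n)
  have "bounded_op X X (\<lambda>x. complex_of_real (1/2) *\<^sub>C (B x + sqrt_iter B n (sqrt_iter B n x)))"
    by (intro bounded_op_scaleC_op bounded_op_add_op B bounded_op_compose[OF Suc Suc] sub)
  then show ?case unfolding scaleC_of_real by simp
qed

lemmas iter_in = bounded_op_in[OF iter_op]
lemmas iter_add = bounded_op_add[OF iter_op]
lemmas iter_diff = bounded_op_diff[OF iter_op sub]

lemma iter_norm: "x \<in> X \<Longrightarrow> norm (sqrt_iter B n x) \<le> sqrt_bound n * norm x"
proof (induction n arbitrary: x)
  case (Suc n)
  have "norm (sqrt_iter B n (sqrt_iter B n x)) \<le> sqrt_bound n * (sqrt_bound n * norm x)"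
    using Suc.IH[OF iter_in[OF Suc.prems], of n] mult_left_mono[OF Suc.IH[OF Suc.prems], of "sqrt_bound n"]
      sqrt_bound_range[of n] by simp
  then have "norm (B x + sqrt_iter B n (sqrt_iter B n x)) \<le> norm x + (sqrt_bound n)\<^sup>2 * norm x"
    using norm_triangle_ineq[of "B x" "sqrt_iter B n (sqrt_iter B n x)"] contr[OF Suc.prems]
    by (simp add: power2_eq_square mult.assoc)
  moreover have "norm (sqrt_iter B (Suc n) x) = norm (B x + sqrt_iter B n (sqrt_iter B n x)) / 2"
    by (simp del: scaleR_add_right)
  ultimately show ?case by (simp add: field_simps del: sqrt_iter.simps)
qed simp

text \<open>Used in two stages: with Z = B it shows that the iterates commute with B, and then, with
  Z an iterate, that they commute with each other.\<close>

lemma iter_commute_gen: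
  assumes Z: "bounded_op X X Z" and c: "\<And>x. x \<in> X \<Longrightarrow> Z (B x) = B (Z x)"
  shows "x \<in> X \<Longrightarrow> Z (sqrt_iter B n x) = sqrt_iter B n (Z x)"
proof (induction n arbitrary: x)
  case 0
  show ?case by (simp add: bounded_op_zero[OF Z csubspace_zero[OF sub]])
next
  case (Suc n)
  have "Z (sqrt_iter B (Suc n) x) = (1/2) *\<^sub>R (Z (B x) + Z (sqrt_iter B n (sqrt_iter B n x)))"
    using Suc.prems
    by (simp add: bounded_op_scaleR[OF Z] bounded_op_add[OF Z] iter_in bounded_op_in[OF B] csubspace_add[OF sub])
  also have "\<dots> = sqrt_iter B (Suc n) (Z x)"
    using Suc.prems by (simp add: c Suc.IH iter_in)
  finally show ?case .
qed

lemma iter_commute: "x \<in> X \<Longrightarrow> sqrt_iter B m (sqrt_iter B n x) = sqrt_iter B n (sqrt_iter B m x)"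
  by (rule iter_commute_gen[OF iter_op]) (rule iter_commute_gen[OF B refl, symmetric])

lemma iter_symm:
  "x \<in> X \<Longrightarrow> y \<in> X \<Longrightarrow> cinner (sqrt_iter B n x) y = cinner x (sqrt_iter B n y)"
proof (induction n arbitrary: x y)
  case (Suc n)
  have "cinner (B x + sqrt_iter B n (sqrt_iter B n x)) y = cinner x (B y + sqrt_iter B n (sqrt_iter B n y))"
    using Suc.prems by (simp add: cinner_add_left cinner_add_right symm Suc.IH iter_in)
  then show ?case
    by (simp add: cinner_scaleC_left cinner_scaleC_right flip: scaleC_of_real)
qed simp

text \<open>By commutativity Y^2 - Z^2 = (Y - Z)(Y + Z), so the induction hypothesis applies at w =
  Y x + Z x; the scalar increments obey the same identity.\<close>

lemma iter_increment:
  "x \<in> X \<Longrightarrow> norm (sqrt_iter B (Suc n) x - sqrt_iter B n x) \<le> (sqrt_bound (Suc n) - sqrt_bound n) * norm x"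
proof (induction n arbitrary: x)
  case 0
  then show ?case using contr by (simp add: bounded_op_zero_op)
next
  case (Suc n)
  let ?Y = "sqrt_iter B (Suc n)" and ?Z = "sqrt_iter B n"
  let ?w = "?Y x + ?Z x"
  have w: "?w \<in> X" by (intro csubspace_add[OF sub] iter_in Suc.prems)
  have "?Y ?w - ?Z ?w = ?Y (?Y x) + ?Y (?Z x) - (?Z (?Y x) + ?Z (?Z x))"
    by (simp only: iter_add[OF iter_in[OF Suc.prems] iter_in[OF Suc.prems]])
  also have "\<dots> = ?Y (?Y x) - ?Z (?Z x)"
    by (simp only: iter_commute[OF Suc.prems, of "Suc n" n]) simp
  finally have eq: "?Y (?Y x) - ?Z (?Z x) = ?Y ?w - ?Z ?w" ..
  have nw: "norm ?w \<le> (sqrt_bound (Suc n) + sqrt_bound n) * norm x"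
    using norm_triangle_ineq[of "?Y x" "?Z x"] iter_norm[OF Suc.prems, of "Suc n"] iter_norm[OF Suc.prems, of n]
    by (simp only: distrib_right)
  have alg: "(a - b) * ((a + b) * t) / 2 = (a\<^sup>2 - b\<^sup>2) / 2 * t" for a b t :: real
    by (simp add: power2_eq_square algebra_simps)
  have d: "sqrt_bound (Suc n) - sqrt_bound n \<ge> 0" using sqrt_bound_mono[of n] by simp
  have step: "sqrt_iter B (Suc (Suc n)) x - ?Y x = (1/2) *\<^sub>R (?Y (?Y x) - ?Z (?Z x))"
    unfolding sqrt_iter.simps(2)[of B "Suc n" x] sqrt_iter.simps(2)[of B n x] scaleR_right_diff_distrib [symmetric]
    by (simp only: add_diff_cancel_left)
  have "norm (sqrt_iter B (Suc (Suc n)) x - ?Y x) = norm (?Y ?w - ?Z ?w) / 2"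
    unfolding step eq by simp
  also have "\<dots> \<le> (sqrt_bound (Suc n) - sqrt_bound n) * norm ?w / 2"
    using Suc.IH[OF w] by simp
  also have "\<dots> \<le> (sqrt_bound (Suc n) - sqrt_bound n) * ((sqrt_bound (Suc n) + sqrt_bound n) * norm x) / 2"
    using mult_left_mono[OF nw d] by simp
  also have "\<dots> = ((sqrt_bound (Suc n))\<^sup>2 - (sqrt_bound n)\<^sup>2) / 2 * norm x"
    by (rule alg)
  also have "((sqrt_bound (Suc n))\<^sup>2 - (sqrt_bound n)\<^sup>2) / 2 = sqrt_bound (Suc (Suc n)) - sqrt_bound (Suc n)"
    by (simp only: sqrt_bound.simps(2)[of "Suc n"] sqrt_bound.simps(2)[of n]) (simp add: field_simps)
  finally show ?case .
qed

lemma iter_difference: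
  assumes x: "x \<in> X" and "n \<le> m"
  shows "norm (sqrt_iter B m x - sqrt_iter B n x) \<le> (sqrt_bound m - sqrt_bound n) * norm x"
  using \<open>n \<le> m\<close>
proof (induction m rule: dec_induct)
  case (step m)
  have "norm (sqrt_iter B (Suc m) x - sqrt_iter B n x)
      \<le> norm (sqrt_iter B (Suc m) x - sqrt_iter B m x) + norm (sqrt_iter B m x - sqrt_iter B n x)"
    using norm_triangle_ineq[of "sqrt_iter B (Suc m) x - sqrt_iter B m x"] by (metis diff_add_cancel add_diff_eq)
  also have "\<dots> \<le> (sqrt_bound (Suc m) - sqrt_bound m) * norm x + (sqrt_bound m - sqrt_bound n) * norm x"
    by (intro add_mono iter_increment[OF x] step.IH)
  finally show ?case by (simp add: left_diff_distrib del: sqrt_bound.simps sqrt_iter.simps)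
qed simp

lemma iter_Cauchy:
  assumes x: "x \<in> X" shows "Cauchy (\<lambda>n. sqrt_iter B n x)"
proof (rule CauchyI')
  fix e :: real assume e: "e > 0"
  then have "e / (norm x + 1) > 0" by (simp add: add_nonneg_pos)
  then obtain N where N: "\<And>m n. m \<ge> N \<Longrightarrow> n \<ge> N \<Longrightarrow> norm (sqrt_bound m - sqrt_bound n) < e / (norm x + 1)"
    using CauchyD[OF Cauchy_sqrt_bound] by blast
  have "norm (sqrt_iter B m x - sqrt_iter B n x) < e" if "m \<ge> N" "n > m" for m n
  proof -
    have "norm (sqrt_iter B m x - sqrt_iter B n x) \<le> (sqrt_bound n - sqrt_bound m) * norm x"
      using iter_difference[OF x less_imp_le[OF that(2)]] by (simp add: norm_minus_commute)
    also have "\<dots> \<le> e / (norm x + 1) * norm x"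
      using N[of n m] that by (intro mult_right_mono) (auto simp: abs_less_iff)
    also have "\<dots> < e" using e by (simp add: divide_less_eq add_nonneg_pos)
    finally show ?thesis .
  qed
  then show "\<exists>M. \<forall>m\<ge>M. \<forall>n>m. dist (sqrt_iter B m x) (sqrt_iter B n x) < e"
    unfolding dist_norm by blast
qed

definition sqrt_lim :: "'h \<Rightarrow> 'h" where "sqrt_lim x = lim (\<lambda>n. sqrt_iter B n x)"

lemma sqrt_lim: "x \<in> X \<Longrightarrow> (\<lambda>n. sqrt_iter B n x) \<longlonglongrightarrow> sqrt_lim x"
  unfolding sqrt_lim_def using iter_Cauchy by (simp add: Cauchy_convergent_iff convergent_LIMSEQ_iff)

lemma sqrt_lim_in: "x \<in> X \<Longrightarrow> sqrt_lim x \<in> X"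
  using closed_sequentially[OF _ iter_in sqrt_lim] X by (simp add: closed_csubspace_def)

lemma sqrt_lim_norm:
  assumes x: "x \<in> X" shows "norm (sqrt_lim x) \<le> norm x"
proof (rule LIMSEQ_le_const2[OF tendsto_norm[OF sqrt_lim[OF x]]])
  have "norm (sqrt_iter B n x) \<le> norm x" for n
    using iter_norm[OF x, of n] sqrt_bound_range[of n] mult_right_mono[of "sqrt_bound n" 1 "norm x"] by simp
  then show "\<exists>N. \<forall>n\<ge>N. norm (sqrt_iter B n x) \<le> norm x" by blast
qed

lemma sqrt_lim_op: "bounded_op X X sqrt_lim"
proof (rule bounded_opI[where b = 1])
  fix x y assume xy: "x \<in> X" "y \<in> X"
  have "(\<lambda>n. sqrt_iter B n (x + y)) \<longlonglongrightarrow> sqrt_lim x + sqrt_lim y"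
    using tendsto_add[OF sqrt_lim[OF xy(1)] sqrt_lim[OF xy(2)]] by (simp add: iter_add[OF xy])
  then show "sqrt_lim (x + y) = sqrt_lim x + sqrt_lim y"
    by (rule LIMSEQ_unique[OF sqrt_lim[OF csubspace_add[OF sub xy]]])
next
  fix c x assume x: "x \<in> X"
  have "(\<lambda>n. sqrt_iter B n (c *\<^sub>C x)) \<longlonglongrightarrow> c *\<^sub>C sqrt_lim x"
    using tendsto_scaleC[OF sqrt_lim[OF x]] by (simp add: bounded_op_scaleC[OF iter_op x])
  then show "sqrt_lim (c *\<^sub>C x) = c *\<^sub>C sqrt_lim x"
    by (rule LIMSEQ_unique[OF sqrt_lim[OF csubspace_scaleC[OF sub x]]])
qed (simp_all add: sqrt_lim_in sqrt_lim_norm)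

lemma sqrt_lim_symm:
  assumes "x \<in> X" "y \<in> X" shows "cinner (sqrt_lim x) y = cinner x (sqrt_lim y)"
proof (rule LIMSEQ_unique)
  show "(\<lambda>n. cinner (sqrt_iter B n x) y) \<longlonglongrightarrow> cinner (sqrt_lim x) y"
    by (rule tendsto_cinner_left[OF sqrt_lim[OF assms(1)]])
  show "(\<lambda>n. cinner (sqrt_iter B n x) y) \<longlonglongrightarrow> cinner x (sqrt_lim y)"
    unfolding iter_symm[OF assms] by (rule tendsto_cinner_right[OF sqrt_lim[OF assms(2)]])
qed

lemma sqrt_lim_fixpoint:
  assumes x: "x \<in> X" shows "2 *\<^sub>R sqrt_lim x = B x + sqrt_lim (sqrt_lim x)"
proof -
  \<comment> \<open>The n-th iterate acts on a vector that itself moves with n; since all iterates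
    are contractions, the error tends to 0.\<close>
  have "(\<lambda>n. sqrt_iter B n (sqrt_iter B n x - sqrt_lim x)) \<longlonglongrightarrow> 0"
  proof (rule Lim_null_comparison)
    have "norm (sqrt_iter B n (sqrt_iter B n x - sqrt_lim x)) \<le> norm (sqrt_iter B n x - sqrt_lim x)" for n
      using iter_norm[OF csubspace_diff[OF sub iter_in[OF x] sqrt_lim_in[OF x]], of n n] sqrt_bound_range[of n]
        mult_right_mono[of "sqrt_bound n" 1 "norm (sqrt_iter B n x - sqrt_lim x)"] by simp
    then show "\<forall>\<^sub>F n in sequentially. norm (sqrt_iter B n (sqrt_iter B n x - sqrt_lim x))
        \<le> norm (sqrt_iter B n x - sqrt_lim x)" by (intro always_eventually allI)
    show "(\<lambda>n. norm (sqrt_iter B n x - sqrt_lim x)) \<longlonglongrightarrow> 0"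
      using tendsto_norm[OF LIM_zero[OF sqrt_lim[OF x]]] by simp
  qed
  then have "(\<lambda>n. sqrt_iter B n (sqrt_iter B n x - sqrt_lim x) + sqrt_iter B n (sqrt_lim x))
      \<longlonglongrightarrow> 0 + sqrt_lim (sqrt_lim x)"
    by (rule tendsto_add[OF _ sqrt_lim[OF sqrt_lim_in[OF x]]])
  then have "(\<lambda>n. sqrt_iter B n (sqrt_iter B n x)) \<longlonglongrightarrow> sqrt_lim (sqrt_lim x)"
    by (simp add: iter_diff[OF iter_in[OF x] sqrt_lim_in[OF x]])
  then have "(\<lambda>n. (1/2) *\<^sub>R (B x + sqrt_iter B n (sqrt_iter B n x)))
      \<longlonglongrightarrow> (1/2) *\<^sub>R (B x + sqrt_lim (sqrt_lim x))"
    by (intro tendsto_intros)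
  then have "(\<lambda>n. sqrt_iter B (Suc n) x) \<longlonglongrightarrow> (1/2) *\<^sub>R (B x + sqrt_lim (sqrt_lim x))"
    by simp
  then have "sqrt_lim x = (1/2) *\<^sub>R (B x + sqrt_lim (sqrt_lim x))"
    by (rule LIMSEQ_unique[OF LIMSEQ_Suc[OF sqrt_lim[OF x]]])
  then have "2 *\<^sub>R sqrt_lim x = 2 *\<^sub>R (1/2) *\<^sub>R (B x + sqrt_lim (sqrt_lim x))" by (rule arg_cong)
  then show ?thesis by simp
qed

lemma positive_sqrt_exists: "\<exists>R. positive_op X R \<and> (\<forall>x\<in>X. R (R x) = x - B x)"
proof (intro exI conjI ballI)
  let ?R = "\<lambda>x. x - sqrt_lim x"
  have R: "bounded_op X X ?R" by (intro bounded_op_diff_op bounded_op_ident sqrt_lim_op sub)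
  show "positive_op X ?R"
    unfolding positive_op_def
  proof (intro conjI ballI)
    fix x assume x: "x \<in> X"
    have "cinner (sqrt_lim x) x = cnj (cinner (sqrt_lim x) x)"
      using sqrt_lim_symm[OF x x] cinner_commute[of x "sqrt_lim x"] by simp
    then have "Im (cinner (sqrt_lim x) x) = - Im (cinner (sqrt_lim x) x)"
      by (metis cnj.sel(2))
    then show "Im (cinner (x - sqrt_lim x) x) = 0"
      by (simp add: cinner_diff_left cinner_self)
    have "cmod (cinner (sqrt_lim x) x) \<le> norm x * norm x"
      using cmod_cinner_le[of "sqrt_lim x" x] mult_right_mono[OF sqrt_lim_norm[OF x], of "norm x"] by simp
    then show "0 \<le> Re (cinner (x - sqrt_lim x) x)"
      using complex_Re_le_cmod[of "cinner (sqrt_lim x) x"]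
      by (simp add: cinner_diff_left cinner_self power2_eq_square)
  qed (rule R)
  fix x assume x: "x \<in> X"
  have "?R (?R x) = x - 2 *\<^sub>R sqrt_lim x + sqrt_lim (sqrt_lim x)"
    by (simp add: bounded_op_diff[OF sqrt_lim_op sub x sqrt_lim_in[OF x]] scaleR_2)
  then show "?R (?R x) = x - B x" by (simp add: sqrt_lim_fixpoint[OF x])
qed

lemma
  assumes S: "\<And>x. x \<in> X \<Longrightarrow> S x = x - B x"
  shows op_sqrt_positive: "positive_op X (op_sqrt X S)"
    and op_sqrt_square: "x \<in> X \<Longrightarrow> op_sqrt X S (op_sqrt X S x) = S x"
proof -
  have "\<exists>R. positive_op X R \<and> (\<forall>x\<in>X. R (R x) = S x)" using positive_sqrt_exists S by simp
  then have *: "positive_op X (op_sqrt X S) \<and> (\<forall>x\<in>X. op_sqrt X S (op_sqrt X S x) = S x)"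
    unfolding op_sqrt_def by (rule someI_ex)
  then show "positive_op X (op_sqrt X S)" "x \<in> X \<Longrightarrow> op_sqrt X S (op_sqrt X S x) = S x" by blast+
qed

text \<open>Symmetry moves one factor across and the square of the root is S, so the choice of the
  root drops out.\<close>

lemma
  assumes S: "\<And>x. x \<in> X \<Longrightarrow> S x = x - B x"
  shows op_sqrt_op: "bounded_op X X (op_sqrt X S)"
    and op_sqrt_cinner:
      "x \<in> X \<Longrightarrow> y \<in> X \<Longrightarrow> cinner (op_sqrt X S x) (op_sqrt X S y) = cinner (S x) y"
proof -
  note R = op_sqrt_positive[of S, OF S]
  show b: "bounded_op X X (op_sqrt X S)" using R by (simp add: positive_op_def)
  show "cinner (op_sqrt X S x) (op_sqrt X S y) = cinner (S x) y" if "x \<in> X" "y \<in> X"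
    using positive_op_symmetric[OF R sub bounded_op_in[OF b that(1)] that(2)]
    by (simp add: op_sqrt_square[of S, OF S] that)
qed

end

subsection \<open>Row contractions\<close>

lemma cinner_vec: "cinner \<xi> \<eta> = (\<Sum>i\<in>UNIV. cinner (\<xi> $ i) (\<eta> $ i))"
  by (simp add: cinner_vec_def)

lemma norm_vec_sq: "(norm \<xi>)\<^sup>2 = (\<Sum>i\<in>UNIV. (norm (\<xi> $ i))\<^sup>2)" for \<xi> :: "'h::complex_inner ^ 'd::finite"
  by (simp add: norm_sq_cinner cinner_vec)

lemma scaleC_vec_nth [simp]: "(c *\<^sub>C \<xi>) $ i = c *\<^sub>C (\<xi> $ i)"
  by (simp add: scaleC_vec_def)

lemma bounded_op_vec_nth: "bounded_op UNIV UNIV (\<lambda>\<xi>::'h::complex_inner ^ 'd::finite. \<xi> $ i)"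
  by (rule bounded_opI[where b = 1]) (simp_all add: Finite_Cartesian_Product.norm_nth_le)

text \<open>The row (T_1, ..., T_d) as one operator T, with adjoint \<open>star_vec\<close>; then
  D_T^2 = I - T^* T and D_{*,T}^2 = I - T T^*. Domain and codomain may differ so that the entry B of
  a lifting is covered.\<close>

definition row_op :: "('d::finite \<Rightarrow> 'h \<Rightarrow> 'k::complex_inner) \<Rightarrow> 'h ^ 'd \<Rightarrow> 'k" where
  "row_op T \<xi> = (\<Sum>j\<in>UNIV. T j (\<xi> $ j))"

definition star_vec :: "('d::finite \<Rightarrow> 'h::complex_inner \<Rightarrow> 'k::complex_inner) \<Rightarrow> 'k \<Rightarrow> 'h ^ 'd" where
  "star_vec T x = (\<chi> j. adj UNIV UNIV (T j) x)"

lemma star_vec_nth [simp]: "star_vec T x $ j = adj UNIV UNIV (T j) x"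
  by (simp add: star_vec_def)

locale bounded_row =
  fixes T :: "'d::finite \<Rightarrow> 'h::chilbert_space \<Rightarrow> 'k::chilbert_space"
  assumes bounded: "\<And>j. bounded_op UNIV UNIV (T j)"
begin

lemmas adj_op = bounded_op_adj[OF closed_csubspace_UNIV csubspace_UNIV bounded]

lemma T_adj: "cinner (T j x) y = cinner x (adj UNIV UNIV (T j) y)"
  by (simp add: adj_cinner[OF closed_csubspace_UNIV csubspace_UNIV bounded])

lemma adj_T: "cinner (adj UNIV UNIV (T j) y) x = cinner y (T j x)"
  by (simp add: adj_cinner'[OF closed_csubspace_UNIV csubspace_UNIV bounded])

lemma row_op_op: "bounded_op UNIV UNIV (row_op T)"
  unfolding row_op_def
  by (intro bounded_op_sum_op bounded_op_compose[OF bounded_op_vec_nth bounded]) simp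

lemma row_op_cinner: "cinner (row_op T \<xi>) x = cinner \<xi> (star_vec T x)"
  by (simp add: row_op_def cinner_vec cinner_sum_left T_adj)

lemma star_vec_cinner: "cinner (star_vec T x) \<xi> = cinner x (row_op T \<xi>)"
  by (simp add: row_op_def cinner_vec cinner_sum_right adj_T)

lemma star_vec_op: "bounded_op UNIV UNIV (star_vec T)"
proof -
  obtain b where b: "b \<ge> 0" "\<And>\<xi>. norm (row_op T \<xi>) \<le> b * norm \<xi>"
    using bounded_op_bound[OF row_op_op] by (metis UNIV_I)
  show ?thesis
  proof (rule bounded_opI[where b = b])
    show "norm (star_vec T x) \<le> b * norm x" for x
    proof (cases "star_vec T x = 0")
      case False
      have "(norm (star_vec T x))\<^sup>2 = cmod (cinner (row_op T (star_vec T x)) x)"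
        by (simp add: row_op_cinner cinner_self norm_power)
      also have "\<dots> \<le> norm (row_op T (star_vec T x)) * norm x" by (rule cmod_cinner_le)
      also have "\<dots> \<le> b * norm (star_vec T x) * norm x" by (rule mult_right_mono[OF b(2)]) simp
      finally show ?thesis using False by (simp add: power2_eq_square)
    qed (simp add: b)
  qed (simp_all add: vec_eq_iff bounded_op_add[OF adj_op] bounded_op_scaleC[OF adj_op])
qed

end

section \<open>Defect operators of a row contraction\<close>

locale row_contr =
  fixes T :: "'d::finite \<Rightarrow> 'h::chilbert_space \<Rightarrow> 'h"
  assumes row_contr: "row_contraction T"

sublocale row_contr \<subseteq> bounded_row T
  using row_contr by unfold_locales (simp add: row_contraction_def)

context row_contr
begin

lemma star_vec_norm: "norm (star_vec T x) \<le> norm x"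
proof -
  have "0 \<le> Re (cinner (x - row_op T (star_vec T x)) x)"
    using row_contr by (simp add: row_contraction_def positive_op_def row_op_def)
  then have "(norm (star_vec T x))\<^sup>2 \<le> (norm x)\<^sup>2"
    by (simp add: cinner_diff_left row_op_cinner norm_sq_cinner)
  then show ?thesis by (rule power2_le_imp_le) simp
qed

lemma row_op_norm: "norm (row_op T \<xi>) \<le> norm \<xi>"
proof (cases "row_op T \<xi> = 0")
  case False
  have "(norm (row_op T \<xi>))\<^sup>2 = cmod (cinner \<xi> (star_vec T (row_op T \<xi>)))"
    by (simp add: row_op_cinner [symmetric] cinner_self norm_power)
  also have "\<dots> \<le> norm \<xi> * norm (star_vec T (row_op T \<xi>))" by (rule cmod_cinner_le)
  also have "\<dots> \<le> norm \<xi> * norm (row_op T \<xi>)" by (rule mult_left_mono[OF star_vec_norm]) simp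
  finally show ?thesis using False by (simp add: power2_eq_square)
qed simp

text \<open>For the row operator T, both T^* T and T T^* are symmetric contractions; this provides
  the roots D_T and D_{*,T}.\<close>

sublocale source: contractive_symmetric UNIV "\<lambda>\<xi>. star_vec T (row_op T \<xi>)"
  by unfold_locales
    (simp_all add: bounded_op_compose[OF row_op_op star_vec_op] star_vec_cinner row_op_cinner
      order_trans[OF star_vec_norm row_op_norm])

sublocale target: contractive_symmetric UNIV "\<lambda>x. row_op T (star_vec T x)"
  by unfold_locales
    (simp_all add: bounded_op_compose[OF star_vec_op row_op_op] star_vec_cinner row_op_cinner
      order_trans[OF row_op_norm star_vec_norm])

lemma defect_sum: "(\<chi> i. \<xi> $ i - (\<Sum>j\<in>UNIV. adj UNIV UNIV (T i) (T j (\<xi> $ j)))) = \<xi> - star_vec T (row_op T \<xi>)"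
  by (simp add: vec_eq_iff row_op_def bounded_op_sum[OF adj_op])

lemma star_defect_sum: "x - (\<Sum>j\<in>UNIV. T j (adj UNIV UNIV (T j) x)) = x - row_op T (star_vec T x)"
  by (simp add: row_op_def)

lemma defect_op_op: "bounded_op UNIV UNIV (defect_op T)"
  unfolding defect_op_def by (rule source.op_sqrt_op) (rule defect_sum)

lemma star_defect_op_op: "bounded_op UNIV UNIV (star_defect_op T)"
  unfolding star_defect_op_def by (rule target.op_sqrt_op) (rule star_defect_sum)

lemma defect_cinner:
  "cinner (defect_op T \<xi>) (defect_op T \<eta>) = cinner \<xi> \<eta> - cinner (row_op T \<xi>) (row_op T \<eta>)"
proof -
  have "cinner (defect_op T \<xi>) (defect_op T \<eta>) = cinner (\<xi> - star_vec T (row_op T \<xi>)) \<eta>"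
    unfolding defect_op_def defect_sum by (rule source.op_sqrt_cinner) simp_all
  then show ?thesis by (simp add: cinner_diff_left star_vec_cinner)
qed

lemma star_defect_cinner:
  "cinner (star_defect_op T x) (star_defect_op T y) = cinner x y - cinner (star_vec T x) (star_vec T y)"
proof -
  have "cinner (star_defect_op T x) (star_defect_op T y) = cinner (x - row_op T (star_vec T x)) y"
    unfolding star_defect_op_def star_defect_sum by (rule target.op_sqrt_cinner) simp_all
  then show ?thesis by (simp add: cinner_diff_left row_op_cinner)
qed

lemma star_defect_symmetric: "cinner (star_defect_op T x) y = cinner x (star_defect_op T y)"
  unfolding star_defect_op_def
  by (rule positive_op_symmetric[OF target.op_sqrt_positive]) (simp_all add: star_defect_sum)

lemma defect_symmetric: "cinner (defect_op T x) y = cinner x (defect_op T y)"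
  unfolding defect_op_def
  by (rule positive_op_symmetric[OF source.op_sqrt_positive]) (simp_all add: defect_sum)

lemma star_defect_square: "star_defect_op T (star_defect_op T x) = x - row_op T (star_vec T x)"
  unfolding star_defect_op_def star_defect_sum by (rule target.op_sqrt_square) simp_all

lemma defect_norm: "(norm (defect_op T \<xi>))\<^sup>2 = (norm \<xi>)\<^sup>2 - (norm (row_op T \<xi>))\<^sup>2"
  by (simp add: norm_sq_cinner defect_cinner)

lemma star_defect_norm: "(norm (star_defect_op T x))\<^sup>2 = (norm x)\<^sup>2 - (norm (star_vec T x))\<^sup>2"
  by (simp add: norm_sq_cinner star_defect_cinner)

end

lemma csubspace_range: "bounded_op UNIV UNIV f \<Longrightarrow> csubspace (range f)"
  by (erule csubspace_image) simp

context row_contr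
begin

lemma defect_space_cspan: "defect_space T = closed_cspan (range (defect_op T))"
  unfolding defect_space_def by (rule closed_cspan_csubspace[symmetric, OF csubspace_range[OF defect_op_op]])

lemma star_defect_space_cspan: "star_defect_space T = closed_cspan (range (star_defect_op T))"
  unfolding star_defect_space_def
  by (rule closed_cspan_csubspace[symmetric, OF csubspace_range[OF star_defect_op_op]])

lemma closed_defect_space: "closed_csubspace (defect_space T)"
  by (simp add: defect_space_cspan)

lemma closed_star_defect_space: "closed_csubspace (star_defect_space T)"
  by (simp add: star_defect_space_cspan)

lemma defect_op_in: "defect_op T \<xi> \<in> defect_space T"
  by (simp add: defect_space_cspan closed_cspan_base)

lemma star_defect_op_in: "star_defect_op T x \<in> star_defect_space T"
  by (simp add: star_defect_space_cspan closed_cspan_base)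

end

lemma word_op_append: "word_op T (\<alpha> @ \<beta>) x = word_op T \<alpha> (word_op T \<beta> x)"
  by (induction \<alpha>) simp_all

lemma bounded_op_word: "(\<And>j. bounded_op X X (T j)) \<Longrightarrow> bounded_op X X (word_op T \<alpha>)"
proof (induction \<alpha>)
  case Nil
  show ?case using bounded_op_ident by (simp add: id_def)
next
  case (Cons j \<alpha>)
  show ?case unfolding word_op.simps o_def by (rule bounded_op_compose[OF Cons.IH[OF Cons.prems] Cons.prems])
qed

lemma (in row_contr) adj_word_snoc:
  "adj UNIV UNIV (word_op T (\<alpha> @ [j])) z = adj UNIV UNIV (T j) (adj UNIV UNIV (word_op T \<alpha>) z)"
  by (rule adj_eqI[OF closed_csubspace_UNIV csubspace_UNIV bounded_op_word[OF bounded]])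
    (simp_all add: word_op_append T_adj [symmetric]
      adj_cinner[OF closed_csubspace_UNIV csubspace_UNIV bounded_op_word[OF bounded]])

lemma (in row_contr) adj_word_Nil: "adj UNIV UNIV (word_op T []) z = z"
  by (rule adj_eqI[OF closed_csubspace_UNIV csubspace_UNIV bounded_op_word[OF bounded]]) simp_all

text \<open>The form in which the hypothesis is used. If T^* loses no norm at any T_\<alpha>^* z,
  then the sum over words of length n + 1 equals the sum over words of length n, and all sums equal
  |z|^2.\<close>

lemma (in row_contr) completely_non_coisometric_zero:
  assumes cnc: "completely_non_coisometric T"
    and eq: "\<And>\<alpha>. norm (star_vec T (adj UNIV UNIV (word_op T \<alpha>) z)) = norm (adj UNIV UNIV (word_op T \<alpha>) z)"
  shows "z = 0"
proof -
  let ?w = "\<lambda>\<alpha>. adj UNIV UNIV (word_op T \<alpha>) z"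
  have "(\<Sum>\<alpha> | length \<alpha> = n. (norm (?w \<alpha>))\<^sup>2) = (norm z)\<^sup>2" for n
  proof (induction n)
    case 0
    have "{\<alpha> :: 'd list. length \<alpha> = 0} = {[]}" by auto
    then show ?case by (simp only: adj_word_Nil sum.insert) (simp add: adj_word_Nil del: word_op.simps)
  next
    case (Suc n)
    \<comment> \<open>The new letter goes to the end of the word, because the adjoint of T_\<alpha>
      T_j applies T_j^* last.\<close>
    have split: "{\<alpha> :: 'd list. length \<alpha> = Suc n} = (\<lambda>(\<alpha>, j). \<alpha> @ [j]) ` ({\<alpha>. length \<alpha> = n} \<times> UNIV)"
      by (auto simp: length_Suc_conv_rev image_iff)
    have "(\<Sum>\<alpha> | length \<alpha> = Suc n. (norm (?w \<alpha>))\<^sup>2)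
        = (\<Sum>(\<alpha>, j)\<in>{\<alpha>. length \<alpha> = n} \<times> UNIV. (norm (?w (\<alpha> @ [j])))\<^sup>2)"
      unfolding split by (subst sum.reindex) (auto simp: inj_on_def case_prod_unfold)
    also have "\<dots> = (\<Sum>\<alpha> | length \<alpha> = n. \<Sum>j\<in>UNIV. (norm (?w (\<alpha> @ [j])))\<^sup>2)"
      by (rule sum.cartesian_product [symmetric])
    also have "\<dots> = (\<Sum>\<alpha> | length \<alpha> = n. (norm (star_vec T (?w \<alpha>)))\<^sup>2)"
      by (simp only: adj_word_snoc norm_vec_sq star_vec_nth)
    also have "\<dots> = (norm z)\<^sup>2" unfolding eq by (rule Suc.IH)
    finally show ?case .
  qed
  then show ?thesis using cnc unfolding completely_non_coisometric_def by blast
qed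

subsection \<open>Vectors in Fock space\<close>

abbreviation single :: "'d list \<Rightarrow> 'h::complex_inner \<Rightarrow> ('d, 'h) fock" where
  "single \<alpha> h \<equiv> tensor (basis_vec \<alpha>) h"

lemma coord_single: "coord (single \<alpha> h) \<beta> = (if \<beta> = \<alpha> then h else 0)"
  by (simp add: tensor.rep_eq basis_vec.rep_eq)

lemma cinner_single_right: "cinner x (single \<alpha> h) = cinner (coord x \<alpha>) h"
proof -
  have "(\<Sum>\<^sub>\<infinity>\<beta>. cinner (coord x \<beta>) (coord (single \<alpha> h) \<beta>))
      = (\<Sum>\<^sub>\<infinity>\<beta>\<in>{\<alpha>}. cinner (coord x \<beta>) (coord (single \<alpha> h) \<beta>))"
    by (rule infsum_cong_neutral) (simp_all add: coord_single)
  then show ?thesis by (simp add: cinner_l2_def coord_single)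
qed

lemma cinner_single_left: "cinner (single \<alpha> h) x = cinner h (coord x \<alpha>)"
  using cinner_single_right[of x \<alpha> h] cinner_commute[of "single \<alpha> h" x] cinner_commute[of h "coord x \<alpha>"] by simp

lemma creation_single: "creation j (single \<alpha> h) = single (j # \<alpha>) h"
  by (simp add: creation_tensor creation_basis_vec)

lemma coord_creation: "coord (creation j x) \<beta> = (case \<beta> of [] \<Rightarrow> 0 | i # \<alpha> \<Rightarrow> if i = j then coord x \<alpha> else 0)"
  by (simp add: creation.rep_eq)

lemma bounded_op_creation:
  fixes D :: "'h::complex_inner set" and j :: 'd
  assumes D: "csubspace D" shows "bounded_op (fock_on D) (fock_on D) (creation j)"
proof (rule bounded_opI[where b = 1])
  show "creation j x \<in> fock_on D" if "x \<in> fock_on D" for x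
    using that csubspace_zero[OF D] by (auto simp: fock_on_def coord_creation split: list.splits)
  show "creation j (x + y) = creation j x + creation j y" for x y
    by (rule l2_eqI) (simp add: coord_creation split: list.splits)
  show "creation j (c *\<^sub>C x) = c *\<^sub>C creation j x" for c x
    by (rule l2_eqI) (simp add: coord_creation split: list.splits)
  fix x :: "('d, 'h) fock"
  have "norm (creation j x) \<le> norm x"
  proof (rule norm_l2_le)
    fix F :: "'d list set" assume F: "finite F"
    define G where "G = {\<alpha>. j # \<alpha> \<in> F}"
    have G: "finite G" unfolding G_def using finite_vimageI[OF F, of "(#) j"] by (simp add: vimage_def inj_def)
    have "(\<Sum>\<beta>\<in>F. (norm (coord (creation j x) \<beta>))\<^sup>2) = (\<Sum>\<beta>\<in>(#) j ` G. (norm (coord (creation j x) \<beta>))\<^sup>2)"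
      using F by (intro sum.mono_neutral_right)
        (auto simp: G_def coord_creation image_iff split: list.splits)
    also have "\<dots> = (\<Sum>\<alpha>\<in>G. (norm (coord x \<alpha>))\<^sup>2)"
      by (subst sum.reindex) (auto simp: inj_on_def coord_creation)
    also have "\<dots> \<le> (norm x)\<^sup>2" by (rule sum_coord_le[OF G])
    finally show "(\<Sum>\<beta>\<in>F. (norm (coord (creation j x) \<beta>))\<^sup>2) \<le> (norm x)\<^sup>2" .
  qed simp
  then show "norm (creation j x) \<le> 1 * norm x" by simp
qed

lemma single_in_fock_on: "csubspace D \<Longrightarrow> h \<in> D \<Longrightarrow> single \<alpha> h \<in> fock_on D"
  by (simp add: fock_on_def coord_single csubspace_zero)

text \<open>Orthogonality of x to the tensor of e_\<alpha> with the coordinate of x at \<alpha>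
  makes that coordinate vanish.\<close>

lemma fock_on_cspan:
  fixes D :: "'h::chilbert_space set"
  assumes D: "closed_csubspace D"
  shows "fock_on D = closed_cspan ((\<lambda>(\<alpha>, h). single \<alpha> h) ` (UNIV \<times> D))"
proof (rule orth_eq_0[symmetric])
  note sub = closed_csubspace_imp[OF D]
  show "csubspace (fock_on D)" by (rule closed_csubspace_imp[OF closed_csubspace_fock_on[OF D]])
  show "closed_cspan ((\<lambda>(\<alpha>, h). single \<alpha> h) ` (UNIV \<times> D)) \<subseteq> fock_on D"
    by (rule closed_cspan_minimal[OF _ closed_csubspace_fock_on[OF D]]) (auto simp: single_in_fock_on sub)
  fix x assume x: "x \<in> fock_on D" and o: "x \<in> orth (closed_cspan ((\<lambda>(\<alpha>, h). single \<alpha> h) ` (UNIV \<times> D)))"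
  have "coord x \<alpha> = 0" for \<alpha>
  proof -
    have c: "coord x \<alpha> \<in> D" using x by (simp add: fock_on_def)
    have "single \<alpha> (coord x \<alpha>) \<in> (\<lambda>(\<alpha>, h). single \<alpha> h) ` (UNIV \<times> D)" using c by auto
    then have "cinner x (single \<alpha> (coord x \<alpha>)) = 0"
      using o unfolding orth_closed_cspan by (rule orthD[rotated])
    then show ?thesis by (simp add: cinner_single_right)
  qed
  then show "x = 0" by (intro l2_eqI) simp
qed simp

lemma coord_id_tensor:
  assumes v: "bounded_op D D' v" and x: "x \<in> fock_on D"
  shows "coord (id_tensor v x) \<alpha> = v (coord x \<alpha>)"
proof -
  obtain b where b: "b \<ge> 0" "\<And>h. h \<in> D \<Longrightarrow> norm (v h) \<le> b * norm h" using bounded_op_bound[OF v] by blast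
  have "(\<lambda>\<alpha>. (norm (v (coord x \<alpha>)))\<^sup>2) summable_on UNIV"
  proof (rule summable_on_comparison_test)
    show "(\<lambda>\<alpha>. b\<^sup>2 * (norm (coord x \<alpha>))\<^sup>2) summable_on UNIV"
      by (intro summable_on_cmult_right coord_summable)
    have "norm (v (coord x \<alpha>)) \<le> b * norm (coord x \<alpha>)" for \<alpha>
      using b(2) x by (simp add: fock_on_def)
    then have "(norm (v (coord x \<alpha>)))\<^sup>2 \<le> (b * norm (coord x \<alpha>))\<^sup>2" for \<alpha>
      by (rule power_mono) simp
    then show "(norm (v (coord x \<alpha>)))\<^sup>2 \<le> b\<^sup>2 * (norm (coord x \<alpha>))\<^sup>2" for \<alpha>
      by (simp add: power_mult_distrib)
  qed simp
  then show ?thesis by (simp add: id_tensor_def Abs_l2_inverse)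
qed

lemma bounded_op_id_tensor:
  assumes v: "bounded_op D D' v" and D: "csubspace D"
  shows "bounded_op (fock_on D) (fock_on D') (id_tensor v)"
proof -
  obtain b where b: "b \<ge> 0" "\<And>h. h \<in> D \<Longrightarrow> norm (v h) \<le> b * norm h" using bounded_op_bound[OF v] by blast
  have in_D: "coord x \<alpha> \<in> D" if "x \<in> fock_on D" for x :: "('d, 'a) fock" and \<alpha> using that by (simp add: fock_on_def)
  have add_in: "x + y \<in> fock_on D" "c *\<^sub>C x \<in> fock_on D"
    if "x \<in> fock_on D" "y \<in> fock_on D" for x y :: "('d, 'a) fock" and c
    using that D by (simp_all add: fock_on_def csubspace_add csubspace_scaleC)
  show ?thesis
  proof (rule bounded_opI[where b = b])
    fix x :: "('d, 'a) fock" assume x: "x \<in> fock_on D"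
    show "id_tensor v x \<in> fock_on D'"
      using bounded_op_in[OF v in_D[OF x]] by (simp add: fock_on_def[of D'] coord_id_tensor[OF v x])
    show "id_tensor v (c *\<^sub>C x) = c *\<^sub>C id_tensor v x" for c
      by (rule l2_eqI) (simp add: coord_id_tensor[OF v] x add_in[OF x x] bounded_op_scaleC[OF v] in_D)
    show "id_tensor v (x + y) = id_tensor v x + id_tensor v y" if y: "y \<in> fock_on D" for y
      by (rule l2_eqI) (simp add: coord_id_tensor[OF v] x y add_in[OF x y] bounded_op_add[OF v] in_D)
    show "norm (id_tensor v x) \<le> b * norm x"
    proof (rule norm_l2_le)
      fix F :: "'d list set" assume F: "finite F"
      have "(norm (v (coord x \<alpha>)))\<^sup>2 \<le> b\<^sup>2 * (norm (coord x \<alpha>))\<^sup>2" for \<alpha>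
        using power_mono[OF b(2)[OF in_D[OF x, of \<alpha>]], of 2] by (simp add: power_mult_distrib)
      then have "(\<Sum>\<alpha>\<in>F. (norm (coord (id_tensor v x) \<alpha>))\<^sup>2) \<le> (\<Sum>\<alpha>\<in>F. b\<^sup>2 * (norm (coord x \<alpha>))\<^sup>2)"
        unfolding coord_id_tensor[OF v x] by (rule sum_mono)
      also have "\<dots> \<le> b\<^sup>2 * (norm x)\<^sup>2"
        unfolding sum_distrib_left [symmetric] by (rule mult_left_mono[OF sum_coord_le[OF F]]) simp
      finally show "(\<Sum>\<alpha>\<in>F. (norm (coord (id_tensor v x) \<alpha>))\<^sup>2) \<le> (b * norm x)\<^sup>2"
        by (simp add: power_mult_distrib)
    qed (simp add: b(1))
  qed
qed

lemma id_tensor_single: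
  assumes v: "bounded_op D D' v" and D: "csubspace D" and h: "h \<in> D"
  shows "id_tensor v (single \<alpha> h) = single \<alpha> (v h)"
  by (rule l2_eqI)
    (simp add: coord_id_tensor[OF v single_in_fock_on[OF D h]] coord_single bounded_op_zero[OF v csubspace_zero[OF D]])

lemma id_tensor_creation:
  assumes v: "bounded_op D D' v" and D: "csubspace D" and x: "x \<in> fock_on D"
  shows "id_tensor v (creation j x) = creation j (id_tensor v x)"
  by (rule l2_eqI)
    (simp add: coord_id_tensor[OF v bounded_op_in[OF bounded_op_creation[OF D] x]] coord_id_tensor[OF v x]
      coord_creation bounded_op_zero[OF v csubspace_zero[OF D]] split: list.splits)

subsection \<open>Row isometries and wandering subspaces\<close>

text \<open>Polarisation, with i y for the imaginary part; \<open>row_isometry_on\<close> only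
  speaks of norms.\<close>

lemma cinner_of_isometry:
  assumes f: "bounded_op X Y f" and X: "csubspace X" and iso: "\<And>x. x \<in> X \<Longrightarrow> norm (f x) = norm x"
    and xy: "x \<in> X" "y \<in> X"
  shows "cinner (f x) (f y) = cinner x y"
proof -
  have re: "inner (f u) (f v) = inner u v" if uv: "u \<in> X" "v \<in> X" for u v
  proof -
    have "(norm (f u + f v))\<^sup>2 = (norm (u + v))\<^sup>2"
      using iso[OF csubspace_add[OF X uv]] by (simp add: bounded_op_add[OF f uv])
    then show ?thesis unfolding norm_add_sq using iso[OF uv(1)] iso[OF uv(2)] by (simp add: Re_cinner)
  qed
  have "Re (cinner (f x) (f y)) = Re (cinner x y)" using re[OF xy] by (simp add: Re_cinner)
  moreover have "Im (cinner (f x) (f y)) = Im (cinner x y)"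
    using re[OF xy(1) csubspace_scaleC[OF X xy(2), of \<i>]]
    by (simp add: Im_cinner bounded_op_scaleC[OF f xy(2)])
  ultimately show ?thesis by (simp add: complex_eq_iff)
qed

locale row_iso =
  fixes K :: "'k::chilbert_space set" and V :: "'d::finite \<Rightarrow> 'k \<Rightarrow> 'k"
  assumes K: "closed_csubspace K" and row_iso: "row_isometry_on K V"
begin

lemma K_sub: "csubspace K" by (rule closed_csubspace_imp[OF K])

lemma V_op: "bounded_op K K (V j)"
  using row_iso by (simp add: row_isometry_on_def)

lemmas V_in = bounded_op_in[OF V_op]

lemma V_cinner: "x \<in> K \<Longrightarrow> y \<in> K \<Longrightarrow> cinner (V i x) (V j y) = (if i = j then cinner x y else 0)"
  using row_iso cinner_of_isometry[OF V_op K_sub, of j x y] by (simp add: row_isometry_on_def)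

lemma word_V_op: "bounded_op K K (word_op V \<alpha>)"
  by (rule bounded_op_word) (rule V_op)
lemmas word_in = bounded_op_in[OF word_V_op]

lemma word_cinner: "x \<in> K \<Longrightarrow> y \<in> K \<Longrightarrow> cinner (word_op V \<alpha> x) (word_op V \<alpha> y) = cinner x y"
  by (induction \<alpha>) (simp_all add: V_cinner word_in)

lemma closed_shift_space [simp]: "closed_csubspace (shift_space V L)"
  by (simp add: shift_space_def)

lemma word_in_shift_space: "l \<in> L \<Longrightarrow> word_op V \<alpha> l \<in> shift_space V L"
  unfolding shift_space_def by (rule closed_cspan_base) blast

lemma subset_shift_space: "L \<subseteq> shift_space V L"
  using word_in_shift_space[of _ L "[]"] by auto

lemma shift_space_least:
  assumes X: "closed_csubspace X" "\<And>j x. x \<in> X \<Longrightarrow> V j x \<in> X" and L: "L \<subseteq> X"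
  shows "shift_space V L \<subseteq> X"
proof -
  have "word_op V \<alpha> l \<in> X" if "l \<in> L" for \<alpha> l
    by (induction \<alpha>) (use that L X(2) in auto)
  then show ?thesis unfolding shift_space_def by (intro closed_cspan_minimal X) blast
qed

lemma shift_space_subset: "L \<subseteq> K \<Longrightarrow> shift_space V L \<subseteq> K"
  by (rule shift_space_least[OF K V_in])

lemma V_shift_space:
  assumes L: "L \<subseteq> K" and x: "x \<in> shift_space V L" shows "V j x \<in> shift_space V L"
proof (rule bounded_op_closed_cspan_in[where f = "V j", OF V_op K closed_shift_space _ _ x[unfolded shift_space_def]])
  show "(\<Union>\<alpha>. word_op V \<alpha> ` L) \<subseteq> K" using L word_in by blast
  show "V j s \<in> shift_space V L" if s: "s \<in> (\<Union>\<alpha>. word_op V \<alpha> ` L)" for s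
  proof -
    obtain \<alpha> l where "l \<in> L" "s = word_op V \<alpha> l" using s by blast
    then show ?thesis using word_in_shift_space[of l L "j # \<alpha>"] by simp
  qed
qed

text \<open>Replaces the intersection by explicit generators V_\<alpha> s, on which linear
  identities can be tested.\<close>

lemma inv_hull_eq_shift_space:
  assumes S: "S \<subseteq> K" shows "inv_hull K V S = shift_space V S"
proof
  show "inv_hull K V S \<subseteq> shift_space V S"
    unfolding inv_hull_def
  proof (rule Inter_lower, intro CollectI conjI allI image_subsetI)
    show "S \<subseteq> shift_space V S" by (rule subset_shift_space)
    show "shift_space V S \<subseteq> K" by (rule shift_space_subset[OF S])
    show "V j x \<in> shift_space V S" if "x \<in> shift_space V S" for j x by (rule V_shift_space[OF S that])
  qed simp
  show "shift_space V S \<subseteq> inv_hull K V S"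
    unfolding inv_hull_def
  proof (rule Inter_greatest, elim CollectE conjE)
    fix X assume X: "closed_csubspace X" "S \<subseteq> X" "\<forall>j. V j ` X \<subseteq> X"
    show "shift_space V S \<subseteq> X" by (rule shift_space_least[OF X(1) _ X(2)]) (use X(3) in blast)
  qed
qed

lemma orth_shift_space: "orth (shift_space V L) = {x. \<forall>\<alpha>. \<forall>l\<in>L. cinner x (word_op V \<alpha> l) = 0}"
  unfolding shift_space_def orth_closed_cspan by (auto simp: orth_def)

end

text \<open>\<open>U\<close> is the unitary \<open>e\<^sub>\<alpha> \<otimes> \<delta> \<mapsto> V\<^sub>\<alpha> (u \<delta>)\<close> on \<open>\<Gamma> \<otimes> D\<close>.\<close>

definition fock_ext ::
    "('d \<Rightarrow> 'k::complex_inner \<Rightarrow> 'k) \<Rightarrow> 'h::complex_inner set \<Rightarrow> 'k set \<Rightarrow> ('h \<Rightarrow> 'k) \<Rightarrow> (('d, 'h) fock \<Rightarrow> 'k) \<Rightarrow> bool"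
  where "fock_ext V D S u U \<longleftrightarrow> unitary_op (fock_on D) S U \<and>
     (\<forall>\<delta>\<in>D. U (vac_tensor \<delta>) = u \<delta>) \<and> (\<forall>j. \<forall>x\<in>fock_on D. U (creation j x) = V j (U x))"

lemma fock_ext_unitary: "fock_ext V D S u U \<Longrightarrow> unitary_op (fock_on D) S U"
  and fock_ext_creation: "fock_ext V D S u U \<Longrightarrow> x \<in> fock_on D \<Longrightarrow> U (creation j x) = V j (U x)"
  by (simp_all add: fock_ext_def)

lemma fock_ext_single:
  assumes U: "fock_ext V D S u U" and D: "csubspace D" and h: "h \<in> D"
  shows "U (single \<alpha> h) = word_op V \<alpha> (u h)"
proof (induction \<alpha>)
  case Nil
  show ?case using U h by (simp add: fock_ext_def)
next
  case (Cons j \<alpha>)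
  have "U (creation j (single \<alpha> h)) = V j (U (single \<alpha> h))"
    by (rule fock_ext_creation[OF U single_in_fock_on[OF D h]])
  then show ?case by (simp add: creation_single Cons.IH)
qed

lemma fock_on_eqI:
  fixes D :: "'h::chilbert_space set" and f :: "('d, 'h) fock \<Rightarrow> 'b::complex_inner"
  assumes f: "bounded_op (fock_on D) Y f" and g: "bounded_op (fock_on D) Y' g"
    and D: "closed_csubspace D" and fg: "\<And>\<alpha> h. h \<in> D \<Longrightarrow> f (single \<alpha> h) = g (single \<alpha> h)"
    and x: "x \<in> fock_on D"
  shows "f x = g x"
proof (rule bounded_op_eq_on_closed_cspan[OF f g closed_csubspace_fock_on[OF D]])
  let ?S = "(\<lambda>(\<alpha>, h). single \<alpha> h) ` (UNIV \<times> D) :: ('d, 'h) fock set"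
  show "?S \<subseteq> fock_on D" using single_in_fock_on[OF closed_csubspace_imp[OF D]] by auto
  show "x \<in> closed_cspan ?S" using x unfolding fock_on_cspan[OF D] .
  show "f s = g s" if "s \<in> ?S" for s using that fg by auto
qed

text \<open>Both sides are bounded and intertwine creation with V', so agreement on the coefficient
  space spreads over elementary tensors to the whole Fock space.\<close>

lemma fock_ext_transfer:
  fixes D :: "'h::chilbert_space set" and D' :: "'g::chilbert_space set"
    and V :: "'d \<Rightarrow> 'k::chilbert_space \<Rightarrow> 'k"
  assumes U: "fock_ext V D S \<kappa> U" and U': "fock_ext V' D' S' \<kappa>' U'"
    and D: "closed_csubspace D" "csubspace D'" and W: "bounded_op S K' W"
    and u: "bounded_op D D' u"
    and WV: "\<And>j x. x \<in> S \<Longrightarrow> W (V j x) = V' j (W x)"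
    and \<kappa>: "\<And>\<delta>. \<delta> \<in> D \<Longrightarrow> \<kappa>' (u \<delta>) = W (\<kappa> \<delta>)" and x: "x \<in> fock_on D"
  shows "U' (id_tensor u x) = W (U x)"
proof (rule fock_on_eqI[OF _ _ D(1) _ x])
  note sub = closed_csubspace_imp[OF D(1)]
  show "bounded_op (fock_on D) S' (\<lambda>x. U' (id_tensor u x))"
    by (rule bounded_op_compose[OF bounded_op_id_tensor[OF u sub] unitary_bounded[OF fock_ext_unitary[OF U']]])
  show "bounded_op (fock_on D) K' (\<lambda>x. W (U x))"
    by (rule bounded_op_compose[OF unitary_bounded[OF fock_ext_unitary[OF U]] W])
  fix \<alpha> and \<delta> assume \<delta>: "\<delta> \<in> D"
  have in_S: "word_op V \<alpha> (\<kappa> \<delta>) \<in> S" for \<alpha>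
    using unitary_in[OF fock_ext_unitary[OF U] single_in_fock_on[OF sub \<delta>, of \<alpha>]]
    by (simp add: fock_ext_single[OF U sub \<delta>])
  have "word_op V' \<alpha> (W (\<kappa> \<delta>)) = W (word_op V \<alpha> (\<kappa> \<delta>))"
    by (induction \<alpha>) (simp_all add: WV[OF in_S])
  then show "U' (id_tensor u (single \<alpha> \<delta>)) = W (U (single \<alpha> \<delta>))"
    by (simp add: id_tensor_single[OF u sub \<delta>] fock_ext_single[OF U sub \<delta>]
        fock_ext_single[OF U' D(2) bounded_op_in[OF u \<delta>]] \<kappa>[OF \<delta>])
qed

text \<open>Only nonempty words against the empty word are assumed orthogonal. For a row isometry
  common first letters cancel and different ones give 0, which yields the full statement
  \<open>gram\<close>.\<close>

locale wandering_subspace = row_iso +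
  fixes L
  assumes L: "closed_csubspace L" and L_subset: "L \<subseteq> K"
    and wander: "\<And>j \<alpha> l l'. l \<in> L \<Longrightarrow> l' \<in> L \<Longrightarrow> cinner (word_op V (j # \<alpha>) l) l' = 0"
begin

abbreviation S :: "'a set" where "S \<equiv> shift_space V L"

lemma S_subset: "S \<subseteq> K" by (rule shift_space_subset[OF L_subset])

lemma L_in_K: "l \<in> L \<Longrightarrow> l \<in> K" using L_subset by blast

lemma wander': "l \<in> L \<Longrightarrow> l' \<in> L \<Longrightarrow> cinner l' (word_op V (j # \<alpha>) l) = 0"
  using wander cinner_eq_zero_commute by blast

lemma gram:
  "l \<in> L \<Longrightarrow> l' \<in> L \<Longrightarrow> cinner (word_op V \<alpha> l) (word_op V \<beta> l') = (if \<alpha> = \<beta> then cinner l l' else 0)"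
proof (induction \<alpha> arbitrary: \<beta>)
  case Nil
  then show ?case
    using wander'[of l' l] by (cases \<beta>) (auto simp del: word_op.simps(2))
next
  case (Cons i \<alpha>)
  show ?case
  proof (cases \<beta>)
    case Nil
    then show ?thesis using wander[OF Cons.prems] by (auto simp del: word_op.simps(2))
  next
    case (Cons j \<gamma>)
    then show ?thesis by (simp add: V_cinner word_in word_cinner L_in_K Cons.IH[OF Cons.prems] Cons.prems)
  qed
qed

text \<open>By \<open>gram\<close> the vectors V_\<alpha> (u h) have the inner products of the
  elementary tensors of e_\<alpha> and h.\<close>

lemma fock_ext_exists:
  fixes D :: "'h::chilbert_space set"
  assumes u: "unitary_op D L u" and D: "closed_csubspace D"
  shows "\<exists>U :: ('b, 'h) fock \<Rightarrow> 'a. fock_ext V D S u U"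
proof -
  note sub = closed_csubspace_imp[OF D]
  let ?x = "\<lambda>(\<alpha>, h). single \<alpha> h :: ('b, 'h) fock" and ?y = "\<lambda>(\<alpha>, h). word_op V \<alpha> (u h)"
  have gr: "cinner (?x p) (?x q) = cinner (?y p) (?y q)" if pq: "p \<in> UNIV \<times> D" "q \<in> UNIV \<times> D" for p q
  proof -
    obtain \<alpha> h \<beta> k where p: "p = (\<alpha>, h)" "h \<in> D" and q: "q = (\<beta>, k)" "k \<in> D" using pq by auto
    show ?thesis
      by (simp add: p q cinner_single_left coord_single gram unitary_in[OF u] unitary_cinner[OF u])
  qed
  have "\<exists>U. unitary_op (closed_cspan (?x ` (UNIV \<times> D))) (closed_cspan (?y ` (UNIV \<times> D))) U
      \<and> (\<forall>p\<in>UNIV \<times> D. U (?x p) = ?y p)"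
    by (rule unitary_of_equal_gram) (rule gr)
  then obtain U where U: "unitary_op (closed_cspan (?x ` (UNIV \<times> D))) (closed_cspan (?y ` (UNIV \<times> D))) U"
      "\<forall>p\<in>UNIV \<times> D. U (?x p) = ?y p" by (elim exE conjE)
  have "?y ` (UNIV \<times> D) = (\<Union>\<alpha>. word_op V \<alpha> ` L)"
    unfolding unitary_image[OF u, symmetric] by auto
  then have un: "unitary_op (fock_on D) S U"
    using U(1) unfolding fock_on_cspan[OF D, symmetric] shift_space_def by simp
  have single: "U (single \<alpha> h) = word_op V \<alpha> (u h)" if "h \<in> D" for \<alpha> h using bspec[OF U(2), of "(\<alpha>, h)"] that by simp
  have "U (creation j x) = V j (U x)" if x: "x \<in> fock_on D" for j x
  proof (rule fock_on_eqI[OF _ _ D _ x])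
    show "bounded_op (fock_on D) S (\<lambda>x. U (creation j x))"
      by (rule bounded_op_compose[OF bounded_op_creation[OF sub] unitary_bounded[OF un]])
    show "bounded_op (fock_on D) K (\<lambda>x. V j (U x))"
      by (rule bounded_op_compose[OF bounded_op_subset[OF unitary_bounded[OF un] order_refl] V_op])
        (use unitary_in[OF un] S_subset in blast)
    show "U (creation j (single \<alpha> h)) = V j (U (single \<alpha> h))" if "h \<in> D" for \<alpha> h
      using single[OF that] by (simp add: creation_single)
  qed
  then have "fock_ext V D S u U" using un single[of _ "[]"] by (simp add: fock_ext_def)
  then show ?thesis by (rule exI[of "\<lambda>U. fock_ext V D S u U"])
qed

lemma V_S_orth_L:
  assumes s: "s \<in> S" and l: "l \<in> L" shows "cinner (V j s) l = 0"
proof -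
  have "V j s \<in> orth {l}"
  proof (rule bounded_op_closed_cspan_in[where f = "V j", OF V_op K _ _ _ s[unfolded shift_space_def]])
    show "(\<Union>\<alpha>. word_op V \<alpha> ` L) \<subseteq> K" using L_subset word_in by blast
    show "V j s \<in> orth {l}" if s: "s \<in> (\<Union>\<alpha>. word_op V \<alpha> ` L)" for s
    proof -
      obtain \<alpha> l' where "l' \<in> L" "s = word_op V \<alpha> l'" using s by blast
      then show ?thesis using wander[of l' l j \<alpha>] l by (simp add: orth_def)
    qed
  qed simp
  then show ?thesis by (simp add: orth_def)
qed

lemma V_orth_S:
  assumes z: "z \<in> K" "z \<in> orth S" and zl: "\<And>l. l \<in> L \<Longrightarrow> cinner (V j z) l = 0"
  shows "V j z \<in> orth S"
  unfolding orth_shift_space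
proof (intro CollectI allI ballI)
  fix \<alpha> l assume l: "l \<in> L"
  show "cinner (V j z) (word_op V \<alpha> l) = 0"
  proof (cases \<alpha>)
    case Nil
    then show ?thesis using zl[OF l] by simp
  next
    case (Cons i \<beta>)
    have "cinner z (word_op V \<beta> l) = 0" by (rule orthD[OF z(2) word_in_shift_space[OF l]])
    then show ?thesis by (simp add: Cons V_cinner z(1) word_in L_in_K[OF l])
  qed
qed

text \<open>S is the sum of L and the spaces V_i S, so projecting commutes with V_j up to a
  component in L, which the hypothesis on V_j x excludes. This makes compressions
  multi-analytic.\<close>

lemma proj_V:
  assumes x: "x \<in> K" and xl: "\<And>l. l \<in> L \<Longrightarrow> cinner (V j x) l = 0"
  shows "proj S (V j x) = V j (proj S x)"
proof (rule proj_eqI[OF closed_csubspace_imp[OF closed_shift_space]])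
  have p: "proj S x \<in> S" by (rule proj_in) simp
  then have pK: "proj S x \<in> K" using S_subset by blast
  show "V j (proj S x) \<in> S" by (rule V_shift_space[OF L_subset p])
  fix y assume y: "y \<in> S"
  have "V j (x - proj S x) \<in> orth S"
  proof (rule V_orth_S)
    show "x - proj S x \<in> K" by (rule csubspace_diff[OF K_sub x pK])
    show "x - proj S x \<in> orth S" by (intro orthI proj_orth) simp
    show "cinner (V j (x - proj S x)) l = 0" if "l \<in> L" for l
      using xl[OF that] V_S_orth_L[OF p that] by (simp add: bounded_op_diff[OF V_op K_sub x pK] cinner_diff_left)
  qed
  then show "cinner (V j x - V j (proj S x)) y = 0"
    using y by (simp add: bounded_op_diff[OF V_op K_sub x pK] orthD)
qed

end

subsection \<open>Compressions to a shift space\<close>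

text \<open>Common frame of both characteristic functions; index 1 belongs to the target and 2 to
  the source. For M_{C,E} the space L is L_C and L2 is L_E; for M_{\<Theta>_A} they are L_{*,A} and
  L_A. The last assumption is what \<open>proj_V\<close> asks for.\<close>

locale compression = wandering_subspace +
  fixes D1 :: "'g::chilbert_space set" and u1 and U1 :: "('b, 'g) fock \<Rightarrow> 'a"
    and D2 :: "'h::chilbert_space set" and L2 u2 and U2 :: "('b, 'h) fock \<Rightarrow> 'a"
  assumes D1: "closed_csubspace D1" and D2: "closed_csubspace D2" and L2: "closed_csubspace L2" "L2 \<subseteq> K"
    and u1: "unitary_op D1 L u1" and u2: "unitary_op D2 L2 u2"
    and U1: "fock_ext V D1 S u1 U1" and U2: "fock_ext V D2 (shift_space V L2) u2 U2"
    and V_orth_L: "\<And>j y l. y \<in> shift_space V L2 \<Longrightarrow> l \<in> L \<Longrightarrow> cinner (V j y) l = 0"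
begin

definition M :: "('b, 'h) fock \<Rightarrow> ('b, 'g) fock" where
  "M x = adj (fock_on D1) S U1 (proj S (U2 x))"

lemmas D1_sub = closed_csubspace_imp[OF D1] and D2_sub = closed_csubspace_imp[OF D2]
lemmas F1 = closed_csubspace_fock_on[OF D1, where 'd = 'b] and F2 = closed_csubspace_fock_on[OF D2, where 'd = 'b]
lemmas F1_sub = closed_csubspace_imp[OF F1] and F2_sub = closed_csubspace_imp[OF F2]
lemmas U1_un = fock_ext_unitary[OF U1] and U2_un = fock_ext_unitary[OF U2]
lemmas S_sub = closed_csubspace_imp[OF closed_shift_space]

lemma M_op: "bounded_op (fock_on D2) (fock_on D1) M"
  unfolding M_def
  by (rule bounded_op_compose[OF bounded_op_compose[OF unitary_bounded[OF U2_un] bounded_op_proj]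
        bounded_op_adj[OF F1 S_sub unitary_bounded[OF U1_un]]]) simp

lemma U1_M: "U1 (M x) = proj S (U2 x)"
  unfolding M_def by (subst adj_unitary[OF U1_un F1 S_sub]) (simp_all add: proj_in unitary_inv_right[OF U1_un F1_sub])

lemma U2_in: "x \<in> fock_on D2 \<Longrightarrow> U2 x \<in> K"
  using unitary_in[OF U2_un] shift_space_subset[OF L2(2)] by blast

lemma M_norm: assumes x: "x \<in> fock_on D2" shows "norm (M x) = norm (proj S (U2 x))"
  using unitary_norm[OF U1_un bounded_op_in[OF M_op x]] by (simp add: U1_M)

lemma M_norm_le: assumes x: "x \<in> fock_on D2" shows "norm (M x) \<le> norm x"
  using M_norm[OF x] norm_proj_le[of S "U2 x"] unitary_norm[OF U2_un x] by simp

lemma M_creation: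
  assumes x: "x \<in> fock_on D2" shows "M (creation j x) = creation j (M x)"
proof (rule inj_onD[OF unitary_inj_on[OF U1_un F1_sub]])
  have c: "creation j x \<in> fock_on D2" by (rule bounded_op_in[OF bounded_op_creation[OF D2_sub] x])
  show "M (creation j x) \<in> fock_on D1" by (rule bounded_op_in[OF M_op c])
  show "creation j (M x) \<in> fock_on D1"
    by (rule bounded_op_in[OF bounded_op_creation[OF D1_sub] bounded_op_in[OF M_op x]])
  show "U1 (M (creation j x)) = U1 (creation j (M x))"
    by (simp add: fock_ext_creation[OF U1 bounded_op_in[OF M_op x]] U1_M fock_ext_creation[OF U2 x]
        proj_V[OF U2_in[OF x] V_orth_L[OF unitary_in[OF U2_un x]]])
qed

lemma M_contractive: "contractive_multi_analytic D2 D1 M"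
  by (simp add: contractive_multi_analytic_def multi_analytic_def M_op M_creation M_norm_le)

section \<open>Pure contractivity and the Szego condition for a compression\<close>

lemma proj_vac:
  fixes y :: "('b, 'g) fock"
  assumes y: "y \<in> fock_on D1" shows "proj (vac_tensor ` D1) y = vac_tensor (coord y [])"
proof (rule proj_eqI)
  show "csubspace (vac_tensor ` D1 :: ('b, 'g) fock set)"
  proof (rule csubspaceI)
    show "0 \<in> (vac_tensor ` D1 :: ('b, 'g) fock set)"
      by (rule image_eqI[of _ _ 0]) (auto simp: coord_single csubspace_zero[OF D1_sub] intro!: l2_eqI)
    show "x + y \<in> vac_tensor ` D1" if xy: "x \<in> vac_tensor ` D1" "y \<in> vac_tensor ` D1" for x y :: "('b, 'g) fock"
    proof -
      obtain a b where "a \<in> D1" "b \<in> D1" "x = vac_tensor a" "y = vac_tensor b" using xy by blast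
      then show ?thesis by (intro image_eqI[of _ _ "a + b"] l2_eqI) (simp_all add: coord_single csubspace_add[OF D1_sub])
    qed
    show "c *\<^sub>C x \<in> vac_tensor ` D1" if x: "x \<in> vac_tensor ` D1" for c and x :: "('b, 'g) fock"
    proof -
      obtain a where "a \<in> D1" "x = vac_tensor a" using x by blast
      then show ?thesis by (intro image_eqI[of _ _ "c *\<^sub>C a"] l2_eqI) (simp_all add: coord_single csubspace_scaleC[OF D1_sub])
    qed
  qed
  show "vac_tensor (coord y []) \<in> vac_tensor ` D1" using y by (simp add: fock_on_def)
  show "cinner (y - vac_tensor (coord y [])) z = 0" if "z \<in> vac_tensor ` D1" for z :: "('b, 'g) fock"
    using that by (auto simp: cinner_single_right coord_single)
qed

text \<open>U1 maps the vacuum tensors onto L, so the vacuum coefficient of M sees exactly the part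
  of u2 \<delta> in L.\<close>

lemma vac_component:
  assumes \<delta>: "\<delta> \<in> D2" shows "u1 (coord (M (vac_tensor \<delta>)) []) = proj L (u2 \<delta>)"
proof (rule proj_eqI[OF closed_csubspace_imp[OF L], symmetric])
  have x: "vac_tensor \<delta> \<in> fock_on D2" by (rule single_in_fock_on[OF D2_sub \<delta>])
  have y: "M (vac_tensor \<delta>) \<in> fock_on D1" by (rule bounded_op_in[OF M_op x])
  then have c: "coord (M (vac_tensor \<delta>)) [] \<in> D1" by (simp add: fock_on_def)
  show "u1 (coord (M (vac_tensor \<delta>)) []) \<in> L" by (rule unitary_in[OF u1 c])
  fix l assume l: "l \<in> L"
  then obtain d where d: "d \<in> D1" "l = u1 d" using unitary_image[OF u1] by blast
  have ul: "U1 (vac_tensor d) = l" using fock_ext_single[OF U1 D1_sub d(1), of "[]"] d(2) by simp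
  have "cinner (u2 \<delta>) l = cinner (U2 (vac_tensor \<delta>)) l"
    using fock_ext_single[OF U2 D2_sub \<delta>, of "[]"] by simp
  also have "\<dots> = cinner (proj S (U2 (vac_tensor \<delta>))) l"
    by (rule proj_cinner[symmetric]) (use l subset_shift_space in auto)
  also have "\<dots> = cinner (U1 (M (vac_tensor \<delta>))) (U1 (vac_tensor d))" by (simp add: U1_M ul)
  also have "\<dots> = cinner (M (vac_tensor \<delta>)) (vac_tensor d)"
    by (rule unitary_cinner[OF U1_un y single_in_fock_on[OF D1_sub d(1)]])
  also have "\<dots> = cinner (coord (M (vac_tensor \<delta>)) []) d" by (rule cinner_single_right)
  also have "\<dots> = cinner (u1 (coord (M (vac_tensor \<delta>)) [])) l"
    by (simp add: d(2) unitary_cinner[OF u1 c d(1)])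
  finally show "cinner (u2 \<delta> - u1 (coord (M (vac_tensor \<delta>)) [])) l = 0" by (simp add: cinner_diff_left)
qed

text \<open>The norm in question is that of the projection of u2 \<delta> onto L, and a projection
  strictly shortens every vector outside its range.\<close>

lemma purely_contractive_iff: "purely_contractive D2 D1 M \<longleftrightarrow> L \<inter> L2 = {0}"
proof -
  have norm_eq: "norm (proj (vac_tensor ` D1) (op_symbol M \<delta>)) = norm (proj L (u2 \<delta>))" if \<delta>: "\<delta> \<in> D2" for \<delta>
  proof -
    have y: "M (vac_tensor \<delta>) \<in> fock_on D1"
      by (rule bounded_op_in[OF M_op single_in_fock_on[OF D2_sub \<delta>]])
    have "norm (proj (vac_tensor ` D1) (op_symbol M \<delta>)) = norm (coord (M (vac_tensor \<delta>)) [])"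
      unfolding op_symbol_def proj_vac[OF y]
      by (rule norm_eq_of_cinner) (simp add: cinner_single_right coord_single)
    also have "\<dots> = norm (u1 (coord (M (vac_tensor \<delta>)) []))"
      by (rule unitary_norm[OF u1, symmetric]) (use y in \<open>simp add: fock_on_def\<close>)
    finally show ?thesis by (simp add: vac_component[OF \<delta>])
  qed
  have lt: "norm (proj L z) < norm z \<longleftrightarrow> z \<notin> L" for z
  proof
    assume "z \<notin> L"
    then have "z - proj L z \<noteq> 0" using proj_in[OF L, of z] by auto
    then have "(norm (proj L z))\<^sup>2 < (norm z)\<^sup>2" using proj_pythagoras[OF L, of z] by simp
    then show "norm (proj L z) < norm z" by (rule power2_less_imp_less) simp
  qed (auto simp: proj_same[OF closed_csubspace_imp[OF L]])
  have "purely_contractive D2 D1 M \<longleftrightarrow> (\<forall>\<delta>\<in>D2. \<delta> \<noteq> 0 \<longrightarrow> u2 \<delta> \<notin> L)"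
    unfolding purely_contractive_def using M_contractive
    by (auto simp: norm_eq lt[symmetric] unitary_norm[OF u2])
  also have "\<dots> \<longleftrightarrow> (\<forall>\<delta>\<in>D2. u2 \<delta> \<in> L \<longrightarrow> u2 \<delta> = 0)"
  proof -
    have "\<delta> = 0 \<longleftrightarrow> u2 \<delta> = 0" if "\<delta> \<in> D2" for \<delta> using unitary_norm[OF u2 that] by (metis norm_eq_zero)
    then show ?thesis by blast
  qed
  also have "\<dots> \<longleftrightarrow> L \<inter> L2 = {0}"
    using unitary_image[OF u2] cc_zero[OF L] cc_zero[OF L2(1)] by (auto simp: image_iff)
  finally show ?thesis .
qed

definition N :: "('b, 'h) fock set" where "N = fock_on D2 \<ominus> vac_tensor ` D2"

lemma N_subset: "N \<subseteq> fock_on D2"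
  by (auto simp: N_def orth_diff_def)

lemma in_N_iff: "x \<in> N \<longleftrightarrow> x \<in> fock_on D2 \<and> coord x [] = 0"
proof -
  have "(\<forall>\<delta>\<in>D2. cinner (coord x []) \<delta> = 0) \<longleftrightarrow> coord x [] = 0" if "x \<in> fock_on D2"
    using that by (auto simp: fock_on_def dest!: bspec[of _ _ "coord x []"])
  then show ?thesis by (auto simp: N_def orth_diff_def cinner_single_right)
qed

text \<open>The operator \<Delta> and the complementary projection of U2 x have the same norms,
  since both squares equal |x|^2 - |M x|^2. Distances between values then agree too, so density can
  be tested without the square root.\<close>

lemma szego_iff:
  "szego_condition D2 D1 M \<longleftrightarrow>
     (\<forall>x\<in>fock_on D2. U2 x - proj S (U2 x) \<in> closure ((\<lambda>y. U2 y - proj S (U2 y)) ` N))"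
proof -
  let ?A = "adj (fock_on D2) (fock_on D1) M"
  let ?S = "\<lambda>x. x - ?A (M x)"
  let ?Q = "\<lambda>x. U2 x - proj S (U2 x)"
  let ?\<Delta> = "op_sqrt (fock_on D2) ?S"
  have A: "bounded_op (fock_on D1) (fock_on D2) ?A" by (rule bounded_op_adj[OF F2 F1_sub M_op])
  have A1: "cinner (?A (M x)) y = cinner (M x) (M y)" if "x \<in> fock_on D2" "y \<in> fock_on D2" for x y
    by (rule adj_cinner'[OF F2 F1_sub M_op that(2) bounded_op_in[OF M_op that(1)]])
  have A2: "cinner x (?A (M y)) = cinner (M x) (M y)" if "x \<in> fock_on D2" "y \<in> fock_on D2" for x y
    by (rule adj_cinner[OF F2 F1_sub M_op that(1) bounded_op_in[OF M_op that(2)]])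
  interpret contractive_symmetric "fock_on D2" "\<lambda>x. ?A (M x)"
  proof
    show "norm (?A (M x)) \<le> norm x" if x: "x \<in> fock_on D2" for x
    proof (cases "?A (M x) = 0")
      case False
      have z: "?A (M x) \<in> fock_on D2" by (rule bounded_op_in[OF A bounded_op_in[OF M_op x]])
      have "(norm (?A (M x)))\<^sup>2 = cmod (cinner (M x) (M (?A (M x))))"
        by (simp add: A1[OF x z, symmetric] cinner_self norm_power)
      also have "\<dots> \<le> norm (M x) * norm (M (?A (M x)))" by (rule cmod_cinner_le)
      also have "\<dots> \<le> norm x * norm (?A (M x))"
        by (rule mult_mono[OF M_norm_le[OF x] M_norm_le[OF z]]) simp_all
      finally show ?thesis using False by (simp add: power2_eq_square)
    qed simp
  qed (simp_all add: F2 bounded_op_compose[OF M_op A] A1 A2)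
  have \<Delta>_op: "bounded_op (fock_on D2) (fock_on D2) ?\<Delta>" by (rule op_sqrt_op) simp
  have Q_op: "bounded_op (fock_on D2) UNIV ?Q"
    by (rule bounded_op_compose[OF unitary_bounded[OF U2_un]
          bounded_op_diff_op[OF bounded_op_subset[OF bounded_op_ident order_refl]
            bounded_op_subset[OF bounded_op_proj order_refl]]]) simp_all
  have norm_\<Delta>: "norm (?\<Delta> x) = norm (?Q x)" if x: "x \<in> fock_on D2" for x
  proof -
    have "cinner (?\<Delta> x) (?\<Delta> x) = cinner (?S x) x" by (rule op_sqrt_cinner) (simp_all add: x)
    then have "(norm (?\<Delta> x))\<^sup>2 = (norm x)\<^sup>2 - (norm (M x))\<^sup>2"
      by (simp add: norm_sq_cinner cinner_diff_left A1[OF x x])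
    also have "\<dots> = (norm (?Q x))\<^sup>2"
      using proj_pythagoras[of S "U2 x"] by (simp add: M_norm[OF x] unitary_norm[OF U2_un x])
    finally show ?thesis by simp
  qed
  have dist_\<Delta>: "dist (?\<Delta> y) (?\<Delta> x) = dist (?Q y) (?Q x)" if "x \<in> fock_on D2" "y \<in> N" for x y
  proof -
    have y: "y \<in> fock_on D2" using that(2) N_subset by blast
    have "?\<Delta> y - ?\<Delta> x = ?\<Delta> (y - x)" "?Q y - ?Q x = ?Q (y - x)"
      using bounded_op_diff[OF \<Delta>_op F2_sub y that(1)] bounded_op_diff[OF Q_op F2_sub y that(1)] by simp_all
    then show ?thesis unfolding dist_norm using norm_\<Delta>[OF csubspace_diff[OF F2_sub y that(1)]] by simp
  qed
  have "szego_condition D2 D1 M \<longleftrightarrow> closure (?\<Delta> ` fock_on D2) = closure (?\<Delta> ` N)"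
    by (simp add: szego_condition_def M_contractive N_def Let_def)
  also have "\<dots> \<longleftrightarrow> ?\<Delta> ` fock_on D2 \<subseteq> closure (?\<Delta> ` N)"
  proof
    assume "closure (?\<Delta> ` fock_on D2) = closure (?\<Delta> ` N)"
    then show "?\<Delta> ` fock_on D2 \<subseteq> closure (?\<Delta> ` N)" using closure_subset[of "?\<Delta> ` fock_on D2"] by simp
  next
    assume "?\<Delta> ` fock_on D2 \<subseteq> closure (?\<Delta> ` N)"
    then show "closure (?\<Delta> ` fock_on D2) = closure (?\<Delta> ` N)"
      by (intro subset_antisym closure_minimal closed_closure closure_mono image_mono N_subset)
  qed
  also have "\<dots> \<longleftrightarrow> (\<forall>x\<in>fock_on D2. ?Q x \<in> closure (?Q ` N))"
    by (simp add: image_subset_iff closure_approachable dist_\<Delta>)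
  finally show ?thesis .
qed

lemma cinner_U2_N:
  assumes r: "r \<in> K" "\<And>j x. x \<in> K \<Longrightarrow> cinner (V j x) r = 0" and y: "y \<in> N"
  shows "cinner (U2 y) r = 0"
proof -
  \<comment> \<open>Subtracting the vacuum part gives a bounded operator on the whole Fock space
    that can be tested on elementary tensors; on N it agrees with U2.\<close>
  let ?f = "\<lambda>x. U2 x - u2 (coord x [])"
  have c: "bounded_op (fock_on D2) D2 (\<lambda>x :: ('b, 'h) fock. coord x [])"
    by (rule bounded_opI[where b = 1]) (simp_all add: fock_on_def norm_coord_le)
  have f: "bounded_op (fock_on D2) UNIV ?f"
    by (rule bounded_op_diff_op[OF bounded_op_subset[OF unitary_bounded[OF U2_un] order_refl]
          bounded_op_subset[OF bounded_op_compose[OF c unitary_bounded[OF u2]] order_refl]]) simp_all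
  let ?S = "(\<lambda>(\<alpha>, h). single \<alpha> h) ` (UNIV \<times> D2) :: ('b, 'h) fock set"
  have "?f y \<in> orth {r}"
  proof (rule bounded_op_closed_cspan_in[where f = ?f, OF f F2])
    show "?S \<subseteq> fock_on D2" using single_in_fock_on[OF D2_sub] by auto
    show "y \<in> closed_cspan ?S" using subsetD[OF N_subset y] unfolding fock_on_cspan[OF D2] .
    show "?f s \<in> orth {r}" if s: "s \<in> ?S" for s
    proof -
      obtain \<alpha> h where h: "h \<in> D2" "s = single \<alpha> h" using s by auto
      have uh: "u2 h \<in> K" using unitary_in[OF u2 h(1)] L2(2) by blast
      show ?thesis
      proof (cases \<alpha>)
        case Nil
        then show ?thesis using fock_ext_single[OF U2 D2_sub h(1), of "[]"]
          by (simp add: h(2) coord_single orth_def)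
      next
        case (Cons j \<beta>)
        then show ?thesis using r(2)[OF word_in[OF uh, of \<beta>], of j] bounded_op_zero[OF unitary_bounded[OF u2] csubspace_zero[OF D2_sub]]
          by (simp add: h fock_ext_single[OF U2 D2_sub h(1)] coord_single orth_def)
      qed
    qed
  qed simp
  then show ?thesis
    using y bounded_op_zero[OF unitary_bounded[OF u2] csubspace_zero[OF D2_sub]] by (simp add: orth_def in_N_iff)
qed

lemma single_in_N: "h \<in> D2 \<Longrightarrow> single (j # \<alpha>) h \<in> N"
  by (simp add: in_N_iff single_in_fock_on[OF D2_sub] coord_single)

end

subsection \<open>Isometric dilations\<close>

text \<open>A dilation in which \<open>V\<^sub>j\<^sup>*\<close> leaves the space of \<open>T\<close> invariant and restricts to \<open>T\<^sub>j\<^sup>*\<close> there;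
  this is automatic for minimal dilations and also holds for \<open>C\<close> in the dilation of a lifting.\<close>

locale coinv_dilation = row_contr T + row_iso K V
  for T :: "'d::finite \<Rightarrow> 'h::chilbert_space \<Rightarrow> 'h" and K :: "'k::chilbert_space set"
    and V :: "'d \<Rightarrow> 'k \<Rightarrow> 'k" +
  fixes J :: "'h \<Rightarrow> 'k"
  assumes J: "unitary_op UNIV (range J) J" and J_subset: "range J \<subseteq> K"
    and coinv: "\<And>j x h. x \<in> K \<Longrightarrow> cinner (V j x) (J h) = cinner x (J (adj UNIV UNIV (T j) h))"
begin

abbreviation H :: "'k set" where "H \<equiv> range J"
abbreviation L :: "'k set" where "L \<equiv> wandering V H"

lemma J_in: "J h \<in> K" using J_subset by blast

lemma J_cinner: "cinner (J h) (J k) = cinner h k" by (rule unitary_cinner[OF J]) simp_all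

lemma J_op: "bounded_op UNIV H J" by (rule unitary_bounded[OF J])

lemma J_add: "J (h + k) = J h + J k" by (rule bounded_op_add[OF J_op]) simp_all

lemma J_zero: "J 0 = 0" by (rule bounded_op_zero[OF J_op]) simp

lemma J_sum: "J (\<Sum>i\<in>I. f i) = (\<Sum>i\<in>I. J (f i))" by (rule bounded_op_sum[OF J_op]) simp_all

lemma H_closed: "closed_csubspace H" by (rule unitary_closed_csubspace[OF J closed_csubspace_UNIV])

lemma coinv': "x \<in> K \<Longrightarrow> cinner (J h) (V j x) = cinner (J (adj UNIV UNIV (T j) h)) x"
  using coinv[of x j h] cinner_commute[of "J h" "V j x"] cinner_commute[of _ x] by simp

definition VJ :: "'h ^ 'd \<Rightarrow> 'k" where "VJ \<xi> = (\<Sum>i\<in>UNIV. V i (J (\<xi> $ i)))"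

text \<open>The image of D_T \<xi> under the canonical unitary, written without the square
  root.\<close>

definition canon_vec :: "'h ^ 'd \<Rightarrow> 'k" where "canon_vec \<xi> = VJ \<xi> - J (row_op T \<xi>)"

lemma canon_vec_sum: "(\<Sum>i\<in>UNIV. V i (J (\<xi> $ i)) - J (T i (\<xi> $ i))) = canon_vec \<xi>"
  by (simp add: canon_vec_def VJ_def row_op_def J_sum sum_subtractf)

lemma VJ_in: "VJ \<xi> \<in> K"
  unfolding VJ_def by (intro csubspace_sum[OF K_sub] V_in J_in)

lemma canon_vec_in: "canon_vec \<xi> \<in> K"
  unfolding canon_vec_def by (intro csubspace_diff[OF K_sub] VJ_in J_in)

lemma V_VJ_cinner: "x \<in> K \<Longrightarrow> cinner (V j x) (VJ \<xi>) = cinner x (J (\<xi> $ j))"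
proof -
  assume x: "x \<in> K"
  have "cinner (V j x) (VJ \<xi>) = (\<Sum>i\<in>UNIV. if j = i then cinner x (J (\<xi> $ i)) else 0)"
    unfolding VJ_def cinner_sum_right by (intro sum.cong refl V_cinner x J_in)
  then show ?thesis by simp
qed

lemma VJ_cinner: "cinner (VJ \<xi>) (VJ \<eta>) = cinner \<xi> \<eta>"
proof -
  have "cinner (VJ \<xi>) (VJ \<eta>) = (\<Sum>i\<in>UNIV. cinner (V i (J (\<xi> $ i))) (VJ \<eta>))"
    by (simp only: VJ_def[of \<xi>] cinner_sum_left)
  then show ?thesis by (simp add: V_VJ_cinner J_in J_cinner cinner_vec)
qed

lemma VJ_J_cinner: "cinner (VJ \<xi>) (J k) = cinner (row_op T \<xi>) k"
  by (simp add: VJ_def cinner_sum_left coinv J_in J_cinner row_op_def T_adj)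

lemma J_VJ_cinner: "cinner (J k) (VJ \<xi>) = cinner k (row_op T \<xi>)"
  using VJ_J_cinner[of \<xi> k] cinner_commute[of "J k" "VJ \<xi>"] cinner_commute[of k "row_op T \<xi>"] by simp

lemma canon_vec_cinner:
  "cinner (canon_vec \<xi>) (canon_vec \<eta>) = cinner (defect_op T \<xi>) (defect_op T \<eta>)"
  by (simp add: canon_vec_def cinner_diff_left cinner_diff_right VJ_cinner VJ_J_cinner J_VJ_cinner
      J_cinner defect_cinner)

lemma canon_vec_J: "cinner (canon_vec \<xi>) (J k) = 0"
  by (simp add: canon_vec_def cinner_diff_left VJ_J_cinner J_cinner)

lemma canon_vec_axis: "canon_vec (axis j h) = V j (J h) - J (T j h)"
proof -
  have T0: "T i 0 = 0" for i by (rule bounded_op_zero[OF bounded]) simp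
  have V0: "V i 0 = 0" for i by (rule bounded_op_zero[OF V_op csubspace_zero[OF K_sub]])
  have "V i (J (axis j h $ i)) = (if i = j then V j (J h) else 0)"
    "T i (axis j h $ i) = (if i = j then T j h else 0)" for i
    by (simp_all add: axis_def J_zero T0 V0)
  then show ?thesis by (simp add: canon_vec_def VJ_def row_op_def)
qed

text \<open>Modulo H, the vector V_j J h equals the canonical vector of the column with single entry
  h at j. So a vector orthogonal to H and to all canonical vectors is orthogonal to every generator
  of the span.\<close>

lemma L_eq: "L = closed_cspan (range canon_vec)"
proof -
  let ?G = "H \<union> (\<Union>j. V j ` H)"
  have *: "L = closed_cspan ?G \<inter> orth H" by (simp add: wandering_def orth_diff_eq)
  have "closed_cspan (range canon_vec) = closed_cspan ?G \<inter> orth H"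
  proof (rule orth_eq_0)
    show "csubspace (closed_cspan ?G \<inter> orth H)"
      by (rule closed_csubspace_imp[OF closed_csubspace_Int]) simp_all
    show "closed_cspan (range canon_vec) \<subseteq> closed_cspan ?G \<inter> orth H"
    proof (rule closed_cspan_minimal[OF image_subsetI closed_csubspace_Int])
      fix \<xi>
      have "VJ \<xi> \<in> closed_cspan ?G"
        unfolding VJ_def by (intro cc_sum[OF closed_csubspace_closed_cspan] closed_cspan_base) blast
      moreover have "J (row_op T \<xi>) \<in> closed_cspan ?G" by (intro closed_cspan_base) blast
      ultimately have "canon_vec \<xi> \<in> closed_cspan ?G"
        unfolding canon_vec_def by (rule cc_diff[OF closed_csubspace_closed_cspan])
      moreover have "canon_vec \<xi> \<in> orth H" by (rule orthI) (auto simp: canon_vec_J)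
      ultimately show "canon_vec \<xi> \<in> closed_cspan ?G \<inter> orth H" by simp
    qed simp_all
    fix x assume x: "x \<in> closed_cspan ?G \<inter> orth H" and o: "x \<in> orth (closed_cspan (range canon_vec))"
    have xJ: "cinner x (J h) = 0" for h using x orthD[of x H "J h"] by simp
    have "cinner x (V j (J h)) = 0" for j h
    proof -
      have "cinner x (canon_vec (axis j h)) = 0" by (rule orthD[OF o closed_cspan_base]) simp
      then show ?thesis by (simp add: canon_vec_axis cinner_diff_right xJ)
    qed
    then have "x \<in> orth ?G" using xJ by (auto simp: orth_def)
    then have "x \<in> orth (closed_cspan ?G)" by (simp only: orth_closed_cspan)
    then have "cinner x x = 0" using x orthD by blast
    then show "x = 0" by simp
  qed simp
  then show ?thesis using * by simp
qed

lemma L_closed: "closed_csubspace L" by (simp add: L_eq)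

lemma L_subset: "L \<subseteq> K"
  unfolding L_eq by (rule closed_cspan_minimal[OF _ K]) (auto simp: canon_vec_in)

lemma L_orth_H: "L \<subseteq> orth H"
  by (auto simp: wandering_def orth_diff_eq)

lemma V_orth_H:
  assumes x: "x \<in> K" "x \<in> orth H" shows "V j x \<in> orth H"
  by (rule orthI) (auto simp: coinv[OF x(1)] orthD[OF x(2)])

text \<open>Pairing V_j x with a canonical vector moves V_j off x: both terms become pairings of x
  with vectors of H.\<close>

lemma V_orth_L:
  assumes x: "x \<in> K" "x \<in> orth H" and l: "l \<in> L" shows "cinner (V j x) l = 0"
proof -
  have "range canon_vec \<subseteq> orth {V j x}"
  proof (rule image_subsetI)
    fix \<xi>
    have "cinner (V j x) (canon_vec \<xi>) = 0"
      by (simp add: canon_vec_def cinner_diff_right V_VJ_cinner[OF x(1)] coinv[OF x(1)] orthD[OF x(2)])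
    then show "canon_vec \<xi> \<in> orth {V j x}" by (simp add: orth_def cinner_eq_zero_commute[of _ "V j x"])
  qed
  then have "L \<subseteq> orth {V j x}" unfolding L_eq by (rule closed_cspan_minimal) simp
  then have "l \<in> orth {V j x}" using l by blast
  then show ?thesis by (rule orthD') simp
qed

lemma word_orth_H: "x \<in> K \<Longrightarrow> x \<in> orth H \<Longrightarrow> word_op V \<alpha> x \<in> orth H"
  by (induction \<alpha>) (simp_all add: V_orth_H word_in)

end

sublocale coinv_dilation \<subseteq> wand: wandering_subspace K V L
proof
  show "closed_csubspace L" by (rule L_closed)
  show "L \<subseteq> K" by (rule L_subset)
  show "cinner (word_op V (j # \<alpha>) l) l' = 0" if "l \<in> L" "l' \<in> L" for j \<alpha> l l'
  proof -
    have l: "l \<in> K" "l \<in> orth H" using that(1) L_subset L_orth_H by blast+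
    show ?thesis using V_orth_L[OF word_in[OF l(1)] word_orth_H[OF l] that(2)] by simp
  qed
qed

context coinv_dilation
begin

abbreviation S :: "'k set" where "S \<equiv> shift_space V L"

lemma S_orth_H: "S \<subseteq> orth H"
proof -
  have "closed_csubspace (K \<inter> orth H)" by (simp add: closed_csubspace_Int K)
  then have "S \<subseteq> K \<inter> orth H"
    by (rule shift_space_least) (use V_orth_H V_in L_subset L_orth_H in auto)
  then show ?thesis by simp
qed

text \<open>V_j J h is J (T_j h) plus a vector of L, so the span of H and S is invariant and
  contains all that is generated from H.\<close>

lemma V_cspan_HS:
  assumes x: "x \<in> closed_cspan (H \<union> S)" shows "V j x \<in> closed_cspan (H \<union> S)"
proof (rule bounded_op_closed_cspan_in[where f = "V j", OF V_op K _ _ _ x])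
  show "H \<union> S \<subseteq> K" using J_subset wand.S_subset by blast
  show "V j s \<in> closed_cspan (H \<union> S)" if s: "s \<in> H \<union> S" for s
  proof (cases "s \<in> S")
    case True
    then show ?thesis using V_shift_space[OF L_subset, of s j] by (intro closed_cspan_base) simp
  next
    case False
    then obtain h where h: "s = J h" using s by blast
    have "canon_vec (axis j h) \<in> L" unfolding L_eq by (rule closed_cspan_base) simp
    then have "canon_vec (axis j h) \<in> S" using subset_shift_space[of L] by blast
    then have "J (T j h) + canon_vec (axis j h) \<in> closed_cspan (H \<union> S)"
      by (intro cc_add[OF closed_csubspace_closed_cspan] closed_cspan_base) simp_all
    then show ?thesis by (simp add: h canon_vec_axis)
  qed
qed simp

lemma shift_H_subset: "shift_space V H \<subseteq> closed_cspan (H \<union> S)"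
  by (rule shift_space_least[OF closed_csubspace_closed_cspan V_cspan_HS])
    (simp_all add: closed_cspan_base subsetI)

text \<open>The vectors D_T \<xi> and \<open>canon_vec \<xi>\<close> have equal inner products, so a
  unitary as demanded by the choice exists.\<close>

lemma canon_unitary: "unitary_op (defect_space T) L (canon T V J)"
proof -
  have "\<exists>W. unitary_op (closed_cspan (range (defect_op T))) (closed_cspan (range canon_vec)) W
      \<and> (\<forall>\<xi>\<in>UNIV. W (defect_op T \<xi>) = canon_vec \<xi>)"
    by (rule unitary_of_equal_gram) (rule canon_vec_cinner[symmetric])
  then have "\<exists>u. unitary_op (defect_space T) L u \<and>
      (\<forall>\<xi>. u (defect_op T \<xi>) = (\<Sum>i\<in>UNIV. V i (J (\<xi> $ i)) - J (T i (\<xi> $ i))))"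
    by (simp only: canon_vec_sum L_eq defect_space_cspan) simp
  from someI_ex[OF this] have "unitary_op (defect_space T) L (canon T V J) \<and>
      (\<forall>\<xi>. canon T V J (defect_op T \<xi>) = (\<Sum>i\<in>UNIV. V i (J (\<xi> $ i)) - J (T i (\<xi> $ i))))"
    unfolding canon_def .
  then show ?thesis by (rule conjunct1)
qed

lemma canon_K_ext: "fock_ext V (defect_space T) S (canon T V J) (canon_K T V J)"
  using someI_ex[OF wand.fock_ext_exists[OF canon_unitary closed_defect_space]]
  unfolding canon_K_def fock_ext_def .

end

section \<open>Minimal dilations: the decomposition K = H + S and the space of vectors annihilated
  by all V_j^*\<close>

locale min_dilation = coinv_dilation +
  assumes minimal: "inv_hull K V (range J) = K"
begin

lemma K_eq: "K = shift_space V H"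
  using minimal inv_hull_eq_shift_space[OF J_subset] by simp

lemma orth_words_eq_0:
  assumes x: "x \<in> K" "\<And>\<alpha> h. cinner x (word_op V \<alpha> (J h)) = 0" shows "x = 0"
proof -
  have "x \<in> orth (shift_space V H)" using x(2) by (auto simp: orth_shift_space)
  then have "x \<in> orth K" using K_eq by simp
  from orthD[OF this x(1)] show ?thesis by simp
qed

text \<open>The span of H and S is invariant and contains H, so by minimality it is K. Hence the
  space of T can be recovered as the complement of S.\<close>

lemma orth_H_S_eq_0:
  assumes x: "x \<in> K" "x \<in> orth H" "x \<in> orth S" shows "x = 0"
proof -
  have "x \<in> orth (closed_cspan (H \<union> S))"
    unfolding orth_closed_cspan using x(2,3) by (auto simp: orth_def)
  moreover have "x \<in> closed_cspan (H \<union> S)" using x(1) shift_H_subset K_eq by blast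
  ultimately have "cinner x x = 0" by (rule orthD)
  then show ?thesis by simp
qed

lemma orth_S_in_H:
  assumes x: "x \<in> K" "x \<in> orth S" shows "x \<in> H"
proof -
  have p: "proj H x \<in> H" by (rule proj_in[OF H_closed])
  have "x - proj H x = 0"
  proof (rule orth_H_S_eq_0)
    show "x - proj H x \<in> K" using csubspace_diff[OF K_sub x(1)] p J_subset by blast
    show "x - proj H x \<in> orth H" by (intro orthI proj_orth[OF H_closed])
    have "proj H x \<in> orth S"
    proof (rule orthI)
      fix s assume "s \<in> S"
      then show "cinner (proj H x) s = 0" using orthD'[OF subsetD[OF S_orth_H] p] by simp
    qed
    then show "x - proj H x \<in> orth S" by (rule cc_diff[OF closed_csubspace_orth x(2)])
  qed
  then show ?thesis using p by simp
qed

definition star_canon_vec :: "'b \<Rightarrow> 'c" where "star_canon_vec h = J h - VJ (star_vec T h)"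

abbreviation L_star :: "'c set" where "L_star \<equiv> star_wandering K V"

lemma star_canon_vec_sum: "J h - (\<Sum>i\<in>UNIV. V i (J (adj UNIV UNIV (T i) h))) = star_canon_vec h"
  by (simp add: star_canon_vec_def VJ_def)

lemma V_star_canon_vec: "x \<in> K \<Longrightarrow> cinner (V j x) (star_canon_vec h) = 0"
  by (simp add: star_canon_vec_def cinner_diff_right coinv V_VJ_cinner)

lemma star_canon_vec_in: "star_canon_vec h \<in> K"
  unfolding star_canon_vec_def by (intro csubspace_diff[OF K_sub] J_in VJ_in)

lemma star_canon_vec_cinner:
  "cinner (star_canon_vec h) (star_canon_vec k) = cinner (star_defect_op T h) (star_defect_op T k)"
  by (simp add: star_canon_vec_def cinner_diff_left cinner_diff_right VJ_cinner VJ_J_cinner J_VJ_cinner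
      J_cinner star_defect_cinner row_op_cinner star_vec_cinner)

lemma L_star_iff: "x \<in> L_star \<longleftrightarrow> x \<in> K \<and> (\<forall>j. \<forall>y\<in>K. cinner (V j y) x = 0)"
proof -
  have "adj K K (V j) x = 0 \<longleftrightarrow> (\<forall>y\<in>K. cinner (V j y) x = 0)" if x: "x \<in> K" for j
  proof
    assume "adj K K (V j) x = 0"
    then show "\<forall>y\<in>K. cinner (V j y) x = 0" using adj_cinner[OF K K_sub V_op _ x, of _ j] by auto
  next
    assume *: "\<forall>y\<in>K. cinner (V j y) x = 0"
    show "adj K K (V j) x = 0"
      by (rule adj_eqI[OF K K_sub V_op x csubspace_zero[OF K_sub]]) (simp add: *)
  qed
  then show ?thesis by (auto simp: star_wandering_def)
qed

text \<open>Nonempty words lie in the ranges of the V_j, so only orthogonality to J h has to be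
  tested, and J h differs from \<open>star_canon_vec h\<close> by a sum of vectors in those
  ranges.\<close>

lemma L_star_eq: "L_star = closed_cspan (range star_canon_vec)"
proof -
  have eq: "L_star = K \<inter> orth (\<Union>j. V j ` K)"
    by (auto simp: L_star_iff orth_def cinner_eq_zero_commute)
  have "closed_cspan (range star_canon_vec) = L_star"
  proof (rule orth_eq_0)
    have cl: "closed_csubspace L_star" unfolding eq by (rule closed_csubspace_Int[OF K]) simp
    then show "csubspace L_star" by (rule closed_csubspace_imp)
    show "closed_cspan (range star_canon_vec) \<subseteq> L_star"
      by (rule closed_cspan_minimal[OF _ cl]) (auto simp: L_star_iff star_canon_vec_in V_star_canon_vec)
    fix x assume x: "x \<in> L_star" and o: "x \<in> orth (closed_cspan (range star_canon_vec))"
    have xK: "x \<in> K" and xV: "\<And>j y. y \<in> K \<Longrightarrow> cinner x (V j y) = 0"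
      using x by (auto simp: L_star_iff cinner_eq_zero_commute[of x])
    show "x = 0"
    proof (rule orth_words_eq_0[OF xK])
      fix \<alpha> h
      show "cinner x (word_op V \<alpha> (J h)) = 0"
      proof (cases \<alpha>)
        case Nil
        have "cinner x (star_canon_vec h) = 0" by (rule orthD[OF o closed_cspan_base]) simp
        moreover have "cinner x (VJ \<xi>) = 0" for \<xi> by (simp add: VJ_def cinner_sum_right xV J_in)
        ultimately show ?thesis by (simp add: Nil star_canon_vec_def cinner_diff_right)
      next
        case (Cons j \<beta>)
        then show ?thesis by (simp add: xV word_in J_in)
      qed
    qed
  qed simp
  then show ?thesis by simp
qed

end

sublocale min_dilation \<subseteq> star: wandering_subspace K V L_star
proof
  show "closed_csubspace L_star" by (simp add: L_star_eq)
  show "L_star \<subseteq> K" by (auto simp: L_star_iff)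
  show "cinner (word_op V (j # \<alpha>) l) l' = 0" if "l \<in> L_star" "l' \<in> L_star" for j \<alpha> l l'
    using that by (simp add: L_star_iff word_in)
qed

context min_dilation
begin

abbreviation S_star :: "'c set" where "S_star \<equiv> shift_space V L_star"

lemma star_canon_unitary: "unitary_op (star_defect_space T) L_star (star_canon T K V J)"
proof -
  have "\<exists>W. unitary_op (closed_cspan (range (star_defect_op T))) (closed_cspan (range star_canon_vec)) W
      \<and> (\<forall>h\<in>UNIV. W (star_defect_op T h) = star_canon_vec h)"
    by (rule unitary_of_equal_gram) (rule star_canon_vec_cinner[symmetric])
  then have "\<exists>u. unitary_op (star_defect_space T) L_star u \<and>
      (\<forall>h. u (star_defect_op T h) = J h - (\<Sum>i\<in>UNIV. V i (J (adj UNIV UNIV (T i) h))))"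
    by (simp only: star_canon_vec_sum L_star_eq star_defect_space_cspan) simp
  from someI_ex[OF this] have "unitary_op (star_defect_space T) L_star (star_canon T K V J) \<and>
      (\<forall>h. star_canon T K V J (star_defect_op T h) = J h - (\<Sum>i\<in>UNIV. V i (J (adj UNIV UNIV (T i) h))))"
    unfolding star_canon_def .
  then show ?thesis by (rule conjunct1)
qed

lemma star_canon_K_ext:
  "fock_ext V (star_defect_space T) S_star (star_canon T K V J) (star_canon_K T K V J)"
  using someI_ex[OF star.fock_ext_exists[OF star_canon_unitary closed_star_defect_space]]
  unfolding star_canon_K_def fock_ext_def .

end

sublocale min_dilation \<subseteq> char: compression K V L_star "star_defect_space T" "star_canon T K V J"
  "star_canon_K T K V J" "defect_space T" L "canon T V J" "canon_K T V J"
proof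
  show "cinner (V j y) l = 0" if "y \<in> S" "l \<in> L_star" for j y l
    using that wand.S_subset by (auto simp: L_star_iff)
qed (simp_all add: closed_star_defect_space closed_defect_space L_closed L_subset star_canon_unitary
    canon_unitary star_canon_K_ext canon_K_ext)

lemma (in min_dilation) char_fun_eq: "char_fun T K V J = char.M"
  by (rule ext) (simp add: char_fun_def char.M_def Let_def)

text \<open>The point is that V_j^* restricts to T_j^* on the space of T. For x = V_\<alpha> J k
  both sides equal <T_j T_\<alpha> k, h> by the dilation property, and minimality makes these
  vectors total.\<close>

lemma min_dilationI:
  fixes T :: "'d::finite \<Rightarrow> 'h::chilbert_space \<Rightarrow> 'h" and K :: "'k::chilbert_space set"
  assumes T: "row_contraction T" and dil: "minimal_isometric_dilation T K V J"
  shows "min_dilation T K V J"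
proof -
  have d: "isometric_dilation T K V J" and hull: "inv_hull K V (range J) = K"
    using dil by (simp_all add: minimal_isometric_dilation_def)
  have K: "closed_csubspace K" "row_isometry_on K V" and J: "unitary_op UNIV (range J) J" "range J \<subseteq> K"
    and comp: "\<And>\<alpha> h. J (word_op T \<alpha> h) = proj (range J) (word_op V \<alpha> (J h))"
    using d by (simp_all add: isometric_dilation_def)
  interpret row_contr T by unfold_locales (rule T)
  interpret row_iso K V by unfold_locales (rule K)+
  have H: "closed_csubspace (range J)" by (rule unitary_closed_csubspace[OF J(1) closed_csubspace_UNIV])
  have word_J: "cinner (word_op V \<alpha> (J h)) (J k) = cinner (word_op T \<alpha> h) k" for \<alpha> h k
  proof -
    have "cinner (word_op V \<alpha> (J h)) (J k) = cinner (J (word_op T \<alpha> h)) (J k)"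
      unfolding comp by (rule proj_cinner[OF H, symmetric]) simp
    then show ?thesis by (simp add: unitary_cinner[OF J(1)])
  qed
  have "cinner (V j x) (J h) = cinner x (J (adj UNIV UNIV (T j) h))" if x: "x \<in> K" for j x h
  proof -
    let ?f = "\<lambda>x. cinner (V j x) (J h)" and ?g = "\<lambda>x. cinner x (J (adj UNIV UNIV (T j) h))"
    have cb: "bounded_op UNIV UNIV (\<lambda>x. cinner x y)" for y :: 'k
      by (rule bounded_opI[where b = "norm y"])
        (simp_all add: cinner_add_left cinner_scaleC_left scaleC_complex_def
          order_trans[OF cmod_cinner_le] mult.commute)
    have f: "bounded_op K UNIV ?f"
      by (rule bounded_op_compose[OF V_op bounded_op_subset[OF cb]]) simp_all
    have g: "bounded_op K UNIV ?g" by (rule bounded_op_subset[OF cb]) simp_all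
    have "x \<in> closed_cspan (\<Union>\<alpha>. word_op V \<alpha> ` range J)"
      using x hull inv_hull_eq_shift_space[OF J(2)] by (simp add: shift_space_def)
    then show ?thesis
    proof (rule bounded_op_eq_on_closed_cspan[where f = ?f and g = ?g, OF f g K(1), rotated 2])
      show "(\<Union>\<alpha>. word_op V \<alpha> ` range J) \<subseteq> K" using J(2) word_in by blast
      fix s assume "s \<in> (\<Union>\<alpha>. word_op V \<alpha> ` range J)"
      then obtain \<alpha> k where s: "s = word_op V \<alpha> (J k)" by blast
      show "?f s = ?g s" using word_J[of "j # \<alpha>" k h] by (simp add: s word_J T_adj)
    qed
  qed
  then show ?thesis by unfold_locales (use J hull in auto)
qed

text \<open>Applied with W the identity to compare M_{C,E} with M_{\<Theta>_A}, and with a unitary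
  between dilation spaces to obtain coincidence.\<close>

lemma compression_transfer:
  fixes K :: "'k::chilbert_space set" and K' :: "'l::chilbert_space set" and V :: "'d::finite \<Rightarrow> 'k \<Rightarrow> 'k"
    and D1 :: "'g::chilbert_space set" and D2 :: "'h::chilbert_space set"
    and D1' :: "'g2::chilbert_space set" and D2' :: "'h2::chilbert_space set"
  assumes a: "compression K V L D1 u1 U1 D2 L2 u2 U2" and b: "compression K' V' L' D1' u1' U1' D2' L2' u2' U2'"
    and W: "unitary_op X Y W" and X: "csubspace X" "shift_space V L \<subseteq> X" "shift_space V L2 \<subseteq> X"
    and WV: "\<And>j x. x \<in> X \<Longrightarrow> W (V j x) = V' j (W x)" and WS: "W ` shift_space V L = shift_space V' L'"
    and v1: "bounded_op D1 D1' v1" "\<And>\<delta>. \<delta> \<in> D1 \<Longrightarrow> u1' (v1 \<delta>) = W (u1 \<delta>)"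
    and v2: "bounded_op D2 D2' v2" "\<And>\<delta>. \<delta> \<in> D2 \<Longrightarrow> u2' (v2 \<delta>) = W (u2 \<delta>)"
    and x: "x \<in> fock_on D2"
  shows "adj (fock_on D1') (shift_space V' L') U1' (proj (shift_space V' L') (U2' (id_tensor v2 x)))
    = id_tensor v1 (adj (fock_on D1) (shift_space V L) U1 (proj (shift_space V L) (U2 x)))"
proof -
  interpret a: compression K V L D1 u1 U1 D2 L2 u2 U2 by (rule a)
  interpret b: compression K' V' L' D1' u1' U1' D2' L2' u2' U2' by (rule b)
  have Wb: "bounded_op Z UNIV W" if "Z \<subseteq> X" for Z
    by (rule bounded_op_subset[OF unitary_bounded[OF W] that]) simp
  have t1: "U1' (id_tensor v1 y) = W (U1 y)" if "y \<in> fock_on D1" for y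
    by (rule fock_ext_transfer[OF a.U1 b.U1 a.D1 b.D1_sub Wb[OF X(2)] v1(1) _ v1(2) that])
      (use WV X(2) in blast)
  have t2: "U2' (id_tensor v2 x) = W (U2 x)"
    by (rule fock_ext_transfer[OF a.U2 b.U2 a.D2 b.D2_sub Wb[OF X(3)] v2(1) _ v2(2) x])
      (use WV X(3) in blast)
  have Mx: "a.M x \<in> fock_on D1" by (rule bounded_op_in[OF a.M_op x])
  have ix: "id_tensor v2 x \<in> fock_on D2'" by (rule bounded_op_in[OF bounded_op_id_tensor[OF v2(1) a.D2_sub] x])
  have "U1' (b.M (id_tensor v2 x)) = proj (W ` shift_space V L) (W (U2 x))"
    by (simp only: b.U1_M t2 WS)
  also have "\<dots> = W (proj (shift_space V L) (U2 x))"
    by (rule proj_unitary_image[OF W X(1) a.closed_shift_space X(2)]) (use unitary_in[OF a.U2_un x] X(3) in blast)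
  also have "\<dots> = U1' (id_tensor v1 (a.M x))" by (simp only: t1[OF Mx] a.U1_M)
  finally have "b.M (id_tensor v2 x) = id_tensor v1 (a.M x)"
    by (rule inj_onD[OF unitary_inj_on[OF b.U1_un b.F1_sub] _ bounded_op_in[OF b.M_op ix]
          bounded_op_in[OF bounded_op_id_tensor[OF v1(1) a.D1_sub] Mx]])
  then show ?thesis by (simp only: a.M_def b.M_def)
qed

lemma (in coinv_dilation) word_J_cinner: "cinner (word_op V \<alpha> (J h)) (J k) = cinner (word_op T \<alpha> h) k"
  by (induction \<alpha> arbitrary: k) (simp_all add: J_cinner coinv word_in J_in T_adj)

text \<open>The span of H and S is the orthogonal sum of H, L and the spaces V_j S; the hypotheses
  exclude every summand except L.\<close>

lemma (in coinv_dilation) in_L_if: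
  assumes x: "x \<in> closed_cspan (H \<union> S)" "x \<in> orth H" and xS: "\<And>j s. s \<in> S \<Longrightarrow> cinner x (V j s) = 0"
  shows "x \<in> L"
proof -
  let ?m = "x - proj L x"
  have p: "proj L x \<in> L" by (rule proj_in[OF L_closed])
  then have pS: "proj L x \<in> S" using subset_shift_space by blast
  have "?m \<in> closed_cspan (H \<union> S)"
    by (rule cc_diff[OF closed_csubspace_closed_cspan x(1) closed_cspan_base]) (simp add: pS)
  moreover have "?m \<in> orth (H \<union> S)"
  proof -
    have "?m \<in> orth H" by (rule cc_diff[OF closed_csubspace_orth x(2) subsetD[OF L_orth_H p]])
    moreover have "?m \<in> orth S"
      unfolding orth_shift_space
    proof (intro CollectI allI ballI)
      fix \<alpha> l assume l: "l \<in> L"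
      show "cinner ?m (word_op V \<alpha> l) = 0"
      proof (cases \<alpha>)
        case Nil
        then show ?thesis using proj_orth[OF L_closed l, of x] by simp
      next
        case (Cons j \<beta>)
        have s: "word_op V \<beta> l \<in> S" by (rule word_in_shift_space[OF l])
        have "cinner (V j (word_op V \<beta> l)) (proj L x) = 0" by (rule wand.V_S_orth_L[OF s p])
        then show ?thesis using xS[OF s, of j] by (simp add: Cons cinner_diff_left cinner_eq_zero_commute)
      qed
    qed
    ultimately show ?thesis by (auto simp: orth_def)
  qed
  then have "?m \<in> orth (closed_cspan (H \<union> S))" by (simp only: orth_closed_cspan)
  ultimately have "cinner ?m ?m = 0" using orthD by blast
  then show ?thesis using p by simp
qed

subsection \<open>Contractive liftings\<close>

lemma row_contractionI:
  fixes T :: "'d::finite \<Rightarrow> 'h::chilbert_space \<Rightarrow> 'h"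
  assumes T: "\<And>j. bounded_op UNIV UNIV (T j)" and le: "\<And>x. norm (star_vec T x) \<le> norm x"
  shows "row_contraction T"
proof -
  interpret bounded_row T by unfold_locales (rule T)
  have "bounded_op UNIV UNIV (\<lambda>x. x - (\<Sum>j\<in>UNIV. T j (adj UNIV UNIV (T j) x)))"
    by (intro bounded_op_diff_op bounded_op_ident bounded_op_sum_op bounded_op_compose[OF adj_op T]) simp_all
  moreover have "cinner (x - (\<Sum>j\<in>UNIV. T j (adj UNIV UNIV (T j) x))) x
      = complex_of_real ((norm x)\<^sup>2 - (norm (star_vec T x))\<^sup>2)" for x
  proof -
    have "(\<Sum>j\<in>UNIV. T j (adj UNIV UNIV (T j) x)) = row_op T (star_vec T x)" by (simp add: row_op_def)
    then show ?thesis by (simp add: cinner_diff_left row_op_cinner cinner_self)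
  qed
  ultimately show ?thesis
    unfolding row_contraction_def positive_op_def using T le
    by (simp add: power_mono)
qed

lemma lifting_apply: "lifting C B A j (c, a) = (C j c, B j c + A j a)"
  by (simp add: lifting_def)

locale lifting_ops =
  fixes C :: "'d::finite \<Rightarrow> 'c::chilbert_space \<Rightarrow> 'c" and B :: "'d \<Rightarrow> 'c \<Rightarrow> 'a::chilbert_space"
    and A :: "'d \<Rightarrow> 'a \<Rightarrow> 'a"
  assumes C_op: "\<And>j. bounded_op UNIV UNIV (C j)" and B_op: "\<And>j. bounded_op UNIV UNIV (B j)"
    and A_op: "\<And>j. bounded_op UNIV UNIV (A j)"
begin

sublocale CR: bounded_row C by unfold_locales (rule C_op)
sublocale BR: bounded_row B by unfold_locales (rule B_op)
sublocale AR: bounded_row A by unfold_locales (rule A_op)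

abbreviation E :: "'d \<Rightarrow> 'c \<times> 'a \<Rightarrow> 'c \<times> 'a" where "E \<equiv> lifting C B A"

lemma B_zero: "B j 0 = 0" by (rule bounded_op_zero[OF B_op]) simp

lemma C_zero: "C j 0 = 0" by (rule bounded_op_zero[OF C_op]) simp

lemma E_op: "bounded_op UNIV UNIV (E j)"
proof -
  obtain b1 where b1: "b1 \<ge> 0" "\<And>x. norm (C j x) \<le> b1 * norm x" using bounded_op_bound[OF C_op] by (metis UNIV_I)
  obtain b2 where b2: "b2 \<ge> 0" "\<And>x. norm (B j x) \<le> b2 * norm x" using bounded_op_bound[OF B_op] by (metis UNIV_I)
  obtain b3 where b3: "b3 \<ge> 0" "\<And>x. norm (A j x) \<le> b3 * norm x" using bounded_op_bound[OF A_op] by (metis UNIV_I)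
  show ?thesis
  proof (rule bounded_opI[where b = "b1 + b2 + b3"])
    fix p :: "'c \<times> 'a"
    obtain c a where p: "p = (c, a)" by (cases p)
    have n: "norm c \<le> norm p" "norm a \<le> norm p" unfolding p by (rule norm_fst_le, rule norm_snd_le)
    have "norm (E j p) \<le> norm (C j c) + norm (B j c + A j a)"
      unfolding p lifting_apply by (rule norm_Pair_le)
    also have "\<dots> \<le> norm (C j c) + norm (B j c) + norm (A j a)"
      using norm_triangle_ineq[of "B j c" "A j a"] by simp
    also have "\<dots> \<le> b1 * norm p + b2 * norm p + b3 * norm p"
      by (intro add_mono order_trans[OF b1(2)] order_trans[OF b2(2)] order_trans[OF b3(2)] mult_left_mono n b1(1) b2(1) b3(1))
    finally show "norm (E j p) \<le> (b1 + b2 + b3) * norm p" by (simp add: distrib_right)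
    show "E j (z *\<^sub>C p) = z *\<^sub>C E j p" for z
      by (simp add: p scaleC_prod_def lifting_apply bounded_op_scaleC[OF C_op] bounded_op_scaleC[OF B_op]
          bounded_op_scaleC[OF A_op] scaleC_add_right)
    show "E j (p + q) = E j p + E j q" for q
      by (cases q) (simp add: p lifting_apply bounded_op_add[OF C_op] bounded_op_add[OF B_op]
          bounded_op_add[OF A_op])
  qed simp
qed

sublocale ER: bounded_row E by unfold_locales (rule E_op)

lemma E_word_op: "bounded_op UNIV UNIV (word_op E \<alpha>)"
  by (rule bounded_op_word) (rule E_op)

lemma adj_E: "adj UNIV UNIV (E j) (c, a)
    = (adj UNIV UNIV (C j) c + adj UNIV UNIV (B j) a, adj UNIV UNIV (A j) a)"
  by (rule adj_eqI[OF closed_csubspace_UNIV csubspace_UNIV E_op])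
    (auto simp: cinner_prod_def lifting_apply cinner_add_left cinner_add_right CR.T_adj BR.T_adj AR.T_adj)

lemma adj_zero: "adj UNIV UNIV (A j) 0 = 0" "adj UNIV UNIV (B j) 0 = 0"
  by (rule bounded_op_zero[OF AR.adj_op] bounded_op_zero[OF BR.adj_op], simp)+

end

section \<open>The dilations of C and A inside the dilation of E\<close>

locale lifting_dilation =
  fixes C :: "'d::finite \<Rightarrow> 'c::chilbert_space \<Rightarrow> 'c" and B :: "'d \<Rightarrow> 'c \<Rightarrow> 'a::chilbert_space"
    and A :: "'d \<Rightarrow> 'a \<Rightarrow> 'a" and K :: "'k::chilbert_space set" and V :: "'d \<Rightarrow> 'k \<Rightarrow> 'k"
    and J :: "'c \<times> 'a \<Rightarrow> 'k"
  assumes C: "row_contraction C" and lift: "minimal_contractive_lifting C B A"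
    and dil: "minimal_isometric_dilation (lifting C B A) K V J"

sublocale lifting_dilation \<subseteq> lifting_ops C B A
  using lift by unfold_locales (simp_all add: minimal_contractive_lifting_def)

sublocale lifting_dilation \<subseteq> Ed: min_dilation E K V J
  using lift by (intro min_dilationI[OF _ dil]) (simp add: minimal_contractive_lifting_def)

context lifting_dilation
begin

text \<open>A_j^* a is the second component of E_j^* (0, a).\<close>

lemma A_contraction: "row_contraction A"
proof (rule row_contractionI[OF A_op])
  fix a
  have "norm (adj UNIV UNIV (A j) a) \<le> norm (adj UNIV UNIV (E j) (0, a))" for j
    unfolding adj_E by (rule norm_snd_le)
  then have "(norm (star_vec A a))\<^sup>2 \<le> (norm (star_vec E (0, a)))\<^sup>2"
    unfolding norm_vec_sq star_vec_nth by (rule sum_mono[OF power_mono]) simp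
  then have "norm (star_vec A a) \<le> norm (star_vec E (0, a))" by (rule power2_le_imp_le) simp
  also have "\<dots> \<le> norm (0 :: 'c, a)" by (rule Ed.star_vec_norm)
  finally show "norm (star_vec A a) \<le> norm a" by (simp add: norm_Pair)
qed

definition JC :: "'c \<Rightarrow> 'k" where "JC = J \<circ> in_C"
definition JA :: "'a \<Rightarrow> 'k" where "JA = J \<circ> in_A"

lemma JC_apply: "JC c = J (c, 0)" and JA_apply: "JA a = J (0, a)"
  by (simp_all add: JC_def JA_def)

lemma J_split: "J (c, a) = JC c + JA a"
  using Ed.J_add[of "(c, 0)" "(0, a)"] by (simp add: JC_apply JA_apply)

lemma JA_orth_JC: "cinner (JA a) (JC c) = 0"
  by (simp add: JC_apply JA_apply Ed.J_cinner cinner_prod_def)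

lemma JC_unitary: "unitary_op UNIV (range JC) JC"
proof (rule unitary_opI)
  fix c d z
  show "JC (c + d) = JC c + JC d" using Ed.J_add[of "(c, 0)" "(d, 0)"] by (simp add: JC_apply)
  show "JC (z *\<^sub>C c) = z *\<^sub>C JC c"
    using bounded_op_scaleC[OF Ed.J_op, of "(c, 0)" z] by (simp add: scaleC_prod_def JC_apply)
  show "cinner (JC c) (JC d) = cinner c d" by (simp add: JC_apply Ed.J_cinner cinner_prod_def)
qed simp

lemma JA_unitary: "unitary_op UNIV (range JA) JA"
proof (rule unitary_opI)
  fix c d z
  show "JA (c + d) = JA c + JA d" using Ed.J_add[of "(0, c)" "(0, d)"] by (simp add: JA_apply)
  show "JA (z *\<^sub>C c) = z *\<^sub>C JA c"
    using bounded_op_scaleC[OF Ed.J_op, of "(0, c)" z] by (simp add: scaleC_prod_def JA_apply)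
  show "cinner (JA c) (JA d) = cinner c d" by (simp add: JA_apply Ed.J_cinner cinner_prod_def)
qed simp

end

text \<open>E_j^* is upper triangular and so leaves the space of C invariant. As a dilation of C, V
  is in general not minimal, hence the weaker locale.\<close>

sublocale lifting_dilation \<subseteq> Cd: coinv_dilation C K V JC
proof
  show "cinner (V j x) (JC c) = cinner x (JC (adj UNIV UNIV (C j) c))" if "x \<in> K" for j x c
    using Ed.coinv[OF that, of j "(c, 0)"] by (simp add: adj_E adj_zero JC_apply)
  show "range JC \<subseteq> K" using Ed.J_in by (auto simp: JC_apply)
qed (rule C, rule JC_unitary)

context lifting_dilation
begin

abbreviation KA :: "'k set" where "KA \<equiv> corner_space K V J"

lemma JA_in: "range JA \<subseteq> K" using Ed.J_in by (auto simp: JA_apply)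

lemma KA_eq: "KA = shift_space V (range JA)"
  unfolding corner_space_def JA_def[symmetric] by (rule Ed.inv_hull_eq_shift_space[OF JA_in])

lemma KA_subset: "KA \<subseteq> K" unfolding KA_eq by (rule Ed.shift_space_subset[OF JA_in])

lemma KA_orth: "KA \<subseteq> orth (range JC)"
proof -
  have "KA \<subseteq> K \<inter> orth (range JC)"
    unfolding KA_eq
  proof (rule Ed.shift_space_least)
    show "closed_csubspace (K \<inter> orth (range JC))" by (simp add: closed_csubspace_Int Ed.K)
    show "V j x \<in> K \<inter> orth (range JC)" if "x \<in> K \<inter> orth (range JC)" for j x
      using that Ed.V_in Cd.V_orth_H by blast
    show "range JA \<subseteq> K \<inter> orth (range JC)"
    proof (intro subsetI IntI orthI)
      fix y z assume "y \<in> range JA" "z \<in> range JC"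
      then show "cinner y z = 0" using JA_orth_JC by blast
    qed (use JA_in in blast)
  qed
  then show ?thesis by simp
qed

lemma KA_row_iso: "row_isometry_on KA V"
  unfolding row_isometry_on_def
proof (intro conjI allI ballI impI)
  show "bounded_op KA KA (V j)" for j
    by (rule bounded_op_subset[OF Ed.V_op KA_subset]) (simp add: KA_eq Ed.V_shift_space[OF JA_in])
  show "norm (V j x) = norm x" if "x \<in> KA" for j x
    using that KA_subset by (intro norm_eq_of_cinner) (auto simp: Ed.V_cinner)
  show "cinner (V i x) (V j y) = 0" if "i \<noteq> j" "x \<in> KA" "y \<in> KA" for i j x y
    using that KA_subset by (simp add: Ed.V_cinner subset_iff)
qed

end

sublocale lifting_dilation \<subseteq> Ad: min_dilation A KA V JA
proof -
  have KA: "closed_csubspace KA" by (simp add: KA_eq)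
  have r: "row_iso KA V" by unfold_locales (rule KA, rule KA_row_iso)
  have sub: "range JA \<subseteq> KA" unfolding KA_eq by (rule Ed.subset_shift_space)
  show "min_dilation A KA V JA"
  proof
    show "row_contraction A" by (rule A_contraction)
    show "closed_csubspace KA" "row_isometry_on KA V" by (rule KA, rule KA_row_iso)
    show "unitary_op UNIV (range JA) JA" by (rule JA_unitary)
    show "range JA \<subseteq> KA" by (rule sub)
    show "inv_hull KA V (range JA) = KA"
      by (simp only: row_iso.inv_hull_eq_shift_space[OF r sub]) (simp only: KA_eq)
    show "cinner (V j x) (JA a) = cinner x (JA (adj UNIV UNIV (A j) a))" if x: "x \<in> KA" for j x a
    proof -
      have xK: "x \<in> K" using x KA_subset by blast
      have "cinner (V j x) (JA a) = cinner x (J (adj UNIV UNIV (E j) (0, a)))"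
        using Ed.coinv[OF xK, of j "(0, a)"] by (simp add: JA_apply)
      also have "\<dots> = cinner x (JC (adj UNIV UNIV (C j) 0 + adj UNIV UNIV (B j) a)) + cinner x (JA (adj UNIV UNIV (A j) a))"
        by (simp only: adj_E J_split cinner_add_right)
      \<comment> \<open>The off-diagonal part B_j^* a lands in the space of C, to which the dilation
        space of A is orthogonal.\<close>
      also have "cinner x (JC (adj UNIV UNIV (C j) 0 + adj UNIV UNIV (B j) a)) = 0"
        by (rule orthD[OF subsetD[OF KA_orth x]]) simp
      finally show ?thesis by simp
    qed
  qed
qed

section \<open>The residual space R and equality of the wandering subspaces\<close>

context lifting_dilation
begin

abbreviation LE :: "'k set" where "LE \<equiv> wandering V (range J)"
abbreviation LC :: "'k set" where "LC \<equiv> wandering V (range JC)"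
abbreviation LA :: "'k set" where "LA \<equiv> wandering V (range JA)"
abbreviation LsA :: "'k set" where "LsA \<equiv> star_wandering KA V"
abbreviation SE :: "'k set" where "SE \<equiv> shift_space V LE"
abbreviation SC :: "'k set" where "SC \<equiv> shift_space V LC"
abbreviation KC :: "'k set" where "KC \<equiv> closed_cspan (range JC \<union> SC)"

definition R :: "'k set" where "R = K \<inter> orth (range JC) \<inter> orth SC"

lemma R_closed: "closed_csubspace R"
  unfolding R_def by (intro closed_csubspace_Int Ed.K closed_csubspace_orth)

lemma R_iff: "r \<in> R \<longleftrightarrow> r \<in> K \<and> r \<in> orth KC"
  unfolding R_def orth_closed_cspan by (auto simp: orth_def)

lemma KC_subset: "KC \<subseteq> K"
  by (rule closed_cspan_minimal[OF _ Ed.K]) (use Cd.J_subset Cd.wand.S_subset in blast)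

lemma V_R: assumes r: "r \<in> R" shows "V j r \<in> R"
proof -
  have r': "r \<in> K" "r \<in> orth (range JC)" "r \<in> orth SC" using r by (simp_all add: R_def)
  have "V j r \<in> orth SC"
    by (rule Cd.wand.V_orth_S[OF r'(1,3)]) (rule Cd.V_orth_L[OF r'(1,2)])
  then show ?thesis using Ed.V_in[OF r'(1)] Cd.V_orth_H[OF r'(1,2)] by (simp add: R_def)
qed

lemma range_J_orth: "x \<in> orth (range JC) \<Longrightarrow> x \<in> orth (range JA) \<Longrightarrow> x \<in> orth (range J)"
  by (auto simp: orth_def J_split cinner_add_right)

text \<open>KC contains all V_\<alpha> applied to the space of C, so J h in R forces h to be
  orthogonal to every E_\<alpha> (c, 0); these vectors are total because the lifting is
  minimal.\<close>

lemma R_inter_range_J: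
  assumes r: "J h \<in> R" shows "h = 0"
proof -
  let ?X = "orth (range (\<lambda>\<alpha>. adj UNIV UNIV (word_op E \<alpha>) h))"
  have X: "k \<in> ?X \<longleftrightarrow> (\<forall>\<alpha>. cinner (word_op E \<alpha> k) h = 0)" for k
    by (simp add: orth_def adj_cinner[OF closed_csubspace_UNIV csubspace_UNIV E_word_op])
  have "inv_hull UNIV E (range in_C) \<subseteq> ?X"
    unfolding inv_hull_def
  proof (rule Inter_lower, intro CollectI conjI allI image_subsetI)
    show "E j k \<in> ?X" if k: "k \<in> ?X" for j k
      unfolding X
    proof
      fix \<alpha>
      show "cinner (word_op E \<alpha> (E j k)) h = 0" using k[unfolded X, rule_format, of "\<alpha> @ [j]"]
        by (simp add: word_op_append)
    qed
    show "in_C c \<in> ?X" for c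
      unfolding X
    proof
      fix \<alpha>
      have "word_op V \<alpha> (JC c) \<in> KC"
        by (rule subsetD[OF Cd.shift_H_subset Ed.word_in_shift_space]) simp
      then have "cinner (word_op V \<alpha> (JC c)) (J h) = 0"
        using r orthD'[of "J h" KC] by (simp add: R_iff)
      then show "cinner (word_op E \<alpha> (in_C c)) h = 0" by (simp only: Ed.word_J_cinner JC_apply)
    qed
  qed simp_all
  moreover have "inv_hull UNIV E (range in_C) = UNIV"
    using lift unfolding minimal_contractive_lifting_def by blast
  ultimately have "UNIV \<subseteq> ?X" by (simp only:)
  then have "h \<in> ?X" by (rule subsetD) simp
  then have "cinner (word_op E [] h) h = 0" unfolding X by (rule spec)
  then show "h = 0" by simp
qed

text \<open>The complement of S_E in K is the space of E, which meets R only in 0. Dually, the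
  projection of S_E to R is dense in R.\<close>

lemma R_orth_SE: assumes r: "r \<in> R" "r \<in> orth SE" shows "r = 0"
proof -
  have "r \<in> range J" by (rule Ed.orth_S_in_H[OF _ r(2)]) (use r in \<open>simp add: R_def\<close>)
  then obtain h where h: "r = J h" by blast
  have "h = 0" by (rule R_inter_range_J) (use r(1) h in blast)
  then show ?thesis by (simp only: h Ed.J_zero)
qed

lemma canon_vec_A: "Ad.canon_vec \<alpha> = Ed.canon_vec (\<chi> i. (0, \<alpha> $ i))"
  by (simp add: Ad.canon_vec_sum[symmetric] Ed.canon_vec_sum[symmetric] lifting_apply B_zero C_zero JA_apply)

lemma LA_subset: "LA \<subseteq> LE"
  unfolding Ad.L_eq
  by (rule closed_cspan_minimal[OF _ Ed.L_closed]) (auto simp: canon_vec_A Ed.L_eq intro: closed_cspan_base)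

abbreviation Vs :: "'d \<Rightarrow> 'k \<Rightarrow> 'k" where "Vs j \<equiv> adj K K (V j)"

lemma Vs_in: "x \<in> K \<Longrightarrow> Vs j x \<in> K"
  by (rule bounded_op_in[OF bounded_op_adj[OF Ed.K Ed.K_sub Ed.V_op]])

lemma Vs_cinner: "x \<in> K \<Longrightarrow> y \<in> K \<Longrightarrow> cinner x (Vs j y) = cinner (V j x) y"
  by (rule adj_cinner[OF Ed.K Ed.K_sub Ed.V_op])

lemma Vs_cinner': "x \<in> K \<Longrightarrow> y \<in> K \<Longrightarrow> cinner (Vs j y) x = cinner y (V j x)"
  by (rule adj_cinner'[OF Ed.K Ed.K_sub Ed.V_op])

text \<open>L_E is orthogonal to V_j S_E, so V_j^* l is orthogonal to S_E and lies in the space of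
  E. Its component in the space of A vanishes because V_j JA a is a generator of L_A plus a vector
  of the space of E, and l is orthogonal to both.\<close>

lemma Vs_orth_LA:
  assumes l: "l \<in> LE" "l \<in> orth LA" shows "Vs j l \<in> range JC"
proof -
  have lK: "l \<in> K" and lH: "l \<in> orth (range J)" using l(1) Ed.L_subset Ed.L_orth_H by blast+
  have "Vs j l \<in> range J"
  proof (rule Ed.orth_S_in_H[OF Vs_in[OF lK] orthI])
    fix s assume s: "s \<in> SE"
    have "cinner (V j s) l = 0" by (rule Ed.wand.V_S_orth_L[OF s l(1)])
    then show "cinner (Vs j l) s = 0"
      using s Ed.wand.S_subset by (subst Vs_cinner') (auto simp: lK cinner_eq_zero_commute)
  qed
  then obtain c a where ca: "Vs j l = J (c, a)" by auto
  have "Ad.canon_vec (axis j a) \<in> LA" unfolding Ad.L_eq by (rule closed_cspan_base) simp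
  then have "cinner l (Ad.canon_vec (axis j a)) = 0" by (rule orthD[OF l(2)])
  moreover have "cinner l (JA (A j a)) = 0" by (rule orthD[OF lH]) (simp add: JA_apply)
  ultimately have "cinner l (V j (JA a)) = 0" by (simp add: Ad.canon_vec_axis cinner_diff_right)
  then have "cinner (Vs j l) (JA a) = 0" using JA_in by (subst Vs_cinner') (auto simp: lK)
  then have "a = 0" by (simp add: ca JA_apply Ed.J_cinner cinner_prod_def)
  then show ?thesis by (simp add: ca JC_apply[symmetric])
qed

text \<open>The geometric form of the Szego condition: the restriction of V to R has no wandering
  vector.\<close>

definition SZ :: bool where
  "SZ \<longleftrightarrow> (\<forall>r\<in>R. (\<forall>j. \<forall>x\<in>K. cinner (V j x) r = 0) \<longrightarrow> r = 0)"

text \<open>A vector orthogonal to the space of C and to the dilation space of A is orthogonal to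
  the space of E, and also to S_E, which equals S_A here; these two span K.\<close>

lemma KA_full:
  assumes L: "LE = LA" shows "KA = K \<inter> orth (range JC)"
proof (rule orth_eq_0)
  show "closed_csubspace KA" by (simp add: KA_eq)
  show "csubspace (K \<inter> orth (range JC))"
    by (rule closed_csubspace_imp[OF closed_csubspace_Int[OF Ed.K closed_csubspace_orth]])
  show "KA \<subseteq> K \<inter> orth (range JC)" using KA_subset KA_orth by blast
  fix x assume x: "x \<in> K \<inter> orth (range JC)" and o: "x \<in> orth KA"
  have "x \<in> orth (range J)"
    using x orth_antimono[OF Ad.J_subset] o by (intro range_J_orth) blast+
  moreover have "x \<in> orth SE" using orth_antimono[OF Ad.wand.S_subset] o L by auto
  ultimately show "x = 0" using x Ed.orth_H_S_eq_0 by blast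
qed

lemma KC_invariant: "x \<in> KC \<Longrightarrow> V j x \<in> KC"
  by (rule Cd.V_cspan_HS)

lemma L_agree_if:
  assumes pc: "LC \<inter> LE = {0}" and sz: SZ
  shows "LE = LA"
proof (rule orth_eq_0[symmetric])
  show "closed_csubspace LA" "csubspace LE" "LA \<subseteq> LE"
    by (rule Ad.L_closed closed_csubspace_imp[OF Ed.L_closed] LA_subset)+
  fix l assume l: "l \<in> LE" "l \<in> orth LA"
  have lK: "l \<in> K" and lH: "l \<in> orth (range J)" using l(1) Ed.L_subset Ed.L_orth_H by blast+
  have KC: "closed_csubspace KC" by simp
  let ?r = "l - proj KC l"
  have pl: "proj KC l \<in> KC" by (rule proj_in[OF KC])
  have r: "?r \<in> R"
    unfolding R_iff
  proof
    show "?r \<in> K" by (rule csubspace_diff[OF Ed.K_sub lK subsetD[OF KC_subset pl]])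
    show "?r \<in> orth KC" by (intro orthI proj_orth[OF KC])
  qed
  \<comment> \<open>K is the sum of KC and R, both invariant under V_j. Only <V_j q, l> with q in R
    remains, and V_j^* l lies in the space of C, which is orthogonal to R.\<close>
  have Vr: "cinner (V j x) ?r = 0" if x: "x \<in> K" for j x
  proof -
    let ?p = "proj KC x" and ?q = "x - proj KC x"
    have p: "?p \<in> KC" by (rule proj_in[OF KC])
    have pK: "?p \<in> K" using p KC_subset by blast
    have q: "?q \<in> R"
      unfolding R_iff
    proof
      show "?q \<in> K" by (rule csubspace_diff[OF Ed.K_sub x pK])
      show "?q \<in> orth KC" by (intro orthI proj_orth[OF KC])
    qed
    have qK: "?q \<in> K" using q by (simp add: R_def)
    have "V j x = V j ?p + V j ?q" using bounded_op_add[OF Ed.V_op pK qK] by simp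
    moreover have "cinner (V j ?p) ?r = 0"
      using orthD'[of ?r KC "V j ?p"] r KC_invariant[OF p] by (simp add: R_iff)
    moreover have "cinner (V j ?q) (proj KC l) = 0"
      using orthD[of "V j ?q" KC] V_R[OF q] pl by (simp add: R_iff)
    moreover have "cinner (V j ?q) l = cinner ?q (Vs j l)" by (rule Vs_cinner[OF qK lK, symmetric])
    moreover have "cinner ?q (Vs j l) = 0"
      using orthD[of ?q "range JC"] q Vs_orth_LA[OF l] by (simp add: R_def)
    ultimately show ?thesis by (simp add: cinner_add_left cinner_diff_right)
  qed
  have "?r = 0" by (rule sz[unfolded SZ_def, rule_format, OF r]) (rule Vr)
  then have lKC: "l \<in> KC" using pl by simp
  have "l \<in> LC"
  proof (rule Cd.in_L_if[OF lKC])
    show "l \<in> orth (range JC)" using lH by (auto simp: orth_def JC_apply)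
    fix j s assume s: "s \<in> SC"
    have "cinner l (V j s) = cinner (Vs j l) s"
      by (rule Vs_cinner'[symmetric]) (use s Cd.wand.S_subset lK in blast)+
    also have "\<dots> = 0" by (rule orthD'[OF subsetD[OF Cd.S_orth_H s] Vs_orth_LA[OF l]])
    finally show "cinner l (V j s) = 0" .
  qed
  then show "l = 0" using pc l(1) by blast
qed

lemma LC_subset_LsA:
  assumes L: "LE = LA" shows "LC \<subseteq> LsA"
proof
  fix l assume l: "l \<in> LC"
  have "l \<in> KA" unfolding KA_full[OF L] using l Cd.L_subset Cd.L_orth_H by blast
  moreover have "cinner (V j x) l = 0" if "x \<in> KA" for j x
    by (rule Cd.V_orth_L[OF _ _ l]) (use that KA_subset KA_orth in blast)+
  ultimately show "l \<in> LsA" by (simp add: Ad.L_star_iff)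
qed

lemma agree_if:
  assumes pc: "LC \<inter> LE = {0}" and sz: SZ
  shows "LE = LA" and "LC = LsA"
proof -
  show L: "LE = LA" by (rule L_agree_if[OF assms])
  show "LC = LsA"
  proof (rule orth_eq_0[OF Cd.L_closed])
    show "csubspace LsA" by (rule closed_csubspace_imp[OF Ad.star.L])
    show "LC \<subseteq> LsA" by (rule LC_subset_LsA[OF L])
    fix r assume r: "r \<in> LsA" and o: "r \<in> orth LC"
    have rKA: "r \<in> KA" and rV: "\<And>j y. y \<in> KA \<Longrightarrow> cinner (V j y) r = 0" using r by (simp_all add: Ad.L_star_iff)
    have rK: "r \<in> K" and rH: "r \<in> orth (range JC)" using rKA KA_subset KA_orth by blast+
    have SC: "SC \<subseteq> KA" unfolding KA_full[OF L] using Cd.wand.S_subset Cd.S_orth_H by blast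
    \<comment> \<open>The empty word is covered by the assumption on r, the others because r is in
      L_{*,A} and S_C lies in the dilation space of A. Thus r belongs to R.\<close>
    have "cinner r (word_op V \<alpha> l) = 0" if l: "l \<in> LC" for \<alpha> l
    proof (cases \<alpha>)
      case Nil
      then show ?thesis using orthD[OF o l] by simp
    next
      case (Cons j \<beta>)
      have "cinner (V j (word_op V \<beta> l)) r = 0"
        by (rule rV) (use SC Ed.word_in_shift_space[OF l] in blast)
      then show ?thesis by (simp add: Cons cinner_eq_zero_commute)
    qed
    then have "r \<in> orth SC" by (simp add: Ed.orth_shift_space)
    then have rR: "r \<in> R" using rK rH by (simp add: R_def)
    \<comment> \<open>The test vectors now range over K and not only over the dilation space of A;
      the additional ones come from the space of C, and their images stay in KC.\<close>
    have "cinner (V j x) r = 0" if x: "x \<in> K" for j x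
    proof -
      let ?p = "proj (range JC) x" and ?q = "x - proj (range JC) x"
      have p: "?p \<in> range JC" by (rule proj_in[OF Cd.H_closed])
      have pK: "?p \<in> K" using p Cd.J_subset by blast
      have qK: "?q \<in> K" by (rule csubspace_diff[OF Ed.K_sub x pK])
      have "?q \<in> orth (range JC)" by (intro orthI proj_orth[OF Cd.H_closed])
      then have "?q \<in> KA" unfolding KA_full[OF L] using qK by blast
      then have "cinner (V j ?q) r = 0" by (rule rV)
      moreover have "V j ?p \<in> KC" by (rule KC_invariant[OF closed_cspan_base]) (use p in blast)
      then have "cinner (V j ?p) r = 0" using rR orthD'[of r KC] by (simp add: R_iff)
      moreover have "V j x = V j ?p + V j ?q" using bounded_op_add[OF Ed.V_op pK qK] by simp
      ultimately show ?thesis by (simp add: cinner_add_left)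
    qed
    then show "r = 0" using sz rR by (simp add: SZ_def)
  qed
qed

lemma only_if_agree:
  assumes LEA: "LE = LA" and LCA: "LC = LsA"
  shows "LC \<inter> LE = {0}" and SZ
proof -
  have "l = 0" if l: "l \<in> LC" "l \<in> LE" for l
  proof -
    have lH: "l \<in> orth (range J)" using l(2) Ed.L_orth_H by blast
    have "cinner (V j y) l = 0" if "y \<in> KA" for j y using l(1) that unfolding LCA Ad.L_star_iff by blast
    then have "cinner l (V j y) = 0" if "y \<in> KA" for j y using that by (simp add: cinner_eq_zero_commute)
    \<comment> \<open>Membership in L_{*,A} gives orthogonality to V_j JA a, membership in L_E to JA
      a. So l is orthogonal to the generators of L_A = L_E, a space containing l.\<close>
    then have "cinner l (Ad.VJ \<xi>) = 0" for \<xi>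
      by (simp add: Ad.VJ_def cinner_sum_right Ad.J_in)
    moreover have "cinner l (JA a) = 0" for a by (rule orthD[OF lH]) (simp add: JA_apply)
    ultimately have "l \<in> orth (range Ad.canon_vec)"
      by (auto simp: orth_def Ad.canon_vec_def cinner_diff_right)
    then have "l \<in> orth LA" unfolding Ad.L_eq by (simp only: orth_closed_cspan)
    then have "cinner l l = 0" using l(2) LEA orthD by blast
    then show "l = 0" by simp
  qed
  then show "LC \<inter> LE = {0}" using cc_zero[OF Cd.L_closed] cc_zero[OF Ed.L_closed] by blast
  show SZ
    unfolding SZ_def
  proof (intro ballI impI)
    fix r assume r: "r \<in> R" and rV: "\<forall>j. \<forall>x\<in>K. cinner (V j x) r = 0"
    have "r \<in> KA" unfolding KA_full[OF LEA] using r by (simp add: R_def)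
    then have "r \<in> LC" unfolding LCA Ad.L_star_iff using rV KA_subset by blast
    then have "r \<in> SC" using Ed.subset_shift_space by blast
    moreover have "r \<in> orth SC" using r by (simp add: R_def)
    ultimately have "cinner r r = 0" using orthD by blast
    then show "r = 0" by simp
  qed
qed

end

sublocale lifting_dilation \<subseteq> Ch: compression K V LC "defect_space C" "canon C V JC" "canon_K C V JC"
  "defect_space E" LE "canon E V J" "canon_K E V J"
proof
  show "cinner (V j y) l = 0" if "y \<in> SE" "l \<in> LC" for j y l
    using that Ed.wand.S_subset Ed.S_orth_H
    by (intro Cd.V_orth_L) (auto simp: orth_def subset_iff JC_apply)
qed (simp_all add: Cd.closed_defect_space Ed.closed_defect_space Ed.L_closed Ed.L_subset Cd.canon_unitary
    Ed.canon_unitary Cd.canon_K_ext Ed.canon_K_ext)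

section \<open>The Szego condition as a statement about R\<close>

context lifting_dilation
begin

lemma lifting_char_fun_eq: "lifting_char_fun C B A V J = Ch.M"
  by (rule ext) (simp only: lifting_char_fun_def Ch.M_def Let_def JC_def[symmetric])

text \<open>On S_E, which is orthogonal to the space of C, this is the projection onto R.\<close>

abbreviation Q :: "'k \<Rightarrow> 'k" where "Q z \<equiv> z - proj SC z"

lemma SE_R: assumes s: "s \<in> SE" shows "Q s \<in> R"
proof -
  have p: "proj SC s \<in> SC" by (rule proj_in) simp
  have "s \<in> K" using s Ed.wand.S_subset by blast
  then have "Q s \<in> K" by (rule csubspace_diff[OF Ed.K_sub]) (use p Cd.wand.S_subset in blast)
  moreover have "s \<in> orth (range JC)" using s Ed.S_orth_H by (auto simp: orth_def JC_apply)
  then have "Q s \<in> orth (range JC)"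
    by (rule cc_diff[OF closed_csubspace_orth]) (use p Cd.S_orth_H in blast)
  moreover have "Q s \<in> orth SC" by (intro orthI proj_orth) simp
  ultimately show ?thesis by (simp add: R_def)
qed

lemma cinner_Q: assumes r: "r \<in> R" shows "cinner (Q s) r = cinner s r"
proof -
  have "proj SC s \<in> SC" by (rule proj_in) simp
  then have "cinner (proj SC s) r = 0" using r orthD'[of r SC] by (simp add: R_def)
  then show ?thesis by (simp add: cinner_diff_left)
qed

text \<open>A vector r of R annihilated by all V_j^* is orthogonal to the images of N, hence by
  density to the projection of S_E; so r is orthogonal to S_E itself and vanishes.\<close>

lemma SZ_if_szego:
  assumes "szego_condition (defect_space E) (defect_space C) Ch.M" shows SZ
  unfolding SZ_def
proof (intro ballI impI)
  let ?U = "canon_K E V J"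
  fix r assume r: "r \<in> R" and rV: "\<forall>j. \<forall>x\<in>K. cinner (V j x) r = 0"
  have rK: "r \<in> K" using r by (simp add: R_def)
  have sz: "Q (?U x) \<in> closure ((\<lambda>y. Q (?U y)) ` Ch.N)" if "x \<in> fock_on (defect_space E)" for x
    using assms that unfolding Ch.szego_iff by blast
  have "(\<lambda>y. Q (?U y)) ` Ch.N \<subseteq> orth {r}"
  proof (rule image_subsetI)
    fix y assume y: "y \<in> Ch.N"
    have "cinner (?U y) r = 0" by (rule Ch.cinner_U2_N[OF rK _ y]) (use rV in blast)
    then show "Q (?U y) \<in> orth {r}" by (simp add: orth_def cinner_Q[OF r])
  qed
  then have cl: "closure ((\<lambda>y. Q (?U y)) ` Ch.N) \<subseteq> orth {r}"
    using closed_csubspace_orth[of "{r}"] by (intro closure_minimal) (simp_all add: closed_csubspace_def)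
  have "r \<in> orth SE"
  proof (rule orthI)
    fix s assume "s \<in> SE"
    then obtain x where x: "x \<in> fock_on (defect_space E)" "s = ?U x" using unitary_image[OF Ch.U2_un] by blast
    have "cinner (Q (?U x)) r = 0" using subsetD[OF cl sz[OF x(1)]] by (simp add: orth_def)
    then show "cinner r s = 0" by (simp add: x(2) cinner_Q[OF r] cinner_eq_zero_commute[of r])
  qed
  then show "r = 0" by (rule R_orth_SE[OF r])
qed

lemma szego_if_SZ:
  assumes sz: SZ shows "szego_condition (defect_space E) (defect_space C) Ch.M"
  unfolding Ch.szego_iff
proof
  let ?U = "canon_K E V J"
  let ?Y = "closed_cspan ((\<lambda>y. Q (?U y)) ` Ch.N)"
  have Y: "closed_csubspace ?Y" by simp
  fix x :: "('d, ('c \<times> 'a) ^ 'd) fock"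
  assume x: "x \<in> fock_on (defect_space E)"
  have Us: "?U y \<in> SE" if "y \<in> fock_on (defect_space E)" for y by (rule unitary_in[OF Ch.U2_un that])
  have YR: "?Y \<subseteq> R"
    by (rule closed_cspan_minimal[OF _ R_closed]) (use SE_R Us Ch.N_subset in blast)
  \<comment> \<open>The part of Q (U x) orthogonal to the images of N; the condition holds if it is
    always 0.\<close>
  let ?t = "Q (?U x) - proj ?Y (Q (?U x))"
  have p: "proj ?Y (Q (?U x)) \<in> ?Y" by (rule proj_in[OF Y])
  have t: "?t \<in> R" by (rule cc_diff[OF R_closed SE_R[OF Us[OF x]] subsetD[OF YR p]])
  have tK: "?t \<in> K" using t by (simp add: R_def)
  have tY: "?t \<in> orth ?Y" by (intro orthI proj_orth[OF Y])
  have tN: "cinner (?U y) ?t = 0" if "y \<in> Ch.N" for y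
  proof -
    have "cinner (Q (?U y)) ?t = 0" by (rule orthD'[OF tY closed_cspan_base]) (use that in blast)
    then show ?thesis by (simp only: cinner_Q[OF t])
  qed
  \<comment> \<open>V_j S_E is spanned by the images of tensors with a nonempty word, which belong
    to N.\<close>
  have tSE: "cinner (V j s) ?t = 0" if s: "s \<in> SE" for j s
  proof -
    have "V j s \<in> orth {?t}"
    proof (rule bounded_op_closed_cspan_in[where f = "V j", OF Ed.V_op Ed.K _ _ _ s[unfolded shift_space_def]])
      show "(\<Union>\<alpha>. word_op V \<alpha> ` LE) \<subseteq> K" using Ed.L_subset Ed.word_in by blast
      fix z assume "z \<in> (\<Union>\<alpha>. word_op V \<alpha> ` LE)"
      then obtain \<alpha> l where l: "l \<in> LE" "z = word_op V \<alpha> l" by blast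
      then obtain d where d: "d \<in> defect_space E" "l = canon E V J d" using unitary_image[OF Ed.canon_unitary] by blast
      have "V j z = ?U (single (j # \<alpha>) d)" by (simp add: fock_ext_single[OF Ch.U2 Ch.D2_sub d(1)] l d)
      then show "V j z \<in> orth {?t}" using tN[OF Ch.single_in_N[OF d(1), of j \<alpha>]] by (simp add: orth_def)
    qed simp
    then show ?thesis by (simp add: orth_def)
  qed
  \<comment> \<open>V_j^* t stays in R since KC is invariant, and is orthogonal to S_E by
    \<open>tSE\<close>; minimality of the lifting makes it 0.\<close>
  have Vt0: "cinner (V j z) ?t = 0" if z: "z \<in> K" for j z
  proof -
    have v: "Vs j ?t \<in> K" by (rule Vs_in[OF tK])
    have Vt: "cinner y (Vs j ?t) = cinner (V j y) ?t" if "y \<in> K" for y by (rule Vs_cinner[OF that tK])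
    have "Vs j ?t \<in> orth KC"
    proof (rule orthI)
      fix y assume y: "y \<in> KC"
      have "cinner (V j y) ?t = 0" using t orthD'[of ?t KC] KC_invariant[OF y] by (simp add: R_iff)
      then have "cinner y (Vs j ?t) = 0" by (simp only: Vt[OF subsetD[OF KC_subset y]])
      then show "cinner (Vs j ?t) y = 0" by (simp only: cinner_eq_zero_commute)
    qed
    then have "Vs j ?t \<in> R" using v by (simp add: R_iff)
    moreover have "Vs j ?t \<in> orth SE"
    proof (rule orthI)
      fix y assume y: "y \<in> SE"
      have "cinner y (Vs j ?t) = 0" using tSE[OF y] by (simp only: Vt[OF subsetD[OF Ed.wand.S_subset y]])
      then show "cinner (Vs j ?t) y = 0" by (simp only: cinner_eq_zero_commute)
    qed
    ultimately have "Vs j ?t = 0" by (rule R_orth_SE)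
    then show ?thesis using Vt[OF z] by simp
  qed
  have "?t = 0" by (rule sz[unfolded SZ_def, rule_format, OF t]) (rule Vt0)
  then have "Q (?U x) \<in> ?Y" using p by simp
  moreover have "csubspace ((\<lambda>y. Q (?U y)) ` Ch.N)"
  proof -
    have N: "closed_csubspace Ch.N"
      unfolding Ch.N_def orth_diff_eq by (rule closed_csubspace_Int[OF Ch.F2 closed_csubspace_orth])
    note Nsub = closed_csubspace_imp[OF N]
    have b: "bounded_op Ch.N UNIV (\<lambda>y. Q (?U y))"
      by (rule bounded_op_compose[OF bounded_op_subset[OF unitary_bounded[OF Ch.U2_un] Ch.N_subset, where Y' = UNIV]
            bounded_op_diff_op[OF bounded_op_ident bounded_op_subset[OF bounded_op_proj order_refl]]]) simp_all
    show ?thesis by (rule csubspace_image[OF b Nsub])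
  qed
  ultimately show "Q (?U x) \<in> closure ((\<lambda>y. Q (?U y)) ` Ch.N)" by (simp only: closed_cspan_csubspace)
qed

lemma characterization:
  "purely_contractive (defect_space E) (defect_space C) (lifting_char_fun C B A V J) \<and>
   szego_condition (defect_space E) (defect_space C) (lifting_char_fun C B A V J) \<longleftrightarrow>
   wandering_spaces_agree K V J"
proof -
  have "szego_condition (defect_space E) (defect_space C) Ch.M \<longleftrightarrow> SZ"
    using SZ_if_szego szego_if_SZ by blast
  then show ?thesis
    unfolding lifting_char_fun_eq Ch.purely_contractive_iff wandering_spaces_agree_def
      JC_def[symmetric] JA_def[symmetric]
    using agree_if only_if_agree by metis
qed

lemma char_funs_agree_if:
  assumes agree: "wandering_spaces_agree K V J"
  shows "char_funs_agree C B A K V J"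
proof -
  have L: "LE = LA" "LC = LsA"
    using agree unfolding wandering_spaces_agree_def JC_def[symmetric] JA_def[symmetric] by blast+
  let ?u = "inv_into (defect_space A) (canon A V JA) \<circ> canon E V J"
  let ?w = "inv_into (star_defect_space A) (star_canon A KA V JA) \<circ> canon C V JC"
  note uA = Ad.canon_unitary and sA = Ad.star_canon_unitary
  note DA = closed_csubspace_imp[OF Ad.closed_defect_space]
  note DsA = closed_csubspace_imp[OF Ad.closed_star_defect_space]
  have u: "unitary_op (defect_space E) (defect_space A) ?u"
    by (rule unitary_compose[OF Ed.canon_unitary[unfolded L(1)] unitary_inv[OF uA DA]])
  have w: "unitary_op (defect_space C) (star_defect_space A) ?w"
    by (rule unitary_compose[OF Cd.canon_unitary[unfolded L(2)] unitary_inv[OF sA DsA]])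
  have uE: "canon A V JA (?u \<delta>) = canon E V J \<delta>" if "\<delta> \<in> defect_space E" for \<delta>
    using unitary_inv_right[OF uA DA] unitary_in[OF Ed.canon_unitary that] L(1) by simp
  have wC: "star_canon A KA V JA (?w \<delta>) = canon C V JC \<delta>" if "\<delta> \<in> defect_space C" for \<delta>
    using unitary_inv_right[OF sA DsA] unitary_in[OF Cd.canon_unitary that] L(2) by simp
  \<comment> \<open>Both functions are compressions inside the same K, so the intertwining unitary
    is the identity and only the coefficient spaces are relabelled.\<close>
  have W: "unitary_op K K (\<lambda>x. x)" by (rule unitary_opI) simp_all
  have "id_tensor ?w (lifting_char_fun C B A V J x) = char_fun A KA V JA (id_tensor ?u x)"
    if x: "x \<in> fock_on (defect_space E)" for x
    unfolding lifting_char_fun_eq Ch.M_def Ad.char_fun_eq Ad.char.M_def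
    by (rule compression_transfer[OF Ch.compression_axioms Ad.char.compression_axioms W Ed.K_sub
          Cd.wand.S_subset Ed.wand.S_subset _ _ unitary_bounded[OF w] wC unitary_bounded[OF u] uE x, symmetric])
      (simp_all add: L(2))
  then show ?thesis unfolding char_funs_agree_def Let_def JC_def[symmetric] JA_def[symmetric] by blast
qed

end

subsection \<open>Liftings with prescribed corner\<close>

lemma norm_axis: "norm (axis j c) = norm (c :: 'h::complex_inner)" for j :: "'d::finite"
proof -
  have "(norm (axis j c))\<^sup>2 = (\<Sum>i\<in>UNIV. if i = j then (norm c)\<^sup>2 else 0)"
    unfolding norm_vec_sq by (rule sum.cong) (simp_all add: axis_def)
  then show ?thesis by simp
qed

lemma bounded_op_axis: "bounded_op UNIV UNIV (axis j :: 'h::complex_inner \<Rightarrow> 'h ^ 'd::finite)"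
proof (rule bounded_opI[where b = 1])
  show "norm (axis j x) \<le> 1 * norm x" for x :: 'h by (simp only: norm_axis)
qed (simp_all add: vec_eq_iff axis_def)

lemma sum_axis: "(\<Sum>j\<in>UNIV. axis j (\<xi> $ j)) = (\<xi> :: 'h::complex_inner ^ 'd::finite)"
  by (simp add: vec_eq_iff axis_def)

lemma norm_Pair_sq: "(norm (x, y))\<^sup>2 = (norm x)\<^sup>2 + (norm y)\<^sup>2"
  by (simp add: norm_Pair)

locale canonical_lifting = Cr: row_contr C + Ar: row_contr A
  for C :: "'d::finite \<Rightarrow> 'c::chilbert_space \<Rightarrow> 'c" and A :: "'d \<Rightarrow> 'a::chilbert_space \<Rightarrow> 'a" +
  fixes \<gamma> :: "'c ^ 'd \<Rightarrow> 'a"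
  assumes \<gamma>: "unitary_op (defect_space C) (star_defect_space A) \<gamma>" and cnc: "completely_non_coisometric A"
begin

definition B :: "'d \<Rightarrow> 'c \<Rightarrow> 'a" where
  "B j c = star_defect_op A (\<gamma> (defect_op C (axis j c)))"

definition z :: "'c ^ 'd \<Rightarrow> 'a" where "z \<xi> = \<gamma> (defect_op C \<xi>)"

lemma z_op: "bounded_op UNIV (star_defect_space A) z"
  unfolding z_def
  by (rule bounded_op_compose[OF bounded_op_subset[OF Cr.defect_op_op order_refl] unitary_bounded[OF \<gamma>]])
    (rule Cr.defect_op_in)

lemma z_norm: "norm (z \<xi>) = norm (defect_op C \<xi>)"
  unfolding z_def by (rule unitary_norm[OF \<gamma> Cr.defect_op_in])

lemma Dz_op: "bounded_op UNIV UNIV (\<lambda>\<xi>. star_defect_op A (z \<xi>))"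
  by (rule bounded_op_compose[OF bounded_op_subset[OF z_op order_refl, where Y' = UNIV] Ar.star_defect_op_op]) simp

lemma B_eq: "B j c = star_defect_op A (z (axis j c))"
  by (simp add: B_def z_def)

lemma B_bounded: "bounded_op UNIV UNIV (B j)"
  unfolding B_eq by (rule bounded_op_compose[OF bounded_op_axis Dz_op])

end

sublocale canonical_lifting \<subseteq> lifting_ops C B A
  by unfold_locales (rule Cr.bounded B_bounded Ar.bounded)+

context canonical_lifting
begin

lemma row_op_B: "row_op B \<xi> = star_defect_op A (z \<xi>)"
  unfolding row_op_def B_eq bounded_op_sum[OF Dz_op csubspace_UNIV UNIV_I, symmetric] sum_axis ..

text \<open>B^* a = D_C \<gamma>^* D_{*,A} a. The vector g = \<gamma>^* D_{*,A} a is returned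
  because contractivity uses its norm and minimality its vanishing.\<close>

lemma star_vec_B:
  obtains g where "g \<in> defect_space C" "star_vec B a = defect_op C g" "\<gamma> g = star_defect_op A a"
proof -
  obtain g where g: "g \<in> defect_space C" "star_defect_op A a = \<gamma> g"
    using Ar.star_defect_op_in[of a] unitary_image[OF \<gamma>] by blast
  have "star_vec B a = defect_op C g"
  proof (rule cc_eq_by_cinner[OF csubspace_UNIV UNIV_I UNIV_I])
    fix \<xi>
    have "cinner (star_vec B a) \<xi> = cinner (star_defect_op A a) (z \<xi>)"
      by (simp add: BR.star_vec_cinner row_op_B Ar.star_defect_symmetric)
    also have "\<dots> = cinner g (defect_op C \<xi>)"
      unfolding g(2) z_def by (rule unitary_cinner[OF \<gamma> g(1) Cr.defect_op_in])
    finally show "cinner (star_vec B a) \<xi> = cinner (defect_op C g) \<xi>" by (simp add: Cr.defect_symmetric)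
  qed
  then show ?thesis using that g by simp
qed

lemma star_vec_E_norm:
  "(norm (star_vec E (c, a)))\<^sup>2 = (norm (star_vec C c + star_vec B a))\<^sup>2 + (norm (star_vec A a))\<^sup>2"
  by (simp add: norm_vec_sq adj_E norm_Pair_sq sum.distrib)

text \<open>The map \<xi> -> (C \<xi>, D_C \<xi>) is an isometry, so its adjoint (c, g) -> C^* c +
  D_C g is a contraction. Since |g| = |D_{*,A} a|, the remaining term |A^* a|^2 completes
  |a|^2.\<close>

lemma E_contraction: "row_contraction E"
proof (rule row_contractionI[OF E_op])
  fix p :: "'c \<times> 'a"
  obtain c a where p: "p = (c, a)" by (cases p)
  obtain g where g: "g \<in> defect_space C" "star_vec B a = defect_op C g" "\<gamma> g = star_defect_op A a"
    by (rule star_vec_B)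
  let ?\<xi> = "star_vec C c + star_vec B a"
  have two: "2 * Re (cinner x y) \<le> (norm x)\<^sup>2 + (norm y)\<^sup>2" for x y :: "'h::complex_inner"
    using norm_diff_sq[of x y] zero_le_power2[of "norm (x - y)"] by linarith
  have "(norm ?\<xi>)\<^sup>2 = Re (cinner (row_op C ?\<xi>) c) + Re (cinner (defect_op C ?\<xi>) g)"
    by (simp add: norm_sq_cinner Cr.row_op_cinner Cr.defect_symmetric g(2) cinner_add_right)
  then have "2 * (norm ?\<xi>)\<^sup>2 \<le> (norm (row_op C ?\<xi>))\<^sup>2 + (norm c)\<^sup>2 + ((norm (defect_op C ?\<xi>))\<^sup>2 + (norm g)\<^sup>2)"
    using two[of "row_op C ?\<xi>" c] two[of "defect_op C ?\<xi>" g] by linarith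
  then have "(norm ?\<xi>)\<^sup>2 \<le> (norm c)\<^sup>2 + (norm g)\<^sup>2" by (simp add: Cr.defect_norm)
  also have "(norm g)\<^sup>2 = (norm a)\<^sup>2 - (norm (star_vec A a))\<^sup>2"
    using unitary_norm[OF \<gamma> g(1)] by (simp add: g(3) Ar.star_defect_norm[symmetric])
  finally have "(norm (star_vec E p))\<^sup>2 \<le> (norm p)\<^sup>2"
    by (simp add: p star_vec_E_norm norm_Pair_sq)
  then show "norm (star_vec E p) \<le> norm p" by (rule power2_le_imp_le) simp
qed

text \<open>Vectors orthogonal to X have the form (0, b), and E_j^* keeps them orthogonal to X. So
  B^* vanishes at every A_\<alpha>^* a, hence so does D_{*,A}; then A^* loses no norm along these
  vectors and a = 0.\<close>

lemma minimal_E: "inv_hull UNIV E (range in_C) = UNIV"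
proof -
  have "X = UNIV" if X: "closed_csubspace X" "range in_C \<subseteq> X" "\<forall>j. E j ` X \<subseteq> X" for X
  proof (rule orth_eq_0[OF X(1) csubspace_UNIV subset_UNIV])
    fix p assume "p \<in> orth X"
    moreover obtain c0 a where p: "p = (c0, a)" by (cases p)
    ultimately have pX: "(c0, a) \<in> orth X" by simp
    have fst0: "c = 0" if "(c, b) \<in> orth X" for c b
    proof -
      have "cinner (c, b) (in_C c) = 0" by (rule orthD[OF that]) (use X(2) in blast)
      then show ?thesis by (simp add: cinner_prod_def)
    qed
    have adjX: "(adj UNIV UNIV (B j) b, adj UNIV UNIV (A j) b) \<in> orth X" if b: "(0, b) \<in> orth X" for j b
    proof (rule orthI)
      fix k assume k: "k \<in> X"
      have "cinner (adj UNIV UNIV (E j) (0, b)) k = cinner (0, b) (E j k)" by (rule ER.adj_T)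
      also have "\<dots> = 0" by (rule orthD[OF b]) (use X(3) k in blast)
      finally show "cinner (adj UNIV UNIV (B j) b, adj UNIV UNIV (A j) b) k = 0"
        by (simp add: adj_E bounded_op_zero[OF Cr.adj_op])
    qed
    let ?w = "\<lambda>\<alpha>. adj UNIV UNIV (word_op A \<alpha>) a"
    have wX: "(0, ?w \<alpha>) \<in> orth X" for \<alpha>
    proof (induction \<alpha> rule: rev_induct)
      case Nil
      show ?case using pX fst0[OF pX] by (simp only: Ar.adj_word_Nil)
    next
      case (snoc j \<alpha>)
      show ?case using adjX[OF snoc.IH, of j] fst0[OF adjX[OF snoc.IH, of j]] by (simp only: Ar.adj_word_snoc)
    qed
    have "norm (star_vec A (?w \<alpha>)) = norm (?w \<alpha>)" for \<alpha>
    proof -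
      obtain g where g: "g \<in> defect_space C" "star_vec B (?w \<alpha>) = defect_op C g" "\<gamma> g = star_defect_op A (?w \<alpha>)"
        by (rule star_vec_B)
      have "star_vec B (?w \<alpha>) = 0" using fst0[OF adjX[OF wX]] by (simp add: vec_eq_iff)
      then have "defect_op C g = 0" using g(2) by simp
      then have "g \<in> orth (range (defect_op C))"
        by (auto simp: orth_def Cr.defect_symmetric[symmetric])
      then have "g \<in> orth (defect_space C)" by (simp only: Cr.defect_space_cspan orth_closed_cspan)
      from orthD[OF this g(1)] have "g = 0" by simp
      then have "star_defect_op A (?w \<alpha>) = 0"
        using g(3) bounded_op_zero[OF unitary_bounded[OF \<gamma>] cc_zero[OF Cr.closed_defect_space]] by simp
      then have "(norm (?w \<alpha>))\<^sup>2 = (norm (star_vec A (?w \<alpha>)))\<^sup>2" using Ar.star_defect_norm[of "?w \<alpha>"] by simp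
      then show ?thesis by simp
    qed
    then have "a = 0" by (rule Ar.completely_non_coisometric_zero[OF cnc])
    then show "p = 0" using p fst0[OF pX] by (simp add: zero_prod_def)
  qed
  then show ?thesis unfolding inv_hull_def by blast
qed

lemma minimal_contractive: "minimal_contractive_lifting C B A"
  using E_contraction minimal_E C_op B_op A_op by (simp add: minimal_contractive_lifting_def)

definition pairv :: "'c ^ 'd \<Rightarrow> 'a ^ 'd \<Rightarrow> ('c \<times> 'a) ^ 'd" where "pairv c a = (\<chi> i. (c $ i, a $ i))"

lemma row_op_E: "row_op E (pairv c a) = (row_op C c, star_defect_op A (z c) + row_op A a)"
proof -
  have "row_op E (pairv c a) = (row_op C c, row_op B c + row_op A a)"
    by (simp add: row_op_def pairv_def lifting_apply prod_eq_iff fst_sum snd_sum sum.distrib)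
  then show ?thesis by (simp add: row_op_B)
qed

lemma norm_pairv: "(norm (pairv c a))\<^sup>2 = (norm c)\<^sup>2 + (norm a)\<^sup>2"
  by (simp add: norm_vec_sq pairv_def norm_Pair_sq sum.distrib)

text \<open>For the choice A^* h in the A-component, the second component of the row operator of E
  is h up to the error z c - D_{*,A} h, because D_{*,A}^2 = I - A A^*.\<close>

lemma star_defect_error:
  "star_defect_op A (z c) + row_op A (star_vec A h) = h + star_defect_op A (z c - star_defect_op A h)"
  by (simp add: bounded_op_diff[OF Ar.star_defect_op_op] Ar.star_defect_square)

lemma z_norm_split:
  "(norm (z c))\<^sup>2 = (norm (star_defect_op A h))\<^sup>2 + 2 * Re (cinner (star_defect_op A h) (z c - star_defect_op A h))
    + (norm (z c - star_defect_op A h))\<^sup>2"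
  using norm_add_sq[of "star_defect_op A h" "z c - star_defect_op A h"] by simp

lemma agree:
  fixes K :: "'k::chilbert_space set" and V :: "'d \<Rightarrow> 'k \<Rightarrow> 'k"
  assumes dil: "minimal_isometric_dilation E K V J"
  shows "wandering_spaces_agree K V J" "char_funs_agree C B A K V J"
proof -
  interpret lifting_dilation C B A K V J
    by unfold_locales (rule Cr.row_contr minimal_contractive dil)+
  let ?D = "star_defect_op A"
  have canon_split: "Ed.canon_vec (pairv c a) = Ed.canon_vec (pairv c 0) + Ad.canon_vec a" for c a
  proof -
    have "Ed.canon_vec (pairv c a) = Ed.canon_vec (pairv c 0 + pairv 0 a)"
      by (rule arg_cong[of _ _ Ed.canon_vec]) (simp add: pairv_def vec_eq_iff)
    also have "\<dots> = Ed.canon_vec (pairv c 0) + Ed.canon_vec (pairv 0 a)"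
      by (simp add: Ed.canon_vec_def Ed.VJ_def Ed.J_add bounded_op_add[OF Ed.V_op Ed.J_in Ed.J_in]
          bounded_op_add[OF ER.row_op_op] sum.distrib)
    finally show ?thesis by (simp add: canon_vec_A pairv_def)
  qed
  have approx_LA: "Ed.canon_vec (pairv c 0) \<in> LA" for c
  proof -
    have "\<exists>y\<in>LA. dist y (Ed.canon_vec (pairv c 0)) < e" if e: "e > 0" for e
    proof -
      \<comment> \<open>For h with D_{*,A} h near z c, the choice a = A^* h makes the canonical
        vector at (c, a) no longer than the error. So the one at (c, 0) is close to minus the
        canonical vector of A at a.\<close>
      have "z c \<in> closure (range ?D)" using bounded_op_in[OF z_op, of c] by (simp add: star_defect_space_def)
      then obtain h where h: "norm (z c - ?D h) < e"
        using e unfolding closure_approachable by (auto simp: dist_norm norm_minus_commute)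
      let ?e = "z c - ?D h" and ?a = "star_vec A h"
      have "(norm (Ed.canon_vec (pairv c ?a)))\<^sup>2 = (norm (pairv c ?a))\<^sup>2 - (norm (row_op E (pairv c ?a)))\<^sup>2"
        by (simp only: norm_sq_cinner Ed.canon_vec_cinner Ed.defect_cinner) simp
      also have "\<dots> = (norm (z c))\<^sup>2 + (norm ?a)\<^sup>2 - (norm (h + ?D ?e))\<^sup>2"
        by (simp add: row_op_E norm_Pair_sq norm_pairv star_defect_error z_norm Cr.defect_norm)
      also have "\<dots> = (norm ?e)\<^sup>2 - (norm (?D ?e))\<^sup>2"
        by (simp add: z_norm_split[of c h] norm_add_sq Ar.star_defect_symmetric Ar.star_defect_norm[of h])
      also have "\<dots> \<le> (norm ?e)\<^sup>2" by simp
      finally have "norm (Ed.canon_vec (pairv c ?a)) \<le> norm ?e" by (rule power2_le_imp_le) simp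
      then have "dist (- Ad.canon_vec ?a) (Ed.canon_vec (pairv c 0)) < e"
        using h by (simp add: canon_split[of c ?a] dist_norm norm_minus_commute[of "- _"] add.commute)
      moreover have "- Ad.canon_vec ?a \<in> LA"
        by (rule cc_minus[OF Ad.L_closed]) (simp add: Ad.L_eq closed_cspan_base)
      ultimately show ?thesis by blast
    qed
    then have "Ed.canon_vec (pairv c 0) \<in> closure LA" unfolding closure_approachable by blast
    then show ?thesis using Ad.L_closed by (simp add: closed_csubspace_def)
  qed
  have LE: "LE = LA"
  proof
    show "LE \<subseteq> LA"
      unfolding Ed.L_eq
    proof (rule closed_cspan_minimal[OF _ Ad.L_closed], rule image_subsetI)
      fix \<eta> :: "('c \<times> 'a) ^ 'd"
      have \<eta>: "\<eta> = pairv (\<chi> i. fst (\<eta> $ i)) (\<chi> i. snd (\<eta> $ i))" by (simp add: pairv_def vec_eq_iff)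
      have "Ad.canon_vec a \<in> LA" for a by (simp add: Ad.L_eq closed_cspan_base)
      then show "Ed.canon_vec \<eta> \<in> LA"
        by (subst \<eta>, subst canon_split) (intro cc_add[OF Ad.L_closed] approx_LA)
    qed
  qed (rule LA_subset)
  have approx_LC: "Ad.star_canon_vec h \<in> LC" for h
  proof -
    have "\<exists>y\<in>LC. dist y (Ad.star_canon_vec h) < e" if e: "e > 0" for e
    proof -
      \<comment> \<open>Now h is given, and c is chosen with D_C c near the preimage d of D_{*,A} h
        under \<gamma>. The distance of the two canonical vectors is then exactly the norm of z c -
        D_{*,A} h.\<close>
      obtain d where d: "d \<in> defect_space C" "?D h = \<gamma> d"
        using Ar.star_defect_op_in[of h] unitary_image[OF \<gamma>] by blast
      have "d \<in> closure (range (defect_op C))" using d(1) by (simp add: defect_space_def)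
      then obtain c where c: "norm (defect_op C c - d) < e"
        using e unfolding closure_approachable by (auto simp: dist_norm)
      let ?e = "z c - ?D h" and ?a = "star_vec A h"
      note sub = closed_csubspace_imp[OF Cr.closed_defect_space]
      have "?e = \<gamma> (defect_op C c - d)"
        by (simp add: z_def d(2) bounded_op_diff[OF unitary_bounded[OF \<gamma>] sub Cr.defect_op_in d(1)])
      then have ne: "norm ?e < e"
        using c unitary_norm[OF \<gamma> csubspace_diff[OF sub Cr.defect_op_in d(1)]] by simp
      have VJ: "Ed.VJ (pairv c ?a) = Cd.VJ c + Ad.VJ ?a"
        by (simp add: Ed.VJ_def Cd.VJ_def Ad.VJ_def pairv_def J_split
            bounded_op_add[OF Ed.V_op Cd.J_in subsetD[OF JA_in rangeI]] sum.distrib del: star_vec_nth)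
      have diff: "Cd.canon_vec c - Ad.star_canon_vec h = Ed.VJ (pairv c ?a) - J (row_op C c, h)"
        by (simp add: Cd.canon_vec_def Ad.star_canon_vec_def VJ J_split)
      have "(norm (Cd.canon_vec c - Ad.star_canon_vec h))\<^sup>2
          = (norm (pairv c ?a))\<^sup>2 - 2 * Re (cinner (row_op E (pairv c ?a)) (row_op C c, h)) + (norm (row_op C c, h))\<^sup>2"
        unfolding diff norm_diff_sq Ed.VJ_J_cinner by (simp only: norm_sq_cinner Ed.VJ_cinner Ed.J_cinner)
      also have "\<dots> = (norm c)\<^sup>2 + (norm ?a)\<^sup>2 - (norm (row_op C c))\<^sup>2 - (norm h)\<^sup>2 - 2 * Re (cinner (?D ?e) h)"
        by (simp only: row_op_E star_defect_error norm_pairv norm_Pair_sq cinner_prod_def fst_conv snd_conv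
            cinner_add_left plus_complex.sel norm_sq_cinner[of "row_op C c"] norm_sq_cinner[of h]) simp
      also have "\<dots> = (norm (z c))\<^sup>2 - (norm (?D h))\<^sup>2 - 2 * Re (cinner (?D h) ?e)"
        by (simp add: z_norm Cr.defect_norm Ar.star_defect_norm[of h] Ar.star_defect_symmetric
            Re_cinner_commute[of ?e])
      also have "\<dots> = (norm ?e)\<^sup>2" by (simp add: z_norm_split[of c h])
      finally have "norm (Cd.canon_vec c - Ad.star_canon_vec h) = norm ?e" by simp
      then have "dist (Cd.canon_vec c) (Ad.star_canon_vec h) < e" using ne by (simp add: dist_norm)
      moreover have "Cd.canon_vec c \<in> LC" by (simp add: Cd.L_eq closed_cspan_base)
      ultimately show ?thesis by blast
    qed
    then have "Ad.star_canon_vec h \<in> closure LC" unfolding closure_approachable by blast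
    then show ?thesis using Cd.L_closed by (simp add: closed_csubspace_def)
  qed
  have LC: "LC = LsA"
  proof
    show "LC \<subseteq> LsA" by (rule LC_subset_LsA[OF LE])
    show "LsA \<subseteq> LC"
      unfolding Ad.L_star_eq by (rule closed_cspan_minimal[OF _ Cd.L_closed]) (use approx_LC in blast)
  qed
  show w: "wandering_spaces_agree K V J"
    unfolding wandering_spaces_agree_def JC_def[symmetric] JA_def[symmetric] using LE LC by blast
  show "char_funs_agree C B A K V J" by (rule char_funs_agree_if[OF w])
qed

end

lemma same_hilbert_dim_unitary:
  fixes X :: "'g::chilbert_space set" and Y :: "'h::chilbert_space set"
  assumes "same_hilbert_dim X Y" shows "\<exists>u. unitary_op X Y u"
proof -
  obtain B B' where B: "orthonormal_basis B X" "orthonormal_basis B' Y" "B \<approx> B'"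
    using assms by (auto simp: same_hilbert_dim_def)
  then obtain f where f: "bij_betw f B B'" by (auto simp: eqpoll_def)
  have "cinner x y = cinner (f x) (f y)" if xy: "x \<in> B" "y \<in> B" for x y
  proof -
    have "f x \<in> B'" "f y \<in> B'" "f x = f y \<longleftrightarrow> x = y"
      using f xy by (auto simp: bij_betw_def inj_on_def)
    then show ?thesis using B xy by (simp add: orthonormal_basis_def)
  qed
  then have "\<exists>u. unitary_op (closed_cspan ((\<lambda>x. x) ` B)) (closed_cspan (f ` B)) u \<and> (\<forall>x\<in>B. u x = f x)"
    by (rule unitary_of_equal_gram)
  moreover have "f ` B = B'" using f by (simp add: bij_betw_def)
  ultimately show ?thesis using B by (auto simp: orthonormal_basis_def)
qed

subsection \<open>Characteristic functions as complete invariants\<close>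

lemma unitary_id_tensor:
  fixes D :: "'g::chilbert_space set" and D' :: "'h::chilbert_space set"
  assumes v: "unitary_op D D' v" and D: "csubspace D"
  shows "unitary_op (fock_on D) (fock_on D' :: ('d, 'h) fock set) (id_tensor v)"
proof (rule unitary_opI)
  note vb = unitary_bounded[OF v] and inv = unitary_inv[OF v D]
  have b: "bounded_op (fock_on D) (fock_on D' :: ('d, 'h) fock set) (id_tensor v)"
    by (rule bounded_op_id_tensor[OF vb D])
  have in_D: "coord x \<alpha> \<in> D" if "x \<in> fock_on D" for x :: "('d, 'g) fock" and \<alpha>
    using that by (simp add: fock_on_def)
  fix x y :: "('d, 'g) fock" assume x: "x \<in> fock_on D"
  show "id_tensor v (c *\<^sub>C x) = c *\<^sub>C id_tensor v x" for c by (rule bounded_op_scaleC[OF b x])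
  assume y: "y \<in> fock_on D"
  show "id_tensor v (x + y) = id_tensor v x + id_tensor v y" by (rule bounded_op_add[OF b x y])
  show "cinner (id_tensor v x) (id_tensor v y) = cinner x y"
    unfolding cinner_l2_def coord_id_tensor[OF vb x] coord_id_tensor[OF vb y]
    by (intro infsum_cong unitary_cinner[OF v] in_D x y)
next
  note vb = unitary_bounded[OF v] and inv = unitary_inv[OF v D]
  show "id_tensor v ` fock_on D = (fock_on D' :: ('d, 'h) fock set)"
  proof
    show "id_tensor v ` fock_on D \<subseteq> (fock_on D' :: ('d, 'h) fock set)"
      using bounded_op_in[OF bounded_op_id_tensor[OF vb D]] by blast
    show "(fock_on D' :: ('d, 'h) fock set) \<subseteq> id_tensor v ` fock_on D"
    proof
      fix y :: "('d, 'h) fock" assume y: "y \<in> fock_on D'"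
      let ?x = "id_tensor (inv_into D v) y"
      have c: "coord ?x \<alpha> = inv_into D v (coord y \<alpha>)" for \<alpha>
        by (rule coord_id_tensor[OF unitary_bounded[OF inv] y])
      have yD: "coord y \<alpha> \<in> D'" for \<alpha> using y by (simp add: fock_on_def)
      have x: "?x \<in> fock_on D" by (simp add: fock_on_def c unitary_in[OF inv yD])
      have "y = id_tensor v ?x"
        by (rule l2_eqI) (simp add: coord_id_tensor[OF vb x] c unitary_inv_right[OF v D yD])
      then show "y \<in> id_tensor v ` fock_on D" using x by (rule image_eqI)
    qed
  qed
qed

text \<open>M records the inner products between the two shift parts, which is how it determines
  their relative position in K.\<close>

lemma (in compression) cinner_U1_U2:
  assumes f: "f \<in> fock_on D1" and g: "g \<in> fock_on D2"
  shows "cinner (U1 f) (U2 g) = cinner f (M g)"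
proof -
  have "cinner (U1 f) (U2 g) = cinner (U1 f) (proj S (U2 g))"
    by (rule proj_cinner'[symmetric]) (simp_all add: unitary_in[OF U1_un f])
  also have "\<dots> = cinner f (M g)"
    unfolding U1_M[symmetric] by (rule unitary_cinner[OF U1_un f bounded_op_in[OF M_op g]])
  finally show ?thesis .
qed

lemma (in coinv_dilation) J_word_cinner:
  "y \<in> K \<Longrightarrow> cinner (J h) (word_op V \<alpha> y) = cinner (J (adj UNIV UNIV (word_op T \<alpha>) h)) y"
proof (induction \<alpha> arbitrary: y rule: rev_induct)
  case Nil
  show ?case by (simp only: adj_word_Nil) simp
next
  case (snoc j \<alpha>)
  have "cinner (J h) (word_op V (\<alpha> @ [j]) y) = cinner (J (adj UNIV UNIV (word_op T \<alpha>) h)) (V j y)"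
    using snoc.IH[OF V_in[OF snoc.prems]] by (simp add: word_op_append)
  then show ?case by (simp only: coinv'[OF snoc.prems] adj_word_snoc)
qed

text \<open>A vector orthogonal to S has the form J h. With w = T_\<alpha>^* h, orthogonality to
  V_\<alpha> applied to the star canonical vector of w says |w|^2 = |T^* w|^2, so h = 0 by complete
  non-coisometry.\<close>

lemma (in min_dilation) cspan_S_star_S:
  assumes cnc: "completely_non_coisometric T"
  shows "closed_cspan (S_star \<union> S) = K"
proof (rule orth_eq_0)
  show "closed_cspan (S_star \<union> S) \<subseteq> K"
    by (rule closed_cspan_minimal[OF _ K]) (use star.S_subset wand.S_subset in blast)
  fix x assume x: "x \<in> K" and o: "x \<in> orth (closed_cspan (S_star \<union> S))"
  have oS: "x \<in> orth S" "x \<in> orth S_star" using o unfolding orth_closed_cspan by (auto simp: orth_def)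
  then obtain h where h: "x = J h" using orth_S_in_H[OF x] by blast
  let ?w = "\<lambda>\<alpha>. adj UNIV UNIV (word_op T \<alpha>) h"
  have "norm (star_vec T (?w \<alpha>)) = norm (?w \<alpha>)" for \<alpha>
  proof -
    have "star_canon_vec (?w \<alpha>) \<in> L_star" unfolding L_star_eq by (rule closed_cspan_base) simp
    then have "cinner x (word_op V \<alpha> (star_canon_vec (?w \<alpha>))) = 0"
      by (intro orthD[OF oS(2)] word_in_shift_space)
    then have "cinner (J (?w \<alpha>)) (star_canon_vec (?w \<alpha>)) = 0"
      by (simp add: h J_word_cinner[OF star_canon_vec_in])
    then have "cinner (?w \<alpha>) (?w \<alpha>) = cinner (star_vec T (?w \<alpha>)) (star_vec T (?w \<alpha>))"
      by (simp add: star_canon_vec_def cinner_diff_right J_cinner J_VJ_cinner star_vec_cinner)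
    then show ?thesis by (rule norm_eq_of_cinner[symmetric])
  qed
  then have "h = 0" by (rule completely_non_coisometric_zero[OF cnc])
  then show "x = 0" by (simp add: h J_zero)
qed (simp_all add: K_sub)

lemma unitary_image_shift_space:
  fixes X :: "'k::chilbert_space set" and Y :: "'l::chilbert_space set"
  assumes W: "unitary_op X Y W" and X: "closed_csubspace X" "\<And>j x. x \<in> X \<Longrightarrow> V j x \<in> X"
    and WV: "\<And>j x. x \<in> X \<Longrightarrow> W (V j x) = V' j (W x)" and L: "L \<subseteq> X"
  shows "W ` shift_space V L = shift_space V' (W ` L)"
proof -
  have w: "word_op V \<alpha> x \<in> X \<and> W (word_op V \<alpha> x) = word_op V' \<alpha> (W x)" if "x \<in> X" for \<alpha> x
    by (induction \<alpha>) (simp_all add: that X(2) WV)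
  have "(\<Union>\<alpha>. word_op V \<alpha> ` L) \<subseteq> X" using w L by blast
  then have "W ` shift_space V L = closed_cspan (W ` (\<Union>\<alpha>. word_op V \<alpha> ` L))"
    unfolding shift_space_def by (rule unitary_image_closed_cspan[OF W X(1)])
  also have "W ` (\<Union>\<alpha>. word_op V \<alpha> ` L) = (\<Union>\<alpha>. word_op V' \<alpha> ` (W ` L))"
    unfolding image_UN image_image using w L by (intro SUP_cong image_cong refl) blast
  finally show ?thesis by (simp add: shift_space_def)
qed

section \<open>Unitary equivalence and coincidence of characteristic functions\<close>

locale dilation_pair = a: min_dilation T K V J + b: min_dilation T' K' V' J'
  for T :: "'d::finite \<Rightarrow> 'g::chilbert_space \<Rightarrow> 'g" and K :: "'k::chilbert_space set" and V J
    and T' :: "'d \<Rightarrow> 'h::chilbert_space \<Rightarrow> 'h" and K' :: "'l::chilbert_space set" and V' J'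
begin

lemma coincide_if_equivalent:
  assumes u: "unitary_op UNIV UNIV u" and uT: "\<And>j x. u (T j x) = T' j (u x)"
  shows "coincide (defect_space T) (star_defect_space T) (char_fun T K V J)
    (defect_space T') (star_defect_space T') (char_fun T' K' V' J')"
proof -
  have u_cinner: "cinner (u x) (u y) = cinner x y" for x y by (rule unitary_cinner[OF u]) simp_all
  have u_surj: "range u = UNIV" by (rule unitary_image[OF u])
  have u_sum: "u (\<Sum>i\<in>I. f i) = (\<Sum>i\<in>I. u (f i))" for I :: "'d set" and f
    by (rule bounded_op_sum[OF unitary_bounded[OF u]]) simp_all
  have u_word: "word_op T' \<alpha> (u h) = u (word_op T \<alpha> h)" for \<alpha> h
    by (induction \<alpha>) (simp_all add: uT)
  have u_adj: "adj UNIV UNIV (T' j) (u h) = u (adj UNIV UNIV (T j) h)" for j h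
  proof (rule adj_eqI[OF closed_csubspace_UNIV csubspace_UNIV b.bounded])
    fix k'
    obtain k where k: "k' = u k" using u_surj by blast
    show "cinner (T' j k') (u h) = cinner k' (u (adj UNIV UNIV (T j) h))"
      by (simp add: k uT[symmetric] u_cinner a.T_adj)
  qed simp_all
  let ?x = "\<lambda>(\<alpha>, h). word_op V \<alpha> (J h)" and ?y = "\<lambda>(\<alpha>, h). word_op V' \<alpha> (J' (u h))"
  have left: "cinner (word_op V' \<alpha> (J' (u h))) (J' (u k)) = cinner (word_op V \<alpha> (J h)) (J k)" for \<alpha> h k
    by (simp add: a.word_J_cinner b.word_J_cinner u_word u_cinner)
  \<comment> \<open>Equal first letters cancel and different ones give 0; once a word is empty the
    value is determined by T alone. Hence u extends to a unitary between the dilation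
    spaces.\<close>
  have "cinner (word_op V \<alpha> (J h)) (word_op V \<beta> (J k))
      = cinner (word_op V' \<alpha> (J' (u h))) (word_op V' \<beta> (J' (u k)))" for \<alpha> \<beta> h k
  proof (induction \<alpha> arbitrary: \<beta>)
    case Nil
    show ?case using left[of \<beta> k h] cinner_commute[of "J h"] cinner_commute[of "J' (u h)"] by simp
  next
    case (Cons i \<alpha>)
    show ?case
    proof (cases \<beta>)
      case Nil
      then show ?thesis using left[of "i # \<alpha>" h k] by simp
    next
      case (Cons j \<gamma>)
      then show ?thesis
        by (simp add: a.V_cinner b.V_cinner a.word_in b.word_in a.J_in b.J_in Cons.IH)
    qed
  qed
  then have "\<exists>W. unitary_op (closed_cspan (range ?x)) (closed_cspan (range ?y)) W \<and> (\<forall>p\<in>UNIV. W (?x p) = ?y p)"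
    by (intro unitary_of_equal_gram) (auto split: prod.splits)
  moreover have "closed_cspan (range ?x) = K"
  proof -
    have "range ?x = (\<Union>\<alpha>. word_op V \<alpha> ` range J)" by auto
    then show ?thesis by (simp only: a.K_eq[unfolded shift_space_def, symmetric])
  qed
  moreover have "closed_cspan (range ?y) = K'"
  proof -
    have "range J' = range (J' \<circ> u)" using u_surj by (metis image_comp)
    then have "range ?y = (\<Union>\<alpha>. word_op V' \<alpha> ` range J')" by auto
    then show ?thesis by (simp only: b.K_eq[unfolded shift_space_def, symmetric])
  qed
  ultimately obtain W where W: "unitary_op K K' W" and Wx: "\<And>\<alpha> h. W (word_op V \<alpha> (J h)) = word_op V' \<alpha> (J' (u h))"
    by auto
  note Wb = unitary_bounded[OF W]
  have WJ: "W (J h) = J' (u h)" for h using Wx[of "[]"] by simp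
  have WVJ: "W (V j (J h)) = V' j (J' (u h))" for j h using Wx[of "[j]"] by simp
  have WV: "W (V j x) = V' j (W x)" if x: "x \<in> K" for j x
  proof (rule bounded_op_eq_on_closed_cspan[OF bounded_op_compose[OF a.V_op Wb] bounded_op_compose[OF Wb b.V_op] a.K])
    show "x \<in> closed_cspan (\<Union>\<alpha>. word_op V \<alpha> ` range J)"
      using x a.K_eq by (simp only: shift_space_def)
    show "(\<Union>\<alpha>. word_op V \<alpha> ` range J) \<subseteq> K" using a.word_in a.J_in by blast
    fix s assume "s \<in> (\<Union>\<alpha>. word_op V \<alpha> ` range J)"
    then obtain \<alpha> h where s: "s = word_op V \<alpha> (J h)" by blast
    show "W (V j s) = V' j (W s)" using Wx[of "j # \<alpha>" h] by (simp add: s Wx)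
  qed
  have W_VJ: "W (a.VJ \<xi>) = b.VJ (\<chi> i. u (\<xi> $ i))" for \<xi>
    unfolding a.VJ_def b.VJ_def by (subst bounded_op_sum[OF Wb a.K_sub]) (simp_all add: a.V_in a.J_in WVJ)
  have W_canon: "W (a.canon_vec \<xi>) = b.canon_vec (\<chi> i. u (\<xi> $ i))" for \<xi>
    unfolding a.canon_vec_def b.canon_vec_def bounded_op_diff[OF Wb a.K_sub a.VJ_in a.J_in] W_VJ WJ
    by (simp add: row_op_def u_sum uT)
  have W_star: "W (a.star_canon_vec h) = b.star_canon_vec (u h)" for h
  proof -
    have "(\<chi> i. u (star_vec T h $ i)) = star_vec T' (u h)" by (simp add: vec_eq_iff u_adj)
    then show ?thesis
      unfolding a.star_canon_vec_def b.star_canon_vec_def bounded_op_diff[OF Wb a.K_sub a.J_in a.VJ_in] W_VJ WJ by simp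
  qed
  have WL: "W ` a.L = b.L"
  proof -
    have "b.canon_vec \<eta> = W (a.canon_vec (\<chi> i. inv u (\<eta> $ i)))" for \<eta>
      by (simp add: W_canon surj_f_inv_f[OF u_surj])
    then have "range b.canon_vec \<subseteq> W ` range a.canon_vec" by auto
    moreover have "W ` range a.canon_vec \<subseteq> range b.canon_vec" using W_canon by auto
    ultimately have "W ` range a.canon_vec = range b.canon_vec" by (rule subset_antisym[rotated])
    then show ?thesis
      unfolding a.L_eq b.L_eq using unitary_image_closed_cspan[OF W a.K, of "range a.canon_vec"] a.canon_vec_in by auto
  qed
  have WLs: "W ` a.L_star = b.L_star"
  proof -
    have "W ` range a.star_canon_vec = range b.star_canon_vec"
      unfolding image_image W_star
      using image_image[of b.star_canon_vec u UNIV] u_surj by simp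
    then show ?thesis
      unfolding a.L_star_eq b.L_star_eq
      using unitary_image_closed_cspan[OF W a.K, of "range a.star_canon_vec"] a.star_canon_vec_in by auto
  qed
  have WS: "W ` a.S_star = b.S_star"
  proof -
    have "W ` a.S_star = shift_space V' (W ` a.L_star)"
    proof (rule unitary_image_shift_space[OF W a.K])
      show "V j x \<in> K" "W (V j x) = V' j (W x)" if "x \<in> K" for j x
        using that by (rule a.V_in, rule WV)
    qed (rule a.star.L_subset)
    then show ?thesis by (simp only: WLs)
  qed
  \<comment> \<open>W transported to the defect spaces through the canonical unitaries.\<close>
  let ?vD = "inv_into (defect_space T') (canon T' V' J') \<circ> (W \<circ> canon T V J)"
  let ?vL = "inv_into (star_defect_space T') (star_canon T' K' V' J') \<circ> (W \<circ> star_canon T K V J)"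
  note DT = closed_csubspace_imp[OF b.closed_defect_space] closed_csubspace_imp[OF b.closed_star_defect_space]
  have vD: "unitary_op (defect_space T) (defect_space T') ?vD"
    by (rule unitary_compose[OF unitary_compose[OF a.canon_unitary unitary_restrict[OF W a.L_subset, unfolded WL]]
          unitary_inv[OF b.canon_unitary DT(1)]])
  have vL: "unitary_op (star_defect_space T) (star_defect_space T') ?vL"
    by (rule unitary_compose[OF unitary_compose[OF a.star_canon_unitary unitary_restrict[OF W a.star.L_subset, unfolded WLs]]
          unitary_inv[OF b.star_canon_unitary DT(2)]])
  have kD: "canon T' V' J' (?vD \<delta>) = W (canon T V J \<delta>)" if \<delta>: "\<delta> \<in> defect_space T" for \<delta>
    unfolding o_def
    by (rule unitary_inv_right[OF b.canon_unitary DT(1)]) (use unitary_in[OF a.canon_unitary \<delta>] WL in blast)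
  have kL: "star_canon T' K' V' J' (?vL \<delta>) = W (star_canon T K V J \<delta>)" if \<delta>: "\<delta> \<in> star_defect_space T" for \<delta>
    unfolding o_def
    by (rule unitary_inv_right[OF b.star_canon_unitary DT(2)]) (use unitary_in[OF a.star_canon_unitary \<delta>] WLs in blast)
  have "op_symbol (char_fun T' K' V' J') (?vD \<delta>) = id_tensor ?vL (op_symbol (char_fun T K V J) \<delta>)"
    if \<delta>: "\<delta> \<in> defect_space T" for \<delta>
  proof -
    note D = closed_csubspace_imp[OF a.closed_defect_space]
    have "op_symbol (char_fun T' K' V' J') (?vD \<delta>) = char_fun T' K' V' J' (id_tensor ?vD (vac_tensor \<delta>))"
      by (simp only: op_symbol_def id_tensor_single[OF unitary_bounded[OF vD] D \<delta>])
    also have "\<dots> = id_tensor ?vL (char_fun T K V J (vac_tensor \<delta>))"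
      unfolding a.char_fun_eq b.char_fun_eq a.char.M_def b.char.M_def
      by (rule compression_transfer[OF a.char.compression_axioms b.char.compression_axioms W a.K_sub
            a.star.S_subset a.wand.S_subset WV WS unitary_bounded[OF vL] kL unitary_bounded[OF vD] kD
            single_in_fock_on[OF D \<delta>]])
    finally show ?thesis by (simp only: op_symbol_def)
  qed
  then show ?thesis unfolding coincide_def using vD vL by blast
qed

lemma equivalent_if_coincide:
  assumes cnc: "completely_non_coisometric T" and cnc': "completely_non_coisometric T'"
    and co: "coincide (defect_space T) (star_defect_space T) (char_fun T K V J)
      (defect_space T') (star_defect_space T') (char_fun T' K' V' J')"
  shows "unitarily_equivalent T T'"
proof -
  obtain vD vL where vD: "unitary_op (defect_space T) (defect_space T') vD"
    and vL: "unitary_op (star_defect_space T) (star_defect_space T') vL"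
    and sym: "\<And>\<delta>. \<delta> \<in> defect_space T \<Longrightarrow> b.char.M (vac_tensor (vD \<delta>)) = id_tensor vL (a.char.M (vac_tensor \<delta>))"
    using co unfolding coincide_def op_symbol_def a.char_fun_eq b.char_fun_eq by blast
  note D = closed_csubspace_imp[OF a.closed_defect_space] and Ds = closed_csubspace_imp[OF a.closed_star_defect_space]
  let ?F = "fock_on (defect_space T) :: ('d, 'g ^ 'd) fock set"
  let ?Fs = "fock_on (star_defect_space T) :: ('d, 'g) fock set"
  let ?iD = "id_tensor vD :: ('d, 'g ^ 'd) fock \<Rightarrow> ('d, 'h ^ 'd) fock"
  let ?iL = "id_tensor vL :: ('d, 'g) fock \<Rightarrow> ('d, 'h) fock"
  let ?U = "canon_K T V J" and ?U' = "canon_K T' V' J'"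
  let ?Us = "star_canon_K T K V J" and ?Us' = "star_canon_K T' K' V' J'"
  have iD: "unitary_op ?F (fock_on (defect_space T')) ?iD" by (rule unitary_id_tensor[OF vD D])
  have iL: "unitary_op ?Fs (fock_on (star_defect_space T')) ?iL" by (rule unitary_id_tensor[OF vL Ds])
  \<comment> \<open>Coincidence is given on symbols only; multi-analyticity spreads it over all
    words.\<close>
  have MM: "b.char.M (?iD x) = ?iL (a.char.M x)" if x: "x \<in> ?F" for x
  proof (rule fock_on_eqI[OF bounded_op_compose[OF unitary_bounded[OF iD] b.char.M_op]
        bounded_op_compose[OF a.char.M_op unitary_bounded[OF iL]] a.closed_defect_space _ x])
    fix \<alpha> \<delta> assume \<delta>: "\<delta> \<in> defect_space T"
    show "b.char.M (?iD (single \<alpha> \<delta>)) = ?iL (a.char.M (single \<alpha> \<delta>))"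
    proof (induction \<alpha>)
      case Nil
      show ?case by (simp only: id_tensor_single[OF unitary_bounded[OF vD] D \<delta>] sym[OF \<delta>])
    next
      case (Cons j \<alpha>)
      have s: "single \<alpha> \<delta> \<in> ?F" by (rule single_in_fock_on[OF D \<delta>])
      have "b.char.M (?iD (creation j (single \<alpha> \<delta>))) = creation j (b.char.M (?iD (single \<alpha> \<delta>)))"
        by (simp only: id_tensor_creation[OF unitary_bounded[OF vD] D s] b.char.M_creation[OF unitary_in[OF iD s]])
      also have "\<dots> = ?iL (a.char.M (creation j (single \<alpha> \<delta>)))"
        by (simp only: Cons.IH a.char.M_creation[OF s]
            id_tensor_creation[OF unitary_bounded[OF vL] Ds bounded_op_in[OF a.char.M_op s]])
      finally show ?case by (simp only: creation_single)
    qed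
  qed
  \<comment> \<open>One family indexed by both Fock spaces, so that a single Gram comparison yields
    W on the two shift parts together.\<close>
  let ?I = "Inl ` ?Fs \<union> Inr ` ?F"
  let ?x = "case_sum ?Us ?U" and ?y = "case_sum (\<lambda>f. ?Us' (?iL f)) (\<lambda>g. ?U' (?iD g))"
  \<comment> \<open>The mixed inner products are <f, M g>; here the coincidence of the functions
    enters.\<close>
  have LR: "cinner (?Us f) (?U g) = cinner (?Us' (?iL f)) (?U' (?iD g))" if f: "f \<in> ?Fs" and g: "g \<in> ?F" for f g
    unfolding a.char.cinner_U1_U2[OF f g] b.char.cinner_U1_U2[OF unitary_in[OF iL f] unitary_in[OF iD g]] MM[OF g]
    by (rule unitary_cinner[OF iL f bounded_op_in[OF a.char.M_op g], symmetric])
  have RL: "cinner (?U g) (?Us f) = cinner (?U' (?iD g)) (?Us' (?iL f))" if "f \<in> ?Fs" and "g \<in> ?F" for f g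
    using LR[OF that] cinner_commute[of "?U g"] cinner_commute[of "?U' (?iD g)"] by simp
  have LL: "cinner (?Us f) (?Us g) = cinner (?Us' (?iL f)) (?Us' (?iL g))" if f: "f \<in> ?Fs" and g: "g \<in> ?Fs" for f g
    unfolding unitary_cinner[OF a.char.U1_un f g] unitary_cinner[OF b.char.U1_un unitary_in[OF iL f] unitary_in[OF iL g]]
    by (rule unitary_cinner[OF iL f g, symmetric])
  have RR: "cinner (?U f) (?U g) = cinner (?U' (?iD f)) (?U' (?iD g))" if f: "f \<in> ?F" and g: "g \<in> ?F" for f g
    unfolding unitary_cinner[OF a.char.U2_un f g] unitary_cinner[OF b.char.U2_un unitary_in[OF iD f] unitary_in[OF iD g]]
    by (rule unitary_cinner[OF iD f g, symmetric])
  have "cinner (?x p) (?x q) = cinner (?y p) (?y q)" if "p \<in> ?I" "q \<in> ?I" for p q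
    using that by (elim UnE imageE) (simp_all only: sum.case LL LR RL RR)
  then have "\<exists>W. unitary_op (closed_cspan (?x ` ?I)) (closed_cspan (?y ` ?I)) W \<and> (\<forall>p\<in>?I. W (?x p) = ?y p)"
    by (rule unitary_of_equal_gram)
  moreover have xI: "?x ` ?I = a.S_star \<union> a.S"
    unfolding image_Un image_image sum.case using unitary_image[OF a.char.U1_un] unitary_image[OF a.char.U2_un] by simp
  moreover have "?y ` ?I = b.S_star \<union> b.S"
  proof -
    have "?y ` ?I = ?Us' ` ?iL ` ?Fs \<union> ?U' ` ?iD ` ?F" by (simp only: image_Un image_image sum.case)
    then show ?thesis
      using unitary_image[OF iL] unitary_image[OF iD] unitary_image[OF b.char.U1_un] unitary_image[OF b.char.U2_un] by simp
  qed
  ultimately obtain W where W: "unitary_op K K' W" and Wx: "\<forall>p\<in>?I. W (?x p) = ?y p"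
    using a.cspan_S_star_S[OF cnc] b.cspan_S_star_S[OF cnc'] by auto
  have WUs: "W (?Us f) = ?Us' (?iL f)" if "f \<in> ?Fs" for f using bspec[OF Wx, of "Inl f"] that by simp
  have WU: "W (?U f) = ?U' (?iD f)" if "f \<in> ?F" for f using bspec[OF Wx, of "Inr f"] that by simp
  note Wb = unitary_bounded[OF W]
  have WV: "W (V j x) = V' j (W x)" if x: "x \<in> K" for j x
  proof (rule bounded_op_eq_on_closed_cspan[OF bounded_op_compose[OF a.V_op Wb] bounded_op_compose[OF Wb b.V_op] a.K])
    show "x \<in> closed_cspan (a.S_star \<union> a.S)" using x a.cspan_S_star_S[OF cnc] by simp
    show "a.S_star \<union> a.S \<subseteq> K" using a.star.S_subset a.wand.S_subset by blast
    fix s assume "s \<in> a.S_star \<union> a.S"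
    then consider f where "f \<in> ?Fs" "s = ?Us f" | g where "g \<in> ?F" "s = ?U g"
      using unitary_image[OF a.char.U1_un] unitary_image[OF a.char.U2_un] by blast
    then show "W (V j s) = V' j (W s)"
    proof cases
      case 1
      have "W (?Us (creation j f)) = ?Us' (creation j (?iL f))"
        by (simp only: WUs[OF bounded_op_in[OF bounded_op_creation[OF Ds] 1(1)]]
            id_tensor_creation[OF unitary_bounded[OF vL] Ds 1(1)])
      then show ?thesis
        by (simp only: 1(2) WUs[OF 1(1)] fock_ext_creation[OF a.star_canon_K_ext 1(1)]
            fock_ext_creation[OF b.star_canon_K_ext unitary_in[OF iL 1(1)]])
    next
      case 2
      have "W (?U (creation j g)) = ?U' (creation j (?iD g))"
        by (simp only: WU[OF bounded_op_in[OF bounded_op_creation[OF D] 2(1)]]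
            id_tensor_creation[OF unitary_bounded[OF vD] D 2(1)])
      then show ?thesis
        by (simp only: 2(2) WU[OF 2(1)] fock_ext_creation[OF a.canon_K_ext 2(1)]
            fock_ext_creation[OF b.canon_K_ext unitary_in[OF iD 2(1)]])
    qed
  qed
  have S_sub: "a.S \<subseteq> K" by (rule a.wand.S_subset)
  have WS: "W ` a.S = b.S"
  proof -
    have "W ` ?U ` ?F = ?U' ` ?iD ` ?F" unfolding image_image by (rule image_cong[OF refl WU])
    then show ?thesis
      using unitary_image[OF iD] unitary_image[OF a.char.U2_un] unitary_image[OF b.char.U2_un] by simp
  qed
  have orth_iff: "W x \<in> orth b.S \<longleftrightarrow> x \<in> orth a.S" if x: "x \<in> K" for x
  proof -
    have "cinner (W x) (W y) = cinner x y" if "y \<in> a.S" for y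
      by (rule unitary_cinner[OF W x subsetD[OF S_sub that]])
    then show ?thesis unfolding WS[symmetric] by (simp add: orth_def)
  qed
  \<comment> \<open>The space of T is the complement of S in K, and W respects K and S.\<close>
  have WH: "W ` a.H = b.H"
  proof
    show "W ` a.H \<subseteq> b.H"
    proof (rule image_subsetI)
      fix x assume x: "x \<in> a.H"
      have xK: "x \<in> K" using x a.J_subset by blast
      have "x \<in> orth a.S" by (rule orthI) (rule orthD'[OF subsetD[OF a.S_orth_H] x])
      then show "W x \<in> b.H" by (intro b.orth_S_in_H unitary_in[OF W xK]) (simp only: orth_iff[OF xK])
    qed
    show "b.H \<subseteq> W ` a.H"
    proof
      fix y assume y: "y \<in> b.H"
      then obtain x where x: "x \<in> K" "y = W x" using b.J_subset unitary_image[OF W] by blast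
      have "W x \<in> orth b.S" unfolding x(2)[symmetric] by (rule orthI) (rule orthD'[OF subsetD[OF b.S_orth_H] y])
      then have "x \<in> a.H" by (intro a.orth_S_in_H x(1)) (simp only: orth_iff[OF x(1)])
      then show "y \<in> W ` a.H" using x(2) by blast
    qed
  qed
  let ?u = "inv_into UNIV J' \<circ> (W \<circ> J)"
  have u: "unitary_op UNIV UNIV ?u"
    by (rule unitary_compose[OF unitary_compose[OF a.J unitary_restrict[OF W a.J_subset, unfolded WH]]
          unitary_inv[OF b.J csubspace_UNIV]])
  have Ju: "J' (?u h) = W (J h)" for h
    unfolding o_def by (rule unitary_inv_right[OF b.J csubspace_UNIV]) (use WH in blast)
  \<comment> \<open>T_j is the compression of V_j, so the intertwining of V and V' is tested against
    vectors of the embedded space.\<close>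
  have "?u (T j h) = T' j (?u h)" for j h
  proof (rule cc_eq_by_cinner[OF csubspace_UNIV UNIV_I UNIV_I])
    fix k'
    obtain k where k: "k' = ?u k" using unitary_image[OF u] by blast
    have "cinner (T' j (?u h)) (?u k) = cinner (V' j (J' (?u h))) (J' (?u k))"
      using b.word_J_cinner[of "[j]"] by simp
    also have "\<dots> = cinner (W (V j (J h))) (W (J k))" by (simp only: Ju WV[OF a.J_in])
    also have "\<dots> = cinner (V j (J h)) (J k)" by (rule unitary_cinner[OF W a.V_in[OF a.J_in] a.J_in])
    also have "\<dots> = cinner (T j h) k" using a.word_J_cinner[of "[j]"] by simp
    also have "\<dots> = cinner (?u (T j h)) (?u k)" by (rule unitary_cinner[OF u UNIV_I UNIV_I, symmetric])
    finally show "cinner (?u (T j h)) k' = cinner (T' j (?u h)) k'" by (simp only: k)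
  qed
  then show ?thesis unfolding unitarily_equivalent_def using u by blast
qed

end
theorem theorem4p5:
  shows
   "(\<forall>(C :: 'd::finite \<Rightarrow> 'c::chilbert_space \<Rightarrow> 'c) (B :: 'd \<Rightarrow> 'c \<Rightarrow> 'a::chilbert_space) (A :: 'd \<Rightarrow> 'a \<Rightarrow> 'a)
       (K :: 'k::chilbert_space set) V J.
       row_contraction C \<longrightarrow> minimal_contractive_lifting C B A \<longrightarrow>
       minimal_isometric_dilation (lifting C B A) K V J \<longrightarrow>
       (let M = lifting_char_fun C B A V J; D\<^sub>E = defect_space (lifting C B A); D\<^sub>C = defect_space C
        in (purely_contractive D\<^sub>E D\<^sub>C M \<and> szego_condition D\<^sub>E D\<^sub>C M \<longleftrightarrow> wandering_spaces_agree K V J) \<and>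
           (wandering_spaces_agree K V J \<longrightarrow> char_funs_agree C B A K V J)))
    \<and>
    (\<forall>(A :: 'd \<Rightarrow> 'a \<Rightarrow> 'a) (C :: 'd \<Rightarrow> 'c \<Rightarrow> 'c).
       row_contraction A \<longrightarrow> completely_non_coisometric A \<longrightarrow> row_contraction C \<longrightarrow>
       same_hilbert_dim (defect_space C) (star_defect_space A) \<longrightarrow>
       (\<exists>B. minimal_contractive_lifting C B A \<and>
          (\<forall>(K :: 'k set) V J. minimal_isometric_dilation (lifting C B A) K V J \<longrightarrow>
             wandering_spaces_agree K V J \<and> char_funs_agree C B A K V J)))
    \<and>
    (\<forall>(A :: 'd \<Rightarrow> 'a \<Rightarrow> 'a) (A' :: 'd \<Rightarrow> 'b::chilbert_space \<Rightarrow> 'b)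
       (K :: 'k set) V J (K' :: 'l::chilbert_space set) V' J'.
       row_contraction A \<longrightarrow> completely_non_coisometric A \<longrightarrow>
       row_contraction A' \<longrightarrow> completely_non_coisometric A' \<longrightarrow>
       minimal_isometric_dilation A K V J \<longrightarrow> minimal_isometric_dilation A' K' V' J' \<longrightarrow>
       (coincide (defect_space A) (star_defect_space A) (char_fun A K V J)
                 (defect_space A') (star_defect_space A') (char_fun A' K' V' J')
        \<longleftrightarrow> unitarily_equivalent A A'))"
proof (intro conjI allI impI)
  fix C :: "'d \<Rightarrow> 'c \<Rightarrow> 'c" and B :: "'d \<Rightarrow> 'c \<Rightarrow> 'a" and A :: "'d \<Rightarrow> 'a \<Rightarrow> 'a" and K :: "'k set" and V J
  assume "row_contraction C" "minimal_contractive_lifting C B A" "minimal_isometric_dilation (lifting C B A) K V J"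
  then interpret lifting_dilation C B A K V J by unfold_locales
  show "let M = lifting_char_fun C B A V J; D\<^sub>E = defect_space (lifting C B A); D\<^sub>C = defect_space C
        in (purely_contractive D\<^sub>E D\<^sub>C M \<and> szego_condition D\<^sub>E D\<^sub>C M \<longleftrightarrow> wandering_spaces_agree K V J) \<and>
           (wandering_spaces_agree K V J \<longrightarrow> char_funs_agree C B A K V J)"
    unfolding Let_def using characterization char_funs_agree_if by blast
next
  fix A :: "'d \<Rightarrow> 'a \<Rightarrow> 'a" and C :: "'d \<Rightarrow> 'c \<Rightarrow> 'c"
  assume A: "row_contraction A" "completely_non_coisometric A" and C: "row_contraction C"
    and dim: "same_hilbert_dim (defect_space C) (star_defect_space A)"
  obtain \<gamma> where \<gamma>: "unitary_op (defect_space C) (star_defect_space A) \<gamma>"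
    using same_hilbert_dim_unitary[OF dim] by blast
  interpret canonical_lifting C A \<gamma> by unfold_locales (rule A C \<gamma>)+
  show "\<exists>B. minimal_contractive_lifting C B A \<and>
          (\<forall>(K :: 'k set) V J. minimal_isometric_dilation (lifting C B A) K V J \<longrightarrow>
             wandering_spaces_agree K V J \<and> char_funs_agree C B A K V J)"
    using minimal_contractive agree by blast
next
  fix A :: "'d \<Rightarrow> 'a \<Rightarrow> 'a" and A' :: "'d \<Rightarrow> 'b \<Rightarrow> 'b" and K :: "'k set" and V J and K' :: "'l set" and V' J'
  assume A: "row_contraction A" "completely_non_coisometric A"
    and A': "row_contraction A'" "completely_non_coisometric A'"
    and dil: "minimal_isometric_dilation A K V J" and dil': "minimal_isometric_dilation A' K' V' J'"
  interpret dilation_pair A K V J A' K' V' J'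
    by (intro dilation_pair.intro min_dilationI A A' dil dil')
  show "coincide (defect_space A) (star_defect_space A) (char_fun A K V J)
                 (defect_space A') (star_defect_space A') (char_fun A' K' V' J')
        \<longleftrightarrow> unitarily_equivalent A A'"
    using equivalent_if_coincide[OF A(2) A'(2)] coincide_if_equivalent
    unfolding unitarily_equivalent_def by blast
qed

end
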